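(* Let $1<\beta\le 2$ and $t\in\mathbb{R}$. Let $\phi_t(z)=\sum_{n=1}^\infty q_n(1)H_{n-1}(t,\underline{1})z^n$, let $\lambda_t$ be the inverse of the unique positive zero of $1-\phi_t(z)$, and let $\mu_t$ be an equilibrium state on $X_\beta$ with respect to the potential $t\chi_{C_1}$. Then $$\alpha(t):=\int_{X_\beta}\chi_{C_1}\,d\mu_t=\frac{1}{F(t)}\sum_{n=1}^\infty\Bigl(\sum_{i=1}^n q_i(1)-1\Bigr)\frac{q_n(1)H_{n-1}(t,\underline{1})}{\lambda_t^n},\qquad F(t)=\sum_{n=1}^\infty\frac{n\,q_n(1)H_{n-1}(t,\underline{1})}{\lambda_t^n},$$ and $$\dim_H(\Lambda_{\alpha(t)})=\frac{\log\lambda_t-t\,\alpha(t)}{\log\beta}.$$ In particular, if $\beta\in(1,2)$ is simple, i.e. there is a positive integer $n_0\ge 2$ such that $\tau_\beta^{n_0-1}(1)=1/\beta$, then $\alpha(t)$ is given by $$\alpha(t)=\frac{1}{\widehat F(t)}\left(\sum_{l=1}^{n_0-1}\frac{g_{l+1}(1)H_l(t,(g_m(1))_{m=1}^\infty)}{\lambda_t^l}\sum_{n=1}^{n_0-l}\frac{g_{n+l}(1)H_{n-1}(t,(g_{m+l}(1))_{m=1}^\infty)}{\lambda_t^n}\right),$$ where $$\widehat F(t)=\sum_{l=0}^{n_0-1}\frac{H_l(t,(g_m(1))_{m=1}^\infty)}{\lambda_t^l}\sum_{n=1}^{n_0-l}\frac{g_{n+l}(1)H_{n-1}(t,(g_{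m+l}(1))_{m=1}^\infty)}{\lambda_t^n}.$$
   Context: For $1<\beta\le2$, $\tau_\beta(x)=\beta x-[\beta x]$ on $[0,1]$ ($[y]$ is the integer part) and $g_n(x)=[\beta\tau_\beta^{n-1}(x)]$, $n\ge1$, are the greedy digits of $x$. The space $\{0,1\}^{\mathbb N}$ carries the product topology, the lexicographic order $\preceq$ and the left shift $\sigma$. Put $\underline{1}=(q_n(1))_{n\ge1}:=\lim_{y\nearrow1}(g_n(y))_{n\ge1}$ (the quasi-greedy expansion of $1$). The beta-shift is $X_\beta=\{\underline{x}\in\{0,1\}^{\mathbb N}:\sigma^n(\underline{x})\preceq\underline{1}\text{ for all }n\ge0\}$ with the map $\sigma$; it is the closure of the set of greedy digit sequences of points of $[0,1)$. $C_1=\{(x_i)_{i\ge1}\in X_\beta:x_1=1\}$ and $\chi_{C_1}$ is its indicator function. For a sequence $\underline{x}=(x_i)_{i\ge1}\in\{0,1\}^{\mathbb N}$ and $t\in\mathbb R$: $H_0(t,\underline{x})=1$ and $H_n(t,\underline{x})=\exp(t\sum_{i=1}^n x_i)$ for $n\ge1$. An equilibrium state for a potential $\phi$ is a $\sigma$-invariant Borel probability measure $\mu$ on $X_\beta$ attaining $\sup_m\{h_m(\sigma)+\int\phi\,dm\}$, the supremum being over all $\sigma$-invariant Borel probability measures $m$ ($h_m(\sigma)$ is the measure-theoretic entropy). For $\alpha\in[0,1]$, $\Lambda_\alpha=\{(x_i)_{i\ge1}\in X_\beta:\lim_{n\to\infty}\frac1n\sum_{i=1}^n x_i=\alpha\}$.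 Hausdorff dimension on $X_\beta$ is taken with respect to the metric $d_\beta(\underline{x},\underline{y})=\beta^{-\min\{k\ge0:\,x_{k+1}\ne y_{k+1}\}}$ for $\underline x\ne\underline y$. *)

theory Defs
  imports
    "HOL-Analysis.Analysis"
    "HOL-Probability.Probability_Measure"
    "HOL-Library.Fun_Lexorder"
    "HOL-Library.Disjoint_Sets"
begin

text \<open>
  A sequence \<open>(x\<^sub>i)\<close>, \<open>i \<ge> 1\<close>, is represented by a function \<open>x :: nat \<Rightarrow> nat\<close> whose value \<open>x i\<close> at
  \<open>i \<ge> 0\<close> is the coordinate number \<open>i + 1\<close>. The type \<open>nat \<Rightarrow> nat\<close> carries the product
  of the discrete topologies, and hence \<open>borel\<close> is the Borel sigma-algebra of that topology.
  The individual digits \<open>greedy_digit \<beta> n x\<close> and \<open>quasi_greedy_digit \<beta> n\<close> are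
  numbered from \<open>n = 1\<close>.
\<close>

section \<open>Beta-expansions and the beta-shift\<close>

definition beta_map :: "real \<Rightarrow> real \<Rightarrow> real" where
  "beta_map \<beta> x = \<beta> * x - real_of_int \<lfloor>\<beta> * x\<rfloor>"

definition greedy_digit :: "real \<Rightarrow> nat \<Rightarrow> real \<Rightarrow> nat" where
  "greedy_digit \<beta> n x = nat \<lfloor>\<beta> * (beta_map \<beta> ^^ (n - 1)) x\<rfloor>"

definition greedy_seq :: "real \<Rightarrow> real \<Rightarrow> nat \<Rightarrow> nat" where
  "greedy_seq \<beta> x = (\<lambda>i. greedy_digit \<beta> (i + 1) x)"

text \<open>
  The limit is taken in the product topology. \<open>Lim\<close> is written out because it requires an instance
  of the class \<open>t2_space\<close>, which the library does not supply for \<open>nat \<Rightarrow> nat\<close>.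
\<close>

definition quasi_greedy_seq :: "real \<Rightarrow> nat \<Rightarrow> nat" where
  "quasi_greedy_seq \<beta> = (THE s. ((\<lambda>y. greedy_seq \<beta> y) \<longlongrightarrow> s) (at_left 1))"

definition quasi_greedy_digit :: "real \<Rightarrow> nat \<Rightarrow> nat" where
  "quasi_greedy_digit \<beta> n = quasi_greedy_seq \<beta> (n - 1)"

definition shift :: "(nat \<Rightarrow> nat) \<Rightarrow> (nat \<Rightarrow> nat)" where
  "shift x = (\<lambda>i. x (i + 1))"

definition lex_le :: "(nat \<Rightarrow> nat) \<Rightarrow> (nat \<Rightarrow> nat) \<Rightarrow> bool" where
  "lex_le x y \<longleftrightarrow> x = y \<or> less_fun x y"

definition beta_shift :: "real \<Rightarrow> (nat \<Rightarrow> nat) set" where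
  "beta_shift \<beta> = {x. (\<forall>i. x i \<in> {0, 1}) \<and> (\<forall>n. lex_le ((shift ^^ n) x) (quasi_greedy_seq \<beta>))}"

definition one_cylinder :: "real \<Rightarrow> (nat \<Rightarrow> nat) set" where
  "one_cylinder \<beta> = {x \<in> beta_shift \<beta>. x 0 = 1}"

definition frequency_set :: "real \<Rightarrow> real \<Rightarrow> (nat \<Rightarrow> nat) set" where
  "frequency_set \<beta> a = {x \<in> beta_shift \<beta>. (\<lambda>n. (\<Sum>i<n. real (x i)) / real n) \<longlonglongrightarrow> a}"

definition beta_dist :: "real \<Rightarrow> (nat \<Rightarrow> nat) \<Rightarrow> (nat \<Rightarrow> nat) \<Rightarrow> real" where
  "beta_dist \<beta> x y = (if x = y then 0 else 1 / \<beta> ^ (LEAST k. x k \<noteq> y k))"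

section \<open>The power series of the potential\<close>

definition H :: "nat \<Rightarrow> real \<Rightarrow> (nat \<Rightarrow> nat) \<Rightarrow> real" where
  "H n t x = exp (t * (\<Sum>i<n. real (x i)))"

definition phi_term :: "real \<Rightarrow> real \<Rightarrow> real \<Rightarrow> nat \<Rightarrow> real" where
  "phi_term \<beta> t z n = real (quasi_greedy_digit \<beta> n) * H (n - 1) t (quasi_greedy_seq \<beta>) * z ^ n"

text \<open>Series over \<open>n \<ge> 1\<close> are written with \<open>Suc n\<close> in place of \<open>n\<close>.\<close>

definition phi :: "real \<Rightarrow> real \<Rightarrow> real \<Rightarrow> real" where
  "phi \<beta> t z = (\<Sum>n. phi_term \<beta> t z (Suc n))"

text \<open>
  The series for \<open>phi\<close> may have a finite radius of convergence; a zero of \<open>1 - phi \<beta> t\<close> has to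
  be a point at which the series converges, since \<open>suminf\<close> is unspecified elsewhere.
\<close>

definition lam :: "real \<Rightarrow> real \<Rightarrow> real" where
  "lam \<beta> t = inverse (THE z. 0 < z \<and> summable (\<lambda>n. phi_term \<beta> t z (Suc n)) \<and> 1 - phi \<beta> t z = 0)"

definition F :: "real \<Rightarrow> real \<Rightarrow> real" where
  "F \<beta> t = (\<Sum>n. real (Suc n) * real (quasi_greedy_digit \<beta> (Suc n))
                  * H n t (quasi_greedy_seq \<beta>) / lam \<beta> t ^ Suc n)"

definition F_hat :: "real \<Rightarrow> real \<Rightarrow> nat \<Rightarrow> real" where
  "F_hat \<beta> t n0 =
     (\<Sum>l = 0..n0 - 1. H l t (greedy_seq \<beta> 1) / lam \<beta> t ^ l *
        (\<Sum>n = 1..n0 - l. real (greedy_digit \<beta> (n + l) 1)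
             * H (n - 1) t ((shift ^^ l) (greedy_seq \<beta> 1)) / lam \<beta> t ^ n))"

section \<open>Measure-theoretic entropy and equilibrium states\<close>

definition finite_measurable_partition :: "'a measure \<Rightarrow> 'a set set \<Rightarrow> bool" where
  "finite_measurable_partition m P \<longleftrightarrow> finite P \<and> P \<subseteq> sets m \<and> partition_on (space m) P"

text \<open>Uses \<open>0 * ln 0 = 0\<close>.\<close>

definition partition_entropy :: "'a measure \<Rightarrow> 'a set set \<Rightarrow> real" where
  "partition_entropy m P = - (\<Sum>A\<in>P. measure m A * ln (measure m A))"

text \<open>
  The join of \<open>P, T\<^sup>-\<^sup>1 P, \<dots>\<close> over \<open>n\<close> time steps. The empty set may occur as an element; it
  does not contribute to the entropy.
\<close>

definition iterated_join :: "'a measure \<Rightarrow> ('a \<Rightarrow> 'a) \<Rightarrow> 'a set set \<Rightarrow> nat \<Rightarrow> 'a set set" where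
  "iterated_join m T P n =
     {(\<Inter>i\<in>{..<n}. (T ^^ i) -` c i) \<inter> space m | c. \<forall>i<n. c i \<in> P}"

definition entropy_wrt_partition :: "'a measure \<Rightarrow> ('a \<Rightarrow> 'a) \<Rightarrow> 'a set set \<Rightarrow> real" where
  "entropy_wrt_partition m T P = lim (\<lambda>n. partition_entropy m (iterated_join m T P n) / real n)"

definition ks_entropy :: "'a measure \<Rightarrow> ('a \<Rightarrow> 'a) \<Rightarrow> ereal" where
  "ks_entropy m T = (SUP P\<in>{P. finite_measurable_partition m P}. ereal (entropy_wrt_partition m T P))"

definition invariant_measures :: "'a::topological_space set \<Rightarrow> ('a \<Rightarrow> 'a) \<Rightarrow> 'a measure set" where
  "invariant_measures X T =
     {m. prob_space m \<and> sets m = sets (restrict_space borel X) \<and> T \<in> measurable m m \<and> distr m m T = m}"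

definition equilibrium_state ::
  "'a::topological_space set \<Rightarrow> ('a \<Rightarrow> 'a) \<Rightarrow> ('a \<Rightarrow> real) \<Rightarrow> 'a measure \<Rightarrow> bool" where
  "equilibrium_state X T f \<mu> \<longleftrightarrow>
     \<mu> \<in> invariant_measures X T \<and>
     ks_entropy \<mu> T + ereal (\<integral>x. f x \<partial>\<mu>) =
       (SUP m\<in>invariant_measures X T. ks_entropy m T + ereal (\<integral>x. f x \<partial>m))"

section \<open>Hausdorff dimension\<close>

text \<open>
  Hausdorff dimension of a subset \<open>A\<close> of a set \<open>X\<close> with metric \<open>d\<close>, by countable covers with subsets
  of \<open>X\<close>. The metric is an explicit argument because \<open>beta_dist \<beta>\<close> is not the metric of a type
  class instance. The case distinction in \<open>diam_power\<close> implements \<open>0\<^sup>0 = 1\<close> for nonempty sets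
  (in Isabelle, \<open>0 powr 0 = 0\<close>).
\<close>

definition diam :: "('a \<Rightarrow> 'a \<Rightarrow> real) \<Rightarrow> 'a set \<Rightarrow> real" where
  "diam d U = (if U = {} then 0 else SUP (x, y)\<in>U \<times> U. d x y)"

definition diam_power :: "('a \<Rightarrow> 'a \<Rightarrow> real) \<Rightarrow> real \<Rightarrow> 'a set \<Rightarrow> real" where
  "diam_power d s U = (if U = {} then 0 else if s = 0 then 1 else diam d U powr s)"

definition delta_covers ::
  "'a set \<Rightarrow> ('a \<Rightarrow> 'a \<Rightarrow> real) \<Rightarrow> real \<Rightarrow> 'a set \<Rightarrow> (nat \<Rightarrow> 'a set) set" where
  "delta_covers X d \<delta> A =
     {U. (\<forall>i. U i \<subseteq> X \<and> (\<forall>x\<in>U i. \<forall>y\<in>U i. d x y \<le> \<delta>)) \<and> A \<subseteq> (\<Union>i. U i)}"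

definition hausdorff_measure ::
  "'a set \<Rightarrow> ('a \<Rightarrow> 'a \<Rightarrow> real) \<Rightarrow> real \<Rightarrow> 'a set \<Rightarrow> ennreal" where
  "hausdorff_measure X d s A =
     (SUP \<delta>\<in>{0<..}. INF U\<in>delta_covers X d \<delta> A. \<Sum>i. ennreal (diam_power d s (U i)))"

definition hausdorff_dim :: "'a set \<Rightarrow> ('a \<Rightarrow> 'a \<Rightarrow> real) \<Rightarrow> 'a set \<Rightarrow> ereal" where
  "hausdorff_dim X d A = (INF s\<in>{s. 0 \<le> s \<and> hausdorff_measure X d s A = 0}. ereal s)"

end

theory Submission
  imports Defs "HOL-Probability.Information"
begin

text \<open>
  A word that is not a prefix of the quasi-greedy expansion \<open>q\<close> first leaves \<open>q\<close> at a digit \<open>1\<close> and is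
  then arbitrary. The weighted counts of admissible words therefore satisfy a renewal inequality with
  generating series \<open>phi\<close>, which bounds them by a multiple of \<open>lam \<beta> t ^ n\<close>; since ones of \<open>q\<close> may be
  erased, the zero of \<open>1 - phi\<close> exists and lies strictly inside the disc of convergence.

  Coding Lebesgue measure by the greedy map with slopes \<open>lam \<beta> t\<close> and \<open>lam \<beta> t / exp t\<close>, and using
  Parry's density, gives an invariant measure \<open>gibbs t\<close> whose cylinders have measure at most
  \<open>C * H n t x / lam \<beta> t ^ n\<close>. Its free energy is at least \<open>ln (lam \<beta> t)\<close>, and the word counts show that
  no invariant measure exceeds this value, for any parameter. So \<open>\<alpha>\<close> is a subgradient at \<open>t\<close> of
  \<open>s \<mapsto> ln (lam \<beta> s)\<close>: the value of \<open>phi\<close> along the tangent line is at least \<open>1\<close>, with equality at \<open>t\<close>,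
  and the vanishing of its derivative is the formula for \<open>\<alpha>\<close>.

  The upper bound for the dimension covers the frequency set by words of nearly the right frequency. For
  the lower bound, the word counts at parameters near \<open>t\<close> give large deviation estimates, by which
  \<open>gibbs t\<close> is carried by the frequency set, and the mass distribution principle applies.
\<close>


section \<open>The quasi-greedy expansion and the beta-shift\<close>

text \<open>The obstacle is differentiability. At the zero \<open>1 / lam \<beta> t\<close> the
  series \<open>phi\<close> can be differentiated only if it converges beyond that point, and for t
  > 0 the coefficients alone do not show this: a high density of ones in \<open>q\<close> makes
  \<open>H\<close> large. Erasure decides it, because a prefix with k ones has weight
  \<open>exp (t * k)\<close>, while the words below it have total weight
  \<open>(1 + exp t) ^ k\<close>. The slopes of the coding come from asking that Lebesgue measure
  give the cylinder of a word x at most the weight \<open>H n t x / lam \<beta> t ^ n\<close>. The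
  branch of the digit 1 is then cut off at the point 1, and the equation phi = 1 keeps the orbit of
  1 with digits \<open>q\<close> inside the unit interval. An equilibrium state is not identified
  with \<open>gibbs t\<close>. Only its frequency of ones enters, and the subgradient inequalities
  determine this number. The measure \<open>gibbs t\<close> has two roles: a competitor that bounds
  the supremum from below, and a mass on the frequency set.\<close>

lemma shift_funpow: "(shift ^^ n) x = (\<lambda>i. x (i + n))"
  by (induction n arbitrary: x) (auto simp: shift_def fun_eq_iff)

lemma shift_funpow_apply [simp]: "(shift ^^ n) x i = x (i + n)"
  by (simp add: shift_funpow)

lemma shift_apply: "shift x i = x (Suc i)"
  by (simp add: shift_def)

lemma lex_le_refl [simp]: "lex_le x x"
  by (simp add: lex_le_def)

lemma lex_le_trans: "lex_le x y \<Longrightarrow> lex_le y z \<Longrightarrow> lex_le x z"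
  unfolding lex_le_def using less_fun_trans by blast

lemma lex_le_cases:
  assumes "lex_le x y" "x \<noteq> y"
  obtains j where "x j < y j" "\<And>i. i < j \<Longrightarrow> x i = y i"
  using assms unfolding lex_le_def less_fun_def by blast

lemma first_difference:
  assumes "x \<noteq> (y :: nat \<Rightarrow> nat)"
  obtains j where "x j \<noteq> y j" "\<And>i. i < j \<Longrightarrow> x i = y i"
proof -
  have "\<exists>j. x j \<noteq> y j" using assms by auto
  then show ?thesis
    using that[of "LEAST j. x j \<noteq> y j"] by (metis (mono_tags, lifting) LeastI not_less_Least)
qed

lemma lex_leI:
  assumes "\<And>j. x j \<noteq> y j \<Longrightarrow> (\<And>i. i < j \<Longrightarrow> x i = y i) \<Longrightarrow> x j < y j"
  shows "lex_le x y"
proof (cases "x = y")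
  case False
  then obtain j where "x j \<noteq> y j" "\<And>i. i < j \<Longrightarrow> x i = y i"
    using first_difference by blast
  with assms show ?thesis
    unfolding lex_le_def less_fun_def by blast
qed simp

lemma lex_le_pointwise: "(\<And>i. x i \<le> y i) \<Longrightarrow> lex_le x y"
  by (rule lex_leI) (simp add: order_less_le)

section \<open>The quasi-greedy expansion as an orbit from the left\<close>

lemma tendsto_fun_iff:
  fixes l :: "'a \<Rightarrow> 'b::topological_space"
  shows "(f \<longlongrightarrow> l) G \<longleftrightarrow> (\<forall>i. ((\<lambda>x. f x i) \<longlongrightarrow> l i) G)"
  using limitin_componentwise[of "\<lambda>_. euclidean" UNIV f l G]
  by (simp add: euclidean_product_topology)

text \<open>The orbit of 1 under the left-continuous version of \<open>beta_map\<close>: ceiling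
  minus 1 replaces the floor, so the values stay in (0, 1] and are the limits of the orbits of
  points y < 1.\<close>

primrec left_orbit :: "real \<Rightarrow> nat \<Rightarrow> real" where
  "left_orbit \<beta> 0 = 1"
| "left_orbit \<beta> (Suc n) = \<beta> * left_orbit \<beta> n - (real_of_int \<lceil>\<beta> * left_orbit \<beta> n\<rceil> - 1)"

locale beta_expansion =
  fixes \<beta> :: real
  assumes beta_gt_1: "1 < \<beta>" and beta_le_2: "\<beta> \<le> 2"
begin

abbreviation "q \<equiv> quasi_greedy_seq \<beta>"

lemma left_orbit_bounds: "0 < left_orbit \<beta> n" "left_orbit \<beta> n \<le> 1"
proof -
  have "0 < left_orbit \<beta> n \<and> left_orbit \<beta> n \<le> 1"
  proof (induction n)
    case (Suc n)
    then show ?case by simp linarith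
  qed simp
  then show "0 < left_orbit \<beta> n" "left_orbit \<beta> n \<le> 1" by auto
qed

lemma left_orbit_digit: "\<lceil>\<beta> * left_orbit \<beta> n\<rceil> = 1 \<or> \<lceil>\<beta> * left_orbit \<beta> n\<rceil> = 2"
proof -
  have "0 < \<beta> * left_orbit \<beta> n" using beta_gt_1 left_orbit_bounds(1) by simp
  moreover have "\<beta> * left_orbit \<beta> n \<le> 2 * 1"
    using beta_gt_1 beta_le_2 left_orbit_bounds[of n] by (intro mult_mono) auto
  ultimately have "0 < \<lceil>\<beta> * left_orbit \<beta> n\<rceil>" "\<lceil>\<beta> * left_orbit \<beta> n\<rceil> \<le> 2"
    by (auto simp: ceiling_le_iff)
  then show ?thesis by linarith
qed

text \<open>The orbit of y trails the left orbit by a gap that is multiplied by \<beta> in each step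
  as long as the digits agree; for y close to 1 the first n digits do agree.\<close>

lemma eventually_beta_map:
  "\<forall>\<^sub>F y in at_left 1. (beta_map \<beta> ^^ n) y = left_orbit \<beta> n - \<beta> ^ n * (1 - y) \<and>
     \<lfloor>\<beta> * (beta_map \<beta> ^^ n) y\<rfloor> = \<lceil>\<beta> * left_orbit \<beta> n\<rceil> - 1"
proof -
  have step: "\<forall>\<^sub>F y in at_left 1. (beta_map \<beta> ^^ n) y = left_orbit \<beta> n - \<beta> ^ n * (1 - y) \<longrightarrow>
      \<lfloor>\<beta> * (beta_map \<beta> ^^ n) y\<rfloor> = \<lceil>\<beta> * left_orbit \<beta> n\<rceil> - 1" for n
  proof -
    \<comment> \<open>\<open>?c\<close> is the distance from
      \<open>\<beta> * left_orbit \<beta> n\<close> to the next integer strictly below it. As long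
      as the gap \<open>\<beta> ^ Suc n * (1 - y)\<close> is smaller, the floor is that
      integer.\<close>
    let ?c = "left_orbit \<beta> (Suc n)"
    have "1 - ?c / \<beta> ^ Suc n < 1"
      using left_orbit_bounds(1)[of "Suc n"] beta_gt_1 by (simp del: left_orbit.simps)
    then have "\<forall>\<^sub>F y in at_left 1. y \<in> {1 - ?c / \<beta> ^ Suc n<..<1}"
      by (rule eventually_at_left_real)
    then show ?thesis
    proof (rule eventually_mono, intro impI)
      fix y assume y: "y \<in> {1 - ?c / \<beta> ^ Suc n<..<1}"
        and eq: "(beta_map \<beta> ^^ n) y = left_orbit \<beta> n - \<beta> ^ n * (1 - y)"
      have "1 - y < ?c / \<beta> ^ Suc n" using y by auto
      then have "\<beta> ^ Suc n * (1 - y) < ?c"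
        using beta_gt_1 by (simp add: pos_less_divide_eq mult.commute del: left_orbit.simps power_Suc)
      moreover have "0 < \<beta> ^ Suc n * (1 - y)" using y beta_gt_1 by simp
      moreover have "\<beta> * (beta_map \<beta> ^^ n) y = \<beta> * left_orbit \<beta> n - \<beta> ^ Suc n * (1 - y)"
        by (simp add: eq algebra_simps)
      ultimately show "\<lfloor>\<beta> * (beta_map \<beta> ^^ n) y\<rfloor> = \<lceil>\<beta> * left_orbit \<beta> n\<rceil> - 1"
        by simp linarith
    qed
  qed
  show ?thesis
  proof (induction n)
    case 0
    show ?case using step[of 0] by simp
  next
    case (Suc n)
    have "\<forall>\<^sub>F y in at_left 1. (beta_map \<beta> ^^ Suc n) y = left_orbit \<beta> (Suc n) - \<beta> ^ Suc n * (1 - y)"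
      using Suc
    proof (rule eventually_mono)
      fix y assume y: "(beta_map \<beta> ^^ n) y = left_orbit \<beta> n - \<beta> ^ n * (1 - y) \<and>
        \<lfloor>\<beta> * (beta_map \<beta> ^^ n) y\<rfloor> = \<lceil>\<beta> * left_orbit \<beta> n\<rceil> - 1"
      have "(beta_map \<beta> ^^ Suc n) y
          = \<beta> * (beta_map \<beta> ^^ n) y - real_of_int \<lfloor>\<beta> * (beta_map \<beta> ^^ n) y\<rfloor>"
        by (simp add: beta_map_def)
      also have "\<dots> = \<beta> * (left_orbit \<beta> n - \<beta> ^ n * (1 - y))
          - real_of_int (\<lceil>\<beta> * left_orbit \<beta> n\<rceil> - 1)"
        using y by metis
      finally show "(beta_map \<beta> ^^ Suc n) y = left_orbit \<beta> (Suc n) - \<beta> ^ Suc n * (1 - y)"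
        by (simp add: right_diff_distrib)
    qed
    with step[of "Suc n"] show ?case
      by eventually_elim blast
  qed
qed

lemma quasi_greedy_seq_eq: "q = (\<lambda>n. nat (\<lceil>\<beta> * left_orbit \<beta> n\<rceil> - 1))"
proof -
  let ?s = "\<lambda>n. nat (\<lceil>\<beta> * left_orbit \<beta> n\<rceil> - 1)"
  have lim: "((\<lambda>y. greedy_seq \<beta> y) \<longlongrightarrow> ?s) (at_left 1)"
    unfolding tendsto_fun_iff
  proof
    fix n
    have "\<forall>\<^sub>F y in at_left 1. greedy_seq \<beta> y n = ?s n"
      using eventually_beta_map[of n]
      by (rule eventually_mono) (metis greedy_seq_def greedy_digit_def add_diff_cancel_right')
    then show "((\<lambda>y. greedy_seq \<beta> y n) \<longlongrightarrow> ?s n) (at_left 1)"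
      by (simp add: tendsto_discrete)
  qed
  have "s = ?s" if "((\<lambda>y. greedy_seq \<beta> y) \<longlongrightarrow> s) (at_left 1)" for s
  proof
    fix n
    have "((\<lambda>y. greedy_seq \<beta> y n) \<longlongrightarrow> s n) (at_left 1)"
      using that by (simp add: tendsto_fun_iff)
    moreover have "((\<lambda>y. greedy_seq \<beta> y n) \<longlongrightarrow> ?s n) (at_left 1)"
      using lim by (simp add: tendsto_fun_iff)
    ultimately show "s n = ?s n"
      by (intro tendsto_unique[of "at_left (1::real)"]) auto
  qed
  with lim show ?thesis unfolding quasi_greedy_seq_def by (intro the_equality) 
qed

lemma q_digit: "q n = 0 \<or> q n = 1"
  unfolding quasi_greedy_seq_eq using left_orbit_digit[of n] by linarith

lemma q_le_1: "q n \<le> 1" using q_digit[of n] by auto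

lemma left_orbit_Suc: "left_orbit \<beta> (Suc n) = \<beta> * left_orbit \<beta> n - real (q n)"
proof -
  have "real (q n) = real_of_int (\<lceil>\<beta> * left_orbit \<beta> n\<rceil> - 1)"
    unfolding quasi_greedy_seq_eq using left_orbit_digit[of n] by linarith
  then show ?thesis by (simp only: left_orbit.simps(2) of_int_diff of_int_1)
qed

lemma q_0 [simp]: "q 0 = 1"
proof -
  have "\<lceil>\<beta>\<rceil> = 2" using beta_gt_1 beta_le_2 by linarith
  then show ?thesis by (simp add: quasi_greedy_seq_eq)
qed

text \<open>Once all digits vanish, every step multiplies the left orbit by \<beta>, but the orbit
  is positive and bounded by 1.\<close>

lemma q_infinite: "\<exists>i\<ge>n. q i = 1"
proof (rule ccontr)
  assume "\<not> ?thesis"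
  then have z: "q i = 0" if "i \<ge> n" for i using that q_digit by blast
  have "left_orbit \<beta> (n + k) = \<beta> ^ k * left_orbit \<beta> n" for k
    by (induction k) (simp_all add: left_orbit_Suc z del: left_orbit.simps(2))
  then have le: "\<beta> ^ k * left_orbit \<beta> n \<le> 1" for k
    using left_orbit_bounds(2)[of "n + k"] by simp
  obtain k where "1 / left_orbit \<beta> n < \<beta> ^ k"
    using real_arch_pow beta_gt_1 by blast
  with le[of k] left_orbit_bounds(1)[of n] show False by (simp add: field_simps)
qed

text \<open>The left orbit starts at its largest possible value 1. Equal digits preserve the order
  of two orbits, and the ceiling is monotone, so the first differing digit is the smaller
  one.\<close>

lemma lex_le_shift_q: "lex_le ((shift ^^ n) q) q"
proof (rule lex_leI)
  fix j assume ne: "(shift ^^ n) q j \<noteq> q j"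
    and same: "\<And>i. i < j \<Longrightarrow> (shift ^^ n) q i = q i"
  have "left_orbit \<beta> (i + n) \<le> left_orbit \<beta> i" if "i \<le> j" for i
    using that
  proof (induction i)
    case 0
    show ?case using left_orbit_bounds(2) by simp
  next
    case (Suc i)
    then show ?case
      using same[of i] beta_gt_1 
      by (simp add: left_orbit_Suc del: left_orbit.simps(2))
  qed
  then have "\<beta> * left_orbit \<beta> (j + n) \<le> \<beta> * left_orbit \<beta> j"
    using beta_gt_1 by (intro mult_left_mono) auto
  then have "\<lceil>\<beta> * left_orbit \<beta> (j + n)\<rceil> \<le> \<lceil>\<beta> * left_orbit \<beta> j\<rceil>"
    by (rule ceiling_mono)
  then have "q (j + n) \<le> q j" by (simp add: quasi_greedy_seq_eq nat_mono)
  with ne show "(shift ^^ n) q j < q j" by simp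
qed

section \<open>The beta-shift as a hereditary binary shift\<close>

abbreviation "X \<equiv> beta_shift \<beta>"

lemma beta_shift_digit: "x \<in> X \<Longrightarrow> x i = 0 \<or> x i = 1"
  by (auto simp: beta_shift_def)

lemma q_in_beta_shift: "q \<in> X"
  using q_digit lex_le_shift_q by (auto simp: beta_shift_def)

lemma shift_in_beta_shift: "x \<in> X \<Longrightarrow> (shift ^^ n) x \<in> X"
proof -
  assume x: "x \<in> X"
  have "(shift ^^ m) ((shift ^^ n) x) = (shift ^^ (m + n)) x" for m
    by (simp add: funpow_add)
  with x show ?thesis unfolding beta_shift_def by simp
qed

lemma shift_in_beta_shift': "x \<in> X \<Longrightarrow> shift x \<in> X"
  using shift_in_beta_shift[of x 1] by simp

text \<open>Lowering digits lowers every shifted sequence pointwise, hence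
  lexicographically.\<close>

lemma beta_shift_hereditary:
  assumes "x \<in> X" "\<And>i. y i \<le> x i"
  shows "y \<in> X"
proof -
  have "y i = 0 \<or> y i = 1" for i
    using assms(2)[of i] beta_shift_digit[OF assms(1), of i] by auto
  moreover have "lex_le ((shift ^^ n) y) q" for n
  proof (rule lex_le_trans)
    show "lex_le ((shift ^^ n) y) ((shift ^^ n) x)"
      by (rule lex_le_pointwise) (simp add: assms(2))
    show "lex_le ((shift ^^ n) x) q" using assms(1) by (simp add: beta_shift_def)
  qed
  ultimately show ?thesis by (auto simp: beta_shift_def)
qed

lemma zero_in_beta_shift: "(\<lambda>_. 0) \<in> X"
  by (rule beta_shift_hereditary[OF q_in_beta_shift]) simp

lemma beta_shift_first_difference:
  assumes "x \<in> X" "x \<noteq> q"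
  obtains j where "q j = 1" "x j = 0" "\<And>i. i < j \<Longrightarrow> x i = q i"
proof -
  have "lex_le ((shift ^^ 0) x) q" using assms(1) unfolding beta_shift_def by blast
  then obtain j where j: "x j < q j" "\<And>i. i < j \<Longrightarrow> x i = q i"
    using assms(2) by (auto elim: lex_le_cases)
  show ?thesis using that[of j] j q_digit[of j] by auto
qed

text \<open>Before time \<open>n0 - 1\<close> no product with \<beta> is an integer, so floor and
  ceiling minus 1 agree. At that time the product is exactly 1: the greedy digit is 1, the
  quasi-greedy digit is 0, and the left orbit returns to 1, which makes \<open>q\<close>
  periodic.\<close>

lemma simple_expansion:
  assumes "\<beta> < 2" "2 \<le> n0" and simple: "(beta_map \<beta> ^^ (n0 - 1)) 1 = 1 / \<beta>"
  shows greedy_eq_quasi_greedy: "i < n0 - 1 \<Longrightarrow> greedy_seq \<beta> 1 i = q i"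
    and greedy_last: "greedy_seq \<beta> 1 (n0 - 1) = 1"
    and quasi_greedy_last: "q (n0 - 1) = 0"
    and quasi_greedy_periodic: "(shift ^^ n0) q = q"
proof -
  \<comment> \<open>Zero is a fixed point of \<open>beta_map \<beta>\<close>, so an orbit that hits
    it early could not reach \<open>1 / \<beta>\<close>.\<close>
  have zero: "(beta_map \<beta> ^^ (i + k)) 1 = 0" if "(beta_map \<beta> ^^ i) 1 = 0" for i k
    by (induction k) (use that in \<open>simp_all add: beta_map_def[of \<beta> 0]\<close>)
  have nonzero: "(beta_map \<beta> ^^ i) 1 \<noteq> 0" if "i \<le> n0 - 1" for i
  proof
    assume "(beta_map \<beta> ^^ i) 1 = 0"
    moreover have "i + (n0 - 1 - i) = n0 - 1" using that by simp
    ultimately have "(beta_map \<beta> ^^ (n0 - 1)) 1 = 0" using zero by metis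
    with simple beta_gt_1 show False by simp
  qed
  have digit: "\<lfloor>\<beta> * (beta_map \<beta> ^^ i) 1\<rfloor> = \<lceil>\<beta> * (beta_map \<beta> ^^ i) 1\<rceil> - 1" if "i < n0 - 1" for i
  proof -
    let ?y = "\<beta> * (beta_map \<beta> ^^ i) 1"
    have "?y \<noteq> real_of_int \<lfloor>?y\<rfloor>"
      using nonzero[of "Suc i"] that by (simp add: beta_map_def)
    then show ?thesis by linarith
  qed
  have orbit: "(beta_map \<beta> ^^ i) 1 = left_orbit \<beta> i" if "i \<le> n0 - 1" for i
    using that
  proof (induction i)
    case (Suc i)
    then have "(beta_map \<beta> ^^ i) 1 = left_orbit \<beta> i" by simp
    moreover have "(beta_map \<beta> ^^ Suc i) 1
        = \<beta> * (beta_map \<beta> ^^ i) 1 - real_of_int \<lfloor>\<beta> * (beta_map \<beta> ^^ i) 1\<rfloor>"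
      by (simp add: beta_map_def)
    ultimately show ?case using digit[of i] Suc.prems by simp
  qed simp
  show "greedy_seq \<beta> 1 i = q i" if "i < n0 - 1"
    using digit[OF that] orbit[of i] that
    by (simp add: greedy_seq_def greedy_digit_def quasi_greedy_seq_eq)
  show "greedy_seq \<beta> 1 (n0 - 1) = 1"
    using simple beta_gt_1 by (simp add: greedy_seq_def greedy_digit_def)
  have last: "\<beta> * left_orbit \<beta> (n0 - 1) = 1"
    using beta_gt_1 unfolding orbit[OF order_refl, symmetric] simple by simp
  then show q0: "q (n0 - 1) = 0" by (simp add: quasi_greedy_seq_eq)
  have "left_orbit \<beta> n0 = 1"
    using left_orbit_Suc[of "n0 - 1"] last q0 assms(2) by (simp del: left_orbit.simps)
  then have "left_orbit \<beta> (i + n0) = left_orbit \<beta> i" for i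
    by (induction i) simp_all
  then show "(shift ^^ n0) q = q"
    by (simp add: shift_funpow quasi_greedy_seq_eq)
qed

end

section \<open>Admissible words and the renewal inequality\<close>

lemma H_0 [simp]: "H 0 t x = 1"
  by (simp add: H_def)

lemma H_pos [simp]: "0 < H n t x"
  by (simp add: H_def)

lemma H_nonneg [simp]: "0 \<le> H n t x"
  by (simp add: H_def)

lemma H_neq_0 [simp]: "H n t x \<noteq> 0"
  by (simp add: H_def)

lemma H_Suc: "H (Suc n) t x = H n t x * exp (t * real (x n))"
  by (simp add: H_def distrib_left exp_add)

lemma H_cong: "(\<And>i. i < n \<Longrightarrow> x i = y i) \<Longrightarrow> H n t x = H n t y"
  by (simp add: H_def)

lemma H_add: "H (m + n) t x = H m t x * H n t ((shift ^^ m) x)"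
proof (induction n)
  case (Suc n)
  have "H (m + Suc n) t x = H (m + n) t x * exp (t * real (x (m + n)))"
    by (simp add: H_Suc)
  then show ?case by (simp add: Suc H_Suc add.commute)
qed simp

text \<open>A word is encoded by its padding with zeros. Heredity keeps the padded sequence in the
  beta-shift, and equality of prefixes becomes equality of truncations.\<close>

definition trunc :: "nat \<Rightarrow> (nat \<Rightarrow> nat) \<Rightarrow> nat \<Rightarrow> nat" where
  "trunc N x = (\<lambda>i. if i < N then x i else 0)"

lemma trunc_eq_iff: "trunc N x = trunc N y \<longleftrightarrow> (\<forall>i<N. x i = y i)"
  by (auto simp: trunc_def fun_eq_iff)

lemma H_trunc [simp]: "H N t (trunc N x) = H N t x"
  by (rule H_cong) (simp add: trunc_def)

context beta_expansion
begin

definition words :: "nat \<Rightarrow> (nat \<Rightarrow> nat) set" where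
  "words N = {x \<in> X. \<forall>i\<ge>N. x i = 0}"

text \<open>The partition function of the potential over the admissible words of length N.\<close>

definition pressure_sum :: "nat \<Rightarrow> real \<Rightarrow> real" where
  "pressure_sum N t = (\<Sum>x\<in>words N. H N t x)"

definition phi_coeff :: "real \<Rightarrow> nat \<Rightarrow> real" where
  "phi_coeff t n = real (q n) * H n t q"

lemma phi_coeff_nonneg [simp]: "0 \<le> phi_coeff t n"
  by (simp add: phi_coeff_def)

lemma phi_coeff_le_H: "phi_coeff t n \<le> H n t q"
  using q_digit[of n] by (auto simp: phi_coeff_def)

lemma phi_coeff_0 [simp]: "phi_coeff t 0 = 1"
  by (simp add: phi_coeff_def)

lemma phi_term_Suc: "phi_term \<beta> t z (Suc n) = phi_coeff t n * z ^ Suc n"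
  by (simp add: phi_term_def phi_coeff_def quasi_greedy_digit_def)

lemma finite_words [simp]: "finite (words N)"
proof (rule finite_subset)
  show "words N \<subseteq> {x. \<forall>i. (i \<in> {..<N} \<longrightarrow> x i \<in> {0, 1}) \<and> (i \<notin> {..<N} \<longrightarrow> x i = 0)}"
    using beta_shift_digit by (auto simp: words_def)
  show "finite \<dots>" by (rule finite_set_of_finite_funs) auto
qed

lemma trunc_in_words: "x \<in> X \<Longrightarrow> trunc N x \<in> words N"
  using beta_shift_hereditary[of x "trunc N x"] by (auto simp: words_def trunc_def)

lemma pressure_sum_renewal:
  "pressure_sum N t \<le> H N t q + (\<Sum>j<N. phi_coeff t j * pressure_sum (N - Suc j) t)"
proof -
  define glue where "glue j y = (\<lambda>i. if i < j then q i else if i = j then 0 else y (i - Suc j))"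
    for j and y :: "nat \<Rightarrow> nat"
  \<comment> \<open>A word that leaves \<open>q\<close> at j < N is coded by j and its remainder.
    The index N, with a dummy singleton, stands for the one word that follows \<open>q\<close> to
    its end.\<close>
  define B where "B j = (if j < N then words (N - Suc j) else {\<lambda>_. 0})" for j
  define g where "g = (\<lambda>(j, y). if j < N then phi_coeff t j * H (N - Suc j) t y else H N t q)"
  define f where "f = (\<lambda>(j, y). if j < N then glue j y else trunc N q)"
  have "pressure_sum N t \<le> sum g (Sigma {..N} B)"
    unfolding pressure_sum_def
  \<comment> \<open>For an upper bound it suffices that every word arises from some index of at
    least its weight.\<close>
  proof (rule sum_le_included)
    show "finite (Sigma {..N} B)"
      by (intro finite_SigmaI) (auto simp: B_def)
    show "\<forall>p\<in>Sigma {..N} B. 0 \<le> g p"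
      by (auto simp: g_def)
    show "\<forall>x\<in>words N. \<exists>p\<in>Sigma {..N} B. f p = x \<and> H N t x \<le> g p"
    proof
      fix x assume "x \<in> words N"
      then have x: "x \<in> X" "\<And>i. i \<ge> N \<Longrightarrow> x i = 0" by (auto simp: words_def)
      show "\<exists>p\<in>Sigma {..N} B. f p = x \<and> H N t x \<le> g p"
      proof (cases "\<forall>i<N. x i = q i")
        case True
        then have "x = trunc N q" using x(2) by (auto simp: trunc_def fun_eq_iff)
        then have "f (N, \<lambda>_. 0) = x" "H N t x \<le> g (N, \<lambda>_. 0)" "(N, \<lambda>_. 0) \<in> Sigma {..N} B"
          by (auto simp: f_def g_def B_def)
        then show ?thesis by blast
      next
        case False
        then have "x \<noteq> q" by auto
        with x(1) obtain j where j: "q j = 1" "x j = 0" "\<And>i. i < j \<Longrightarrow> x i = q i"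
          using beta_shift_first_difference by blast
        have "j < N"
        proof (rule ccontr)
          assume "\<not> j < N"
          then show False using False j(3) by auto
        qed
        define y where "y = (\<lambda>i. x (i + Suc j))"
        have y_shift: "y = (shift ^^ Suc j) x" by (simp only: y_def shift_funpow)
        have "y \<in> words (N - Suc j)"
          using x shift_in_beta_shift[OF x(1), of "Suc j"]
          unfolding words_def y_shift[symmetric] by (auto simp: y_def)
        moreover have "glue j y = x"
          using j by (auto simp: glue_def y_def fun_eq_iff)
        moreover have "H N t x = H (Suc j + (N - Suc j)) t x"
          using \<open>j < N\<close> by simp
        then have "H N t x = phi_coeff t j * H (N - Suc j) t y"
          using j by (simp only: H_add H_Suc y_shift phi_coeff_def) (simp add: H_cong[of j x q])
        ultimately have "f (j, y) = x" "H N t x \<le> g (j, y)" "(j, y) \<in> Sigma {..N} B"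
          using \<open>j < N\<close> by (auto simp: f_def g_def B_def)
        then show ?thesis by blast
      qed
    qed
  qed simp
  also have "\<dots> = (\<Sum>j\<le>N. \<Sum>y\<in>B j. g (j, y))"
    by (subst sum.Sigma) (auto simp: B_def)
  also have "\<dots> = (\<Sum>j<N. \<Sum>y\<in>B j. g (j, y)) + (\<Sum>y\<in>B N. g (N, y))"
    by (simp only: lessThan_Suc_atMost[symmetric] sum.lessThan_Suc)
  also have "\<dots> = H N t q + (\<Sum>j<N. phi_coeff t j * pressure_sum (N - Suc j) t)"
    by (simp add: B_def g_def pressure_sum_def sum_distrib_left)
  finally show ?thesis .
qed

text \<open>With total mass at most 1, the coefficients of \<open>phi\<close> at z act as
  sub-probability weights: the convolution in the renewal inequality averages earlier values, all
  bounded by \<open>G\<close>, and only the boundary term \<open>H N t q * z ^ N\<close> is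
  added.\<close>

lemma pressure_sum_le:
  assumes "0 < z" and le_1: "\<And>N. (\<Sum>j<N. phi_coeff t j * z ^ Suc j) \<le> 1"
  shows "pressure_sum N t * z ^ N \<le> (\<Sum>n\<le>N. H n t q * z ^ n)"
proof (induction N rule: less_induct)
  case (less N)
  define G where "G = (\<Sum>n<N. H n t q * z ^ n)"
  have "0 \<le> G" unfolding G_def using assms(1) by (intro sum_nonneg) simp
  have "pressure_sum N t * z ^ N \<le> 
      (H N t q + (\<Sum>j<N. phi_coeff t j * pressure_sum (N - Suc j) t)) * z ^ N"
    using assms(1) pressure_sum_renewal by (intro mult_right_mono) auto
  also have "\<dots> = H N t q * z ^ N
      + (\<Sum>j<N. phi_coeff t j * z ^ Suc j * (pressure_sum (N - Suc j) t * z ^ (N - Suc j)))"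
  proof -
    have "z ^ N = z ^ Suc j * z ^ (N - Suc j)" if "j < N" for j
      using that by (metis Suc_leI le_add_diff_inverse power_add)
    then have "phi_coeff t j * pressure_sum (N - Suc j) t * z ^ N
        = phi_coeff t j * z ^ Suc j * (pressure_sum (N - Suc j) t * z ^ (N - Suc j))" if "j < N" for j
      using that by simp
    then have "(\<Sum>j<N. phi_coeff t j * pressure_sum (N - Suc j) t * z ^ N)
        = (\<Sum>j<N. phi_coeff t j * z ^ Suc j * (pressure_sum (N - Suc j) t * z ^ (N - Suc j)))"
      by (intro sum.cong) auto
    then show ?thesis by (simp only: distrib_right sum_distrib_right)
  qed
  also have "\<dots> \<le> H N t q * z ^ N + (\<Sum>j<N. phi_coeff t j * z ^ Suc j * G)"
  proof (intro add_left_mono sum_mono mult_left_mono)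
    fix j assume "j \<in> {..<N}"
    then have "pressure_sum (N - Suc j) t * z ^ (N - Suc j) \<le> (\<Sum>n\<le>N - Suc j. H n t q * z ^ n)"
      using less.IH by simp
    also have "\<dots> \<le> G"
      unfolding G_def using \<open>j \<in> {..<N}\<close> assms(1) by (intro sum_mono2) auto
    finally show "pressure_sum (N - Suc j) t * z ^ (N - Suc j) \<le> G" .
  qed (use assms(1) in simp)
  also have "(\<Sum>j<N. phi_coeff t j * z ^ Suc j * G) \<le> 1 * G"
    unfolding sum_distrib_right[symmetric]
    by (intro mult_right_mono le_1 \<open>0 \<le> G\<close>)
  finally show ?case
    by (simp add: G_def lessThan_Suc_atMost[symmetric])
qed

text \<open>The shift is hereditary: ones of a prefix of \<open>q\<close> may be erased freely.\<close>

lemma power_le_pressure_sum: "(1 + exp t) ^ (\<Sum>i<N. q i) \<le> pressure_sum N t"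
proof -
  define sub where "sub N = {x. (\<forall>i<N. x i \<le> q i) \<and> (\<forall>i\<ge>N. x i = 0)}" for N
  have sub_words: "sub N \<subseteq> words N" for N
  proof
    fix x assume x: "x \<in> sub N"
    have "x i \<le> q i" for i
      using x by (cases "i < N") (auto simp: sub_def)
    then have "x \<in> X" using beta_shift_hereditary[OF q_in_beta_shift] by blast
    moreover have "x i = 0" if "i \<ge> N" for i
      using x that by (auto simp: sub_def)
    ultimately show "x \<in> words N" by (simp add: words_def)
  qed
  have fin: "finite (sub N)" for N by (rule finite_subset[OF sub_words finite_words])
  \<comment> \<open>Each one of \<open>q\<close> is kept or erased and contributes the factor
    \<open>1 + exp t\<close>; each zero contributes 1.\<close>
  have "(\<Sum>x\<in>sub N. H N t x) = (1 + exp t) ^ (\<Sum>i<N. q i)"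
  proof (induction N)
    case 0
    have "sub 0 = {\<lambda>_. 0}" by (auto simp: sub_def)
    then show ?case by simp
  next
    case (Suc N)
    have zero: "x N = 0" if "x \<in> sub N" for x
      using that by (auto simp: sub_def)
    show ?case
    proof (cases "q N = 0")
      case True
      have "sub (Suc N) = sub N"
      proof (intro set_eqI iffI)
        fix x assume "x \<in> sub (Suc N)"
        then have le: "\<And>i. i < Suc N \<Longrightarrow> x i \<le> q i" and zero: "\<And>i. i \<ge> Suc N \<Longrightarrow> x i = 0"
          by (auto simp: sub_def)
        have "x i = 0" if "i \<ge> N" for i
          using that le[of N] zero[of i] True by (cases "i = N") auto
        then show "x \<in> sub N" using le by (auto simp: sub_def)
      next
        fix x assume "x \<in> sub N"
        then show "x \<in> sub (Suc N)" by (auto simp: sub_def less_Suc_eq)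
      qed
      moreover have "(\<Sum>x\<in>sub N. H (Suc N) t x) = (\<Sum>x\<in>sub N. H N t x)"
        using zero by (intro sum.cong) (simp_all add: H_Suc)
      ultimately show ?thesis using Suc True by simp
    next
      case False
      then have qN: "q N = 1" using q_digit[of N] by simp
      have eq: "sub (Suc N) = sub N \<union> (\<lambda>x. x(N := 1)) ` sub N"
      proof (intro set_eqI iffI)
        fix x assume x: "x \<in> sub (Suc N)"
        have "x N \<le> 1" using x qN by (auto simp: sub_def)
        have *: "x(N := 0) \<in> sub N"
          using x by (auto simp: sub_def)
        show "x \<in> sub N \<union> (\<lambda>x. x(N := 1)) ` sub N"
        proof (cases "x N = 0")
          case True
          then have "x(N := 0) = x" by auto
          then show ?thesis using * by simp
        next
          case False
          then have "x = (x(N := 0))(N := 1)" using \<open>x N \<le> 1\<close> by (auto simp: fun_eq_iff)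
          then show ?thesis using * by blast
        qed
      next
        fix x assume "x \<in> sub N \<union> (\<lambda>x. x(N := 1)) ` sub N"
        then show "x \<in> sub (Suc N)"
          using qN by (auto simp: sub_def less_Suc_eq)
      qed
      have disj: "sub N \<inter> (\<lambda>x. x(N := 1)) ` sub N = {}"
        using zero by fastforce
      have inj: "inj_on (\<lambda>x. x(N := 1)) (sub N)"
      proof (rule inj_onI)
        fix x y assume xy: "x \<in> sub N" "y \<in> sub N" "x(N := 1) = y(N := 1)"
        have "x i = y i" for i
          using fun_cong[OF xy(3), of i] zero[OF xy(1)] zero[OF xy(2)] by (cases "i = N") auto
        then show "x = y" by blast
      qed
      have "(\<Sum>x\<in>sub (Suc N). H (Suc N) t x)
          = (\<Sum>x\<in>sub N. H (Suc N) t x) + (\<Sum>x\<in>sub N. H (Suc N) t (x(N := 1)))"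
        unfolding eq sum.union_disjoint[OF fin finite_imageI[OF fin] disj] sum.reindex[OF inj]
          by (simp add: comp_def)
      also have "(\<Sum>x\<in>sub N. H (Suc N) t x) = (\<Sum>x\<in>sub N. H N t x)"
        using zero by (intro sum.cong) (simp_all add: H_Suc)
      also have "(\<Sum>x\<in>sub N. H (Suc N) t (x(N := 1))) = (\<Sum>x\<in>sub N. H N t x * exp t)"
      proof (intro sum.cong refl)
        fix x
        have "H N t (x(N := 1)) = H N t x" by (rule H_cong) simp
        then show "H (Suc N) t (x(N := 1)) = H N t x * exp t" by (simp add: H_Suc)
      qed
      finally show ?thesis
        unfolding sum_distrib_right[symmetric] using Suc qN by (simp add: algebra_simps)
    qed
  qed
  moreover have "(\<Sum>x\<in>sub N. H N t x) \<le> pressure_sum N t"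
    unfolding pressure_sum_def by (intro sum_mono2 sub_words) auto
  ultimately show ?thesis by simp
qed

end

section \<open>The zero of \<open>1 - phi\<close>\<close>

lemma sum_lessThan_add:
  "(\<Sum>j<m + n. f j) = (\<Sum>j<m. f j) + (\<Sum>i<n. f (m + i) :: 'a::comm_monoid_add)" for m n :: nat
  by (induction n) (simp_all add: add.assoc)

context beta_expansion
begin

lemma H_le_power: "H n t q \<le> (1 + exp t) ^ n"
proof (induction n)
  case (Suc n)
  have "exp (t * real (q n)) \<le> 1 + exp t"
    using q_digit[of n] by (auto simp: add_nonneg_nonneg)
  then show ?case
    unfolding H_Suc power_Suc2 using Suc by (intro mult_mono) (auto simp: add_nonneg_nonneg)
qed simp

text \<open>Erasing ones shows that the prefixes of \<open>q\<close> carry strictly less weight than the partition sums,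
  on an exponential scale.\<close>

lemma H_summable_improve:
  obtains \<kappa> where "\<kappa> > 1"
    "\<And>z y. 0 < z \<Longrightarrow> z < 1 \<Longrightarrow> summable (\<lambda>n. H n t q * z ^ n) \<Longrightarrow>
      (\<And>N. (\<Sum>j<N. phi_coeff t j * z ^ Suc j) \<le> 1) \<Longrightarrow> 0 < y \<Longrightarrow> y < z powr (1 / \<kappa>) \<Longrightarrow>
      summable (\<lambda>n. H n t q * y ^ n)"
proof (cases "t \<le> 0")
  \<comment> \<open>For t \<le> 0 all weights are at most 1, so comparison with a geometric series
    works for every radius below 1, and the exponent 2 is one possible choice.\<close>
  case True
  have H_le_1: "H n t q \<le> 1" for n
    using True by (auto simp: H_def intro!: mult_nonpos_nonneg sum_nonneg)
  have "summable (\<lambda>n. H n t q * y ^ n)" if "0 < z" "z < 1" "0 < y" "y < z powr (1 / 2)" for z y :: real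
  proof (rule summable_comparison_test')
    have "z powr (1/2) < 1" using powr_less_mono2[of "1/2" z 1] that by simp
    then show "summable (\<lambda>n. y ^ n)" using that by (intro summable_geometric) auto
    show "norm (H n t q * y ^ n) \<le> y ^ n" for n
      using that H_le_1[of n] by (simp add: abs_mult mult_left_le_one_le)
  qed
  then show ?thesis using that[of 2] by auto
next
  case False
  \<comment> \<open>Chosen so that \<open>(1 + exp t) powr (1 / \<kappa>) = exp t\<close>; the bound
    for the erased words then turns into a bound for \<open>H n t q\<close> by taking the power
    \<open>1 / \<kappa>\<close>.\<close>
  define \<kappa> where "\<kappa> = ln (1 + exp t) / t"
  have "t = ln (exp t)" by simp
  also have "\<dots> < ln (1 + exp t)" by (subst ln_less_cancel_iff) (auto simp: add_pos_pos)
  finally have "\<kappa> > 1" using False by (simp add: \<kappa>_def)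
  have "summable (\<lambda>n. H n t q * y ^ n)"
    if z: "0 < z" "z < 1" and sum: "summable (\<lambda>n. H n t q * z ^ n)"
      and le: "\<And>N. (\<Sum>j<N. phi_coeff t j * z ^ Suc j) \<le> 1"
      and y: "0 < y" "y < z powr (1 / \<kappa>)" for z y :: real
  proof (rule summable_comparison_test')
    define G where "G = (\<Sum>n. H n t q * z ^ n)"
    let ?r = "z powr (1 / \<kappa>)"
    have "0 < ?r" using z by simp
    then show "summable (\<lambda>n. G powr (1 / \<kappa>) * (y / ?r) ^ n)"
      using y by (intro summable_mult summable_geometric) auto
    fix n
    have pow: "(1 + exp t) ^ (\<Sum>i<n. q i) \<le> G * (1 / z ^ n)"
    proof -
      have "(1 + exp t) ^ (\<Sum>i<n. q i) * z ^ n \<le> pressure_sum n t * z ^ n"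
        using z power_le_pressure_sum by (intro mult_right_mono) auto
      also have "\<dots> \<le> (\<Sum>k\<le>n. H k t q * z ^ k)"
        using z(1) le by (rule pressure_sum_le)
      also have "\<dots> \<le> G"
        unfolding G_def using z sum by (intro sum_le_suminf) auto
      finally show ?thesis using z by (simp add: field_simps)
    qed
    have "H n t q = exp (t * real (\<Sum>i<n. q i))"
      by (simp add: H_def)
    also have "\<dots> = ((1 + exp t) ^ (\<Sum>i<n. q i)) powr (1 / \<kappa>)"
    proof -
      have "ln (1 + exp t) * (1 / \<kappa>) = t"
        using \<open>\<kappa> > 1\<close> False by (simp add: \<kappa>_def)
      moreover have "((1 + exp t) ^ m) powr (1 / \<kappa>) = exp (real m * (ln (1 + exp t) * (1 / \<kappa>)))" for m
        using add_pos_pos[OF zero_less_one exp_gt_zero[of t]] by (simp add: powr_def ln_realpow)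
      ultimately show ?thesis by (simp add: mult.commute)
    qed
    also have "\<dots> \<le> (G * (1 / z ^ n)) powr (1 / \<kappa>)"
      using \<open>\<kappa> > 1\<close> pow by (intro powr_mono2) (auto simp: add_nonneg_nonneg)
    also have "\<dots> = G powr (1 / \<kappa>) * (1 / ?r) ^ n"
    proof -
      have "0 \<le> G" unfolding G_def using z sum by (intro suminf_nonneg) auto
      moreover have "(1 / z ^ n) powr (1 / \<kappa>) = (1 / ?r) ^ n"
        using z by (simp add: powr_divide power_divide powr_power powr_realpow[symmetric] powr_powr mult.commute)
      ultimately show ?thesis using z by (subst powr_mult) auto
    qed
    finally have "H n t q * y ^ n \<le> G powr (1 / \<kappa>) * (1 / ?r) ^ n * y ^ n"
      using y by (intro mult_right_mono) auto
    then show "norm (H n t q * y ^ n) \<le> G powr (1 / \<kappa>) * (y / ?r) ^ n"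
      using y by (simp add: power_divide abs_mult)
  qed
  with \<open>\<kappa> > 1\<close> show ?thesis using that by blast
qed

text \<open>The zero is the supremum s of the points z < 1 at which the series of \<open>H\<close>
  converges and the partial sums of \<open>phi\<close> stay at most 1. Erasure gives convergence up
  to \<open>s powr (1 / \<kappa>)\<close>, which exceeds s because s < 1. Hence \<open>phi\<close>
  is continuous at s, and a value below 1 would allow larger z.\<close>

lemma phi_zero_exists:
  obtains z R where "0 < z" "z < 1" "(\<lambda>n. phi_coeff t n * z ^ Suc n) sums 1"
    "z < R" "summable (\<lambda>n. H n t q * R ^ n)"
proof -
  obtain \<kappa> where \<kappa>: "\<kappa> > 1"
    and improve: "\<And>z y. 0 < z \<Longrightarrow> z < 1 \<Longrightarrow> summable (\<lambda>n. H n t q * z ^ n) \<Longrightarrow>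
      (\<And>N. (\<Sum>j<N. phi_coeff t j * z ^ Suc j) \<le> 1) \<Longrightarrow> 0 < y \<Longrightarrow> y < z powr (1 / \<kappa>) \<Longrightarrow>
      summable (\<lambda>n. H n t q * y ^ n)"
    using H_summable_improve[of t] by blast
  define f where "f N z = (\<Sum>j<N. phi_coeff t j * z ^ Suc j)" for N and z :: real
  define A where "A = {z. 0 < z \<and> z < 1 \<and> summable (\<lambda>n. H n t q * z ^ n) \<and> (\<forall>N. f N z \<le> 1)}"
  have f_cont: "continuous_on UNIV (f N)" for N
    unfolding f_def by (intro continuous_intros)
  \<comment> \<open>Since \<open>H n t q\<close> is at most \<open>(1 + exp t) ^ n\<close>, the
    terms at this point are dominated by powers of 1/2, and the terms of \<open>phi\<close> by a
    series with sum 1.\<close>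
  define z0 where "z0 = 1 / (2 * (1 + exp t))"
  have e: "0 < 1 + exp t" by (simp add: add_pos_pos)
  have z0_A: "z0 \<in> A"
  proof -
    have pos: "0 < z0" "z0 < 1"
      unfolding z0_def using e exp_gt_zero[of t]
      by (auto simp: divide_less_eq simp del: exp_gt_zero)
    have H_le: "H n t q * z0 ^ n \<le> (1/2) ^ n" for n
    proof -
      have "H n t q * z0 ^ n \<le> (1 + exp t) ^ n * z0 ^ n"
        using H_le_power pos by (intro mult_right_mono) auto
      also have "\<dots> = (1/2) ^ n"
      proof -
        have "(1 + exp t) * z0 = 1 / 2" unfolding z0_def using e by (simp add: field_simps)
        then show ?thesis by (metis power_mult_distrib)
      qed
      finally show ?thesis .
    qed
    have "summable (\<lambda>n. H n t q * z0 ^ n)"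
      by (rule summable_comparison_test'[of "\<lambda>n. (1/2)^n" 0])
         (use H_le pos in \<open>auto simp: abs_mult intro: summable_geometric\<close>)
    moreover have "f N z0 \<le> 1" for N
    proof -
      have "z0 \<le> 1 / 2" unfolding z0_def using e by (simp add: field_simps)
      have "f N z0 \<le> (\<Sum>j<N. (1/2) ^ Suc j)"
        unfolding f_def
      proof (rule sum_mono)
        fix j
        have "phi_coeff t j * z0 ^ Suc j \<le> H j t q * z0 ^ Suc j"
          using phi_coeff_le_H pos by (intro mult_right_mono) auto
        also have "\<dots> = (H j t q * z0 ^ j) * z0" by simp
        also have "\<dots> \<le> (1/2) ^ j * (1/2)"
          using H_le \<open>z0 \<le> 1/2\<close> pos by (intro mult_mono) auto
        finally show "phi_coeff t j * z0 ^ Suc j \<le> (1/2) ^ Suc j" by simp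
      qed
      also have "\<dots> \<le> (\<Sum>j. (1/2) ^ Suc j :: real)"
        by (intro sum_le_suminf) (auto simp: summable_geometric summable_mult)
      also have "\<dots> = 1" using power_half_series by (rule sums_unique[symmetric])
      finally show ?thesis .
    qed
    ultimately show ?thesis using pos by (simp add: A_def)
  qed
  define s where "s = Sup A"
  have bdd: "bdd_above A" by (rule bdd_aboveI[of _ 1]) (auto simp: A_def)
  have "s \<le> 1" unfolding s_def using z0_A by (intro cSup_least) (auto simp: A_def)
  have "0 < s" using cSup_upper[OF z0_A bdd] z0_A by (auto simp: s_def A_def)
  have f_s: "f N s \<le> 1" for N
  proof -
    have "closed {z. f N z \<le> 1}"
      using f_cont by (intro closed_Collect_le) auto
    moreover have "A \<subseteq> {z. f N z \<le> 1}" by (auto simp: A_def)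
    ultimately have "closure A \<subseteq> {z. f N z \<le> 1}" by (intro closure_minimal)
    moreover have "s \<in> closure A"
      unfolding s_def using z0_A bdd by (intro closure_contains_Sup) auto
    ultimately show ?thesis by auto
  qed
  \<comment> \<open>At s = 1 the leading coefficient 1 and one later positive coefficient, which
    exists because \<open>q\<close> has ones arbitrarily far out, already exceed 1.\<close>
  have "s < 1"
  proof (rule ccontr)
    assume "\<not> s < 1"
    then have "s = 1" using \<open>s \<le> 1\<close> by simp
    obtain k where k: "k \<ge> 1" "q k = 1" using q_infinite by blast
    have "(\<Sum>j\<in>{0, k}. phi_coeff t j) \<le> f (Suc k) s"
      unfolding f_def \<open>s = 1\<close> power_one mult_1_right by (intro sum_mono2) auto
    then have "phi_coeff t k \<le> 0" using f_s[of "Suc k"] k by simp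
    then show False using k H_pos[of k t q] by (simp add: phi_coeff_def del: H_pos)
  qed
  have summable_s: "summable (\<lambda>n. H n t q * y ^ n)" if y: "0 < y" "y < s powr (1 / \<kappa>)" for y
  proof -
    have "y powr \<kappa> < (s powr (1 / \<kappa>)) powr \<kappa>"
      using y \<kappa> by (intro powr_less_mono2) auto
    also have "\<dots> = s" using \<kappa> \<open>0 < s\<close> by (simp add: powr_powr)
    finally have "y powr \<kappa> < Sup A" by (simp add: s_def)
    then obtain z where z: "z \<in> A" "y powr \<kappa> < z" using bdd z0_A less_cSup_iff[of A] by blast
    have "y = (y powr \<kappa>) powr (1 / \<kappa>)" using y \<kappa> by (simp add: powr_powr)
    also have "\<dots> < z powr (1 / \<kappa>)"
      using z \<kappa> by (intro powr_less_mono2) auto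
    finally show ?thesis using improve[of z y] z(1) y(1) by (auto simp: A_def f_def)
  qed
  have "s < s powr (1 / \<kappa>)"
  proof -
    have "s powr 1 < s powr (1 / \<kappa>)"
      using \<open>0 < s\<close> \<open>s < 1\<close> \<kappa> by (intro powr_less_mono') auto
    then show ?thesis using \<open>0 < s\<close> by simp
  qed
  then obtain R where R: "s < R" "R < s powr (1 / \<kappa>)" using dense by blast
  have sum_R: "summable (\<lambda>n. H n t q * R ^ n)" using summable_s R \<open>0 < s\<close> by simp
  have sum_phi_R: "summable (\<lambda>n. phi_coeff t n * R ^ n)"
    by (rule summable_comparison_test'[OF sum_R, of 0])
       (use R \<open>0 < s\<close> phi_coeff_le_H in \<open>auto simp: abs_mult intro!: mult_right_mono\<close>)
  have sum_phi: "summable (\<lambda>n. phi_coeff t n * z ^ n)" if "0 < z" "z \<le> R" for z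
    by (rule summable_comparison_test'[OF sum_phi_R, of 0])
       (use that in \<open>auto simp: abs_mult intro!: mult_left_mono power_mono\<close>)
  define g where "g z = z * (\<Sum>n. phi_coeff t n * z ^ n)" for z
  have g_sums: "(\<lambda>n. phi_coeff t n * z ^ Suc n) sums g z" if "0 < z" "z \<le> R" for z
    using sums_mult[OF summable_sums[OF sum_phi[OF that]], of z] by (simp add: g_def ac_simps)
  have "g s \<le> 1"
    using g_sums[of s] f_s \<open>0 < s\<close> R unfolding sums_def f_def by (intro LIMSEQ_le_const2) auto
  moreover have "\<not> g s < 1"
  proof
    assume "g s < 1"
    have "isCont (\<lambda>z. \<Sum>n. phi_coeff t n * z ^ n) s"
      by (rule isCont_powser[OF sum_phi_R]) (use \<open>0 < s\<close> R in auto)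
    then have "isCont g s" unfolding g_def by (intro continuous_intros)
    then have "(g \<longlongrightarrow> g s) (at s within {s<..})"
      using continuous_at_imp_continuous_at_within continuous_within by blast
    then have "\<forall>\<^sub>F z in at_right s. g z < 1" using \<open>g s < 1\<close> by (rule order_tendstoD)
    moreover have "\<forall>\<^sub>F z in at_right s. z \<in> {s<..<min R 1}"
      using R \<open>s < 1\<close> by (intro eventually_at_right_real) auto
    ultimately have "\<forall>\<^sub>F z in at_right s. g z < 1 \<and> z \<in> {s<..<min R 1}"
      by (rule eventually_conj)
    then obtain z where z: "g z < 1" "s < z" "z < R" "z < 1"
      using eventually_happens[of _ "at_right s"] by (auto simp: trivial_limit_at_right_real)
    then have "0 < z" using \<open>0 < s\<close> by simp
    have "f N z \<le> 1" for N
    proof -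
      have "f N z \<le> g z"
        unfolding f_def sums_unique[OF g_sums[OF \<open>0 < z\<close> less_imp_le[OF z(3)]]]
        using \<open>0 < z\<close> sums_summable[OF g_sums[of z]] z by (intro sum_le_suminf) auto
      with z show ?thesis by simp
    qed
    then have "z \<in> A"
      using z \<open>0 < z\<close> summable_s[of z] R by (auto simp: A_def)
    then have "z \<le> s" unfolding s_def using bdd by (rule cSup_upper)
    with z show False by simp
  qed
  ultimately have "g s = 1" by simp
  then show ?thesis
    using that[of s R] \<open>0 < s\<close> \<open>s < 1\<close> g_sums[of s] R sum_R by simp
qed

text \<open>All coefficients are nonnegative and the linear one is 1, so the series increases
  strictly on positive arguments.\<close>

lemma phi_zero_unique:
  assumes "0 < y" "0 < z" "(\<lambda>n. phi_coeff t n * y ^ Suc n) sums 1" "(\<lambda>n. phi_coeff t n * z ^ Suc n) sums 1"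
  shows "y = z"
proof -
  have less: False if "0 < y" "y < z" and y: "(\<lambda>n. phi_coeff t n * y ^ Suc n) sums 1"
    and z: "(\<lambda>n. phi_coeff t n * z ^ Suc n) sums 1" for y z :: real
  proof -
    have diff: "(\<lambda>n. phi_coeff t n * z ^ Suc n - phi_coeff t n * y ^ Suc n) sums (1 - 1)"
      using z y by (rule sums_diff)
    have "0 \<le> phi_coeff t n * z ^ Suc n - phi_coeff t n * y ^ Suc n" for n
      using that by (simp add: mult_left_mono power_mono mult_mono)
    then have "(\<Sum>n\<in>{0}. phi_coeff t n * z ^ Suc n - phi_coeff t n * y ^ Suc n)
        \<le> (\<Sum>n. phi_coeff t n * z ^ Suc n - phi_coeff t n * y ^ Suc n)"
      using diff by (intro sum_le_suminf) (auto simp: sums_iff)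
    then show False using diff that by (simp add: sums_iff)
  qed
  show ?thesis using less[of y z] less[of z y] assms by fastforce
qed

text \<open>Existence and uniqueness of the zero give the definite description in \<open>lam\<close>
  its meaning; the convergence demanded there is part of \<open>sums 1\<close>.\<close>

lemma lam_properties:
  shows lam_gt_1: "1 < lam \<beta> t"
    and phi_sums: "(\<lambda>n. phi_coeff t n / lam \<beta> t ^ Suc n) sums 1"
    and H_summable_beyond: "\<exists>r>1. summable (\<lambda>n. H n t q * (r / lam \<beta> t) ^ n)"
proof -
  obtain z R where z: "0 < z" "z < 1" "(\<lambda>n. phi_coeff t n * z ^ Suc n) sums 1"
    "z < R" "summable (\<lambda>n. H n t q * R ^ n)"
    using phi_zero_exists[of t] by blast
  have iff: "0 < y \<and> summable (\<lambda>n. phi_term \<beta> t y (Suc n)) \<and> 1 - phi \<beta> t y = 0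
      \<longleftrightarrow> 0 < y \<and> (\<lambda>n. phi_coeff t n * y ^ Suc n) sums 1" for y
    unfolding phi_def phi_term_Suc sums_iff right_minus_eq by metis
  have "(THE y. 0 < y \<and> (\<lambda>n. phi_coeff t n * y ^ Suc n) sums 1) = z"
    using z(1,3) phi_zero_unique[OF _ z(1) _ z(3)] by (intro the_equality) blast+
  then have "lam \<beta> t = inverse z"
    unfolding lam_def iff by (rule arg_cong)
  then have lam: "lam \<beta> t = 1 / z" by (simp add: inverse_eq_divide)
  show "1 < lam \<beta> t" using z by (simp add: lam)
  show "(\<lambda>n. phi_coeff t n / lam \<beta> t ^ Suc n) sums 1"
    using z by (simp add: lam power_divide del: power_Suc)
  have "(R / z) / lam \<beta> t = R" using z by (simp add: lam)
  then show "\<exists>r>1. summable (\<lambda>n. H n t q * (r / lam \<beta> t) ^ n)"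
    using z by (intro exI[of _ "R / z"]) simp
qed

section \<open>Estimates at the zero\<close>

lemma lam_pos [simp]: "0 < lam \<beta> t" "lam \<beta> t \<noteq> 0" "0 \<le> lam \<beta> t"
  using lam_gt_1[of t] by auto

lemma phi_partial_le_1: "(\<Sum>j<N. phi_coeff t j / lam \<beta> t ^ Suc j) \<le> 1"
proof -
  have "(\<Sum>j<N. phi_coeff t j / lam \<beta> t ^ Suc j) \<le> (\<Sum>j. phi_coeff t j / lam \<beta> t ^ Suc j)"
    using phi_sums by (intro sum_le_suminf) (auto simp: sums_iff)
  then show ?thesis using phi_sums by (simp add: sums_iff)
qed

lemma H_summable: "summable (\<lambda>n. H n t q / lam \<beta> t ^ n)"
proof -
  obtain r where r: "r > 1" "summable (\<lambda>n. H n t q * (r / lam \<beta> t) ^ n)"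
    using H_summable_beyond by blast
  show ?thesis
    by (rule summable_comparison_test'[OF r(2), of 0])
       (use r(1) in \<open>auto simp: power_divide divide_simps abs_mult one_le_power intro!: mult_right_mono\<close>)
qed

lemma pressure_sum_le_lam: "pressure_sum N t \<le> (\<Sum>n. H n t q / lam \<beta> t ^ n) * lam \<beta> t ^ N"
proof -
  have "pressure_sum N t * (1 / lam \<beta> t) ^ N \<le> (\<Sum>n\<le>N. H n t q * (1 / lam \<beta> t) ^ n)"
    by (rule pressure_sum_le) (use phi_partial_le_1 in \<open>simp_all add: power_divide del: power_Suc\<close>)
  also have "\<dots> \<le> (\<Sum>n. H n t q * (1 / lam \<beta> t) ^ n)"
    using H_summable by (intro sum_le_suminf) (auto simp: power_divide)
  finally show ?thesis by (simp add: field_simps power_divide)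
qed

text \<open>The left-hand side, in the limit, is the conformal measure of the set of points below \<open>x\<close>.\<close>

lemma conformal_partial_le_1:
  assumes "x \<in> X"
  shows "(\<Sum>j<N. real (x j) * H j t x / lam \<beta> t ^ Suc j) \<le> 1"
  using assms
proof (induction N arbitrary: x rule: less_induct)
  case (less N)
  define T where "T N x = (\<Sum>j<N. real (x j) * H j t x / lam \<beta> t ^ Suc j)" for N x
  have T_q: "T N q \<le> 1" for N
    using phi_partial_le_1[where N = N and t = t] by (simp add: T_def phi_coeff_def)
  have T_cong: "T j x = T j q" if "\<And>i. i < j \<Longrightarrow> x i = q i" for j x
    unfolding T_def using that by (intro sum.cong) (auto simp: H_cong[of _ x q])
  show ?case
  proof (cases "x = q")
    case True
    then show ?thesis using T_q by (simp add: T_def)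
  next
    case False
    then obtain j where j: "q j = 1" "x j = 0" "\<And>i. i < j \<Longrightarrow> x i = q i"
      using beta_shift_first_difference less.prems by blast
    show ?thesis
    proof (cases "N \<le> j")
      case True
      then have "T N x = T N q" using j(3) by (intro T_cong) auto
      then show ?thesis using T_q[of N] by (simp add: T_def)
    next
      case False
      define M where "M = N - Suc j"
      have N: "N = Suc j + M" "M < N" using False by (auto simp: M_def)
      let ?y = "(shift ^^ Suc j) x"
      have H_j: "H j t x = H j t q" by (rule H_cong) (rule j)
      have "T N x = T (Suc j) x + (\<Sum>i<M. real (x (Suc j + i)) * H (Suc j + i) t x / lam \<beta> t ^ Suc (Suc j + i))"
        unfolding T_def N(1) by (rule sum_lessThan_add)
      also have "T (Suc j) x = T j q"
        using T_cong[of j x] j by (simp add: T_def)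
      also have "(\<Sum>i<M. real (x (Suc j + i)) * H (Suc j + i) t x / lam \<beta> t ^ Suc (Suc j + i))
          = H j t q / lam \<beta> t ^ Suc j * T M ?y"
      proof -
        have "real (x (Suc j + i)) * H (Suc j + i) t x / lam \<beta> t ^ Suc (Suc j + i)
            = H j t q / lam \<beta> t ^ Suc j * (real (?y i) * H i t ?y / lam \<beta> t ^ Suc i)" for i
        proof -
          have "lam \<beta> t ^ Suc (Suc j + i) = lam \<beta> t ^ Suc j * lam \<beta> t ^ Suc i"
            by (metis add_Suc_right power_add)
          moreover have "H (Suc j + i) t x = H j t q * H i t ?y"
            unfolding H_add[of "Suc j"] H_Suc H_j using j(2) by simp
          moreover have "?y i = x (Suc j + i)" by (simp only: shift_funpow add.commute)
          ultimately show ?thesis by (simp only: times_divide_times_eq) (simp only: ac_simps)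
        qed
        then show ?thesis unfolding T_def sum_distrib_left by (intro sum.cong) auto
      qed
      \<comment> \<open>The whole tail of x behind j weighs at most as much as the single term that
        \<open>q\<close> has at j and x lacks.\<close>
      also have "\<dots> \<le> H j t q / lam \<beta> t ^ Suc j * 1"
        using less.IH[OF N(2) shift_in_beta_shift[OF less.prems, of "Suc j"]]
        unfolding T_def by (intro mult_left_mono) auto
      also have "T j q + H j t q / lam \<beta> t ^ Suc j * 1 = T (Suc j) q"
        using j(1) by (simp add: T_def)
      also have "\<dots> \<le> 1" by (rule T_q)
      finally show ?thesis by (simp add: T_def)
    qed
  qed
qed

end

section \<open>A Gibbs measure on the beta-shift\<close>

lemma affine_vimage_sets:
  fixes a b :: real
  assumes [measurable]: "A \<in> sets borel"
  shows "{u. a * u + b \<in> A} \<in> sets borel"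
  by measurable

lemma emeasure_lborel_affine_vimage:
  fixes a b :: real
  assumes "0 < a" and [measurable]: "A \<in> sets borel"
  shows "emeasure lborel {u. a * u + b \<in> A} = ennreal (1 / a) * emeasure lborel A"
proof -
  have m: "{u. a * u + b \<in> A} \<in> sets lborel" by measurable
  have "emeasure lborel A = (\<integral>\<^sup>+x. indicator A x \<partial>lborel)"
    by simp
  also have "\<dots> = \<bar>a\<bar> * (\<integral>\<^sup>+x. indicator A (b + a * x) \<partial>lborel)"
    using assms by (intro nn_integral_real_affine) auto
  also have "(\<integral>\<^sup>+x. indicator A (b + a * x) \<partial>lborel) = (\<integral>\<^sup>+x. indicator {u. a * u + b \<in> A} x \<partial>lborel)"
    by (intro nn_integral_cong) (auto simp: indicator_def add.commute)
  also have "\<dots> = emeasure lborel {u. a * u + b \<in> A}"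
    using m by simp
  finally have "emeasure lborel A = ennreal a * emeasure lborel {u. a * u + b \<in> A}"
    using assms(1) by simp
  then show ?thesis
    using assms(1) by (simp add: mult.assoc[symmetric] ennreal_mult[symmetric])
qed

lemma borel_nat: "measurable M (borel :: nat measure) = measurable M (count_space UNIV)"
  by (rule measurable_cong_sets) (simp_all add: sets_borel_eq_count_space)

lemma measurable_fun_borel_iff:
  fixes f :: "'a \<Rightarrow> nat \<Rightarrow> nat"
  shows "f \<in> borel_measurable M \<longleftrightarrow> (\<forall>i. (\<lambda>x. f x i) \<in> measurable M (count_space UNIV))"
proof
  assume "f \<in> borel_measurable M"
  then have "(\<lambda>x. f x i) \<in> borel_measurable M" for i
    by (rule measurable_compose) measurable
  then show "\<forall>i. (\<lambda>x. f x i) \<in> measurable M (count_space UNIV)"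
    by (simp add: borel_nat)
next
  assume "\<forall>i. (\<lambda>x. f x i) \<in> measurable M (count_space UNIV)"
  then show "f \<in> borel_measurable M"
    by (intro measurable_coordinatewise_then_product) (simp add: borel_nat)
qed

lemma measurable_shift: "shift \<in> borel_measurable borel"
  unfolding measurable_fun_borel_iff shift_apply
  using measurable_product_coordinates[where 'b = nat] by (auto simp: borel_nat)

context beta_expansion
begin

abbreviation "shift_borel \<equiv> restrict_space (borel :: (nat \<Rightarrow> nat) measure) X"

lemma space_shift_borel [simp]: "space shift_borel = X"
  by (simp add: space_restrict_space)

lemma measurable_shift_borel: "shift \<in> measurable shift_borel shift_borel"
  by (intro measurable_restrict_space2 measurable_restrict_space1 measurable_shift)
     (auto intro: shift_in_beta_shift')

definition cyl :: "nat \<Rightarrow> (nat \<Rightarrow> nat) \<Rightarrow> (nat \<Rightarrow> nat) set" where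
  "cyl n x = {y \<in> X. \<forall>i<n. y i = x i}"

lemma cyl_sets: "cyl n x \<in> sets shift_borel"
proof -
  have [measurable]: "(\<lambda>y::nat \<Rightarrow> nat. y i) \<in> measurable borel (count_space UNIV)" for i
    using measurable_fun_borel_iff[of "\<lambda>y. y" borel] by simp
  have "{y. \<forall>i<n. y i = x i} \<in> sets (borel :: (nat \<Rightarrow> nat) measure)"
    by measurable
  moreover have "cyl n x = X \<inter> {y. \<forall>i<n. y i = x i}"
    by (auto simp: cyl_def)
  ultimately show ?thesis by (auto simp: sets_restrict_space)
qed

text \<open>A greedy transformation of the unit interval with slope \<open>lam \<beta> t\<close> on the branch of the digit \<open>0\<close> and
  slope \<open>lam \<beta> t / exp t\<close> on the branch of the digit \<open>1\<close>: Lebesgue measure is conformal for the potential.\<close>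

definition skew_map :: "real \<Rightarrow> real \<Rightarrow> real" where
  "skew_map t u = (if u < 1 / lam \<beta> t then lam \<beta> t * u else (lam \<beta> t * u - 1) / exp t)"

text \<open>Points outside [0, 1) receive the zero sequence, so that every value of
  \<open>code t\<close> lies in \<open>X\<close>.\<close>

definition code :: "real \<Rightarrow> real \<Rightarrow> nat \<Rightarrow> nat" where
  "code t u = (if u \<in> {0..<1} then (\<lambda>i. if (skew_map t ^^ i) u < 1 / lam \<beta> t then 0 else 1) else (\<lambda>_. 0))"

text \<open>The orbit of the point \<open>1\<close>, taken from the left, under \<open>skew_map t\<close>.\<close>

definition thr :: "real \<Rightarrow> nat \<Rightarrow> real" where
  "thr t n = (1 - (\<Sum>j<n. phi_coeff t j / lam \<beta> t ^ Suc j)) / (H n t q / lam \<beta> t ^ n)"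

section \<open>The orbit of 1 and admissibility of the codes\<close>

lemma thr_0 [simp]: "thr t 0 = 1"
  by (simp add: thr_def)

lemma H_lam_pos [simp]: "0 < H n t x / lam \<beta> t ^ m"
  by simp

lemma thr_mult: "thr t n * (H n t q / lam \<beta> t ^ n) = 1 - (\<Sum>j<n. phi_coeff t j / lam \<beta> t ^ Suc j)"
  unfolding thr_def by (rule nonzero_eq_divide_eq[THEN iffD1, OF _ refl]) (simp add: less_imp_neq[OF H_pos, symmetric])

text \<open>The inverse branch of \<open>skew_map t\<close> for the digit \<open>q n\<close> takes
  \<open>thr t (Suc n)\<close> to \<open>thr t n\<close>. This identifies the normalised tails of
  \<open>phi\<close> with the orbit of 1 along the digits of \<open>q\<close>.\<close>

lemma thr_rec: "thr t n = (real (q n) + exp (t * real (q n)) * thr t (Suc n)) / lam \<beta> t"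
proof -
  have "thr t (Suc n) * (H (Suc n) t q / lam \<beta> t ^ Suc n)
      = thr t n * (H n t q / lam \<beta> t ^ n) - real (q n) * (H n t q / lam \<beta> t ^ n) / lam \<beta> t"
    unfolding thr_mult by (simp add: phi_coeff_def)
  then have "(thr t (Suc n) * exp (t * real (q n)) / lam \<beta> t) * (H n t q / lam \<beta> t ^ n)
      = (thr t n - real (q n) / lam \<beta> t) * (H n t q / lam \<beta> t ^ n)"
    by (simp add: H_Suc algebra_simps)
  then have "thr t (Suc n) * exp (t * real (q n)) / lam \<beta> t = thr t n - real (q n) / lam \<beta> t"
    by (rule mult_right_cancel[THEN iffD1, rotated]) (simp add: less_imp_neq[OF H_pos, symmetric])
  then show ?thesis by (simp add: field_simps)
qed

lemma thr_nonneg: "0 \<le> thr t n"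
  unfolding thr_def by (intro divide_nonneg_pos H_lam_pos) (simp only: diff_ge_0_iff_ge phi_partial_le_1)

text \<open>The tail of \<open>phi\<close> from n on is \<open>H n t q / lam \<beta> t ^ n\<close>
  times the conformal sum of the shifted expansion, and this sum is at most 1 because the shifted
  expansion lies in \<open>X\<close>.\<close>

lemma thr_le_1: "thr t n \<le> 1"
proof -
  let ?a = "\<lambda>j. phi_coeff t j / lam \<beta> t ^ Suc j"
  have "(\<Sum>j<M. ?a j) \<le> (\<Sum>j<n. ?a j) + H n t q / lam \<beta> t ^ n" if "M \<ge> n" for M
  proof -
    obtain k where M: "M = n + k" using \<open>n \<le> M\<close> le_Suc_ex by blast
    let ?y = "(shift ^^ n) q"
    have "?a (n + i) = H n t q / lam \<beta> t ^ n * (real (?y i) * H i t ?y / lam \<beta> t ^ Suc i)" for i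
      by (simp add: phi_coeff_def H_add[of n i] power_add add.commute[of i n] mult_ac)
    then have "(\<Sum>j<M. ?a j) = (\<Sum>j<n. ?a j)
        + H n t q / lam \<beta> t ^ n * (\<Sum>i<k. real (?y i) * H i t ?y / lam \<beta> t ^ Suc i)"
      unfolding M sum_lessThan_add sum_distrib_left by (simp only:)
    also have "\<dots> \<le> (\<Sum>j<n. ?a j) + H n t q / lam \<beta> t ^ n * 1"
      by (intro add_left_mono mult_left_mono conformal_partial_le_1
            shift_in_beta_shift q_in_beta_shift) simp
    finally show ?thesis by simp
  qed
  then have "1 \<le> (\<Sum>j<n. ?a j) + H n t q / lam \<beta> t ^ n"
    using phi_sums[of t] unfolding sums_def by (intro LIMSEQ_le_const2) auto
  then have "thr t n * (H n t q / lam \<beta> t ^ n) \<le> 1 * (H n t q / lam \<beta> t ^ n)"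
    unfolding thr_mult by simp
  then show ?thesis
    by (rule mult_right_le_imp_le) simp
qed

lemma thr_digit_0: "q n = 0 \<Longrightarrow> thr t n \<le> 1 / lam \<beta> t"
  using thr_rec[of t n] thr_le_1[of t "Suc n"] by (simp add: divide_right_mono)

lemma thr_digit_1: "q n = 1 \<Longrightarrow> 1 / lam \<beta> t \<le> thr t n"
  using thr_rec[of t n] thr_nonneg[of t "Suc n"] by (simp add: divide_right_mono)

text \<open>Both branches are increasing, so a point that shares the digit of the threshold stays
  strictly below its image.\<close>

lemma skew_map_less_thr:
  assumes "0 \<le> u" "u < thr t n" "q n = (if u < 1 / lam \<beta> t then 0 else 1)"
  shows "skew_map t u < thr t (Suc n)"
  using assms thr_rec[of t n]
  by (auto simp: skew_map_def divide_less_eq less_divide_eq mult.commute split: if_splits)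

lemma skew_map_unit:
  assumes "u \<in> {0..<1}"
  shows "skew_map t u \<in> {0..<1}"
proof (cases "u < 1 / lam \<beta> t")
  case True
  then show ?thesis using assms by (simp add: skew_map_def less_divide_eq mult.commute)
next
  case False
  \<comment> \<open>Since \<open>q 0 = 1\<close> and \<open>thr t 0 = 1\<close>, the image of the
    branch of the digit 1 ends at \<open>thr t (Suc 0)\<close>, possibly short of 1.\<close>
  then have "skew_map t u < thr t (Suc 0)" using assms by (intro skew_map_less_thr) auto
  moreover have "0 \<le> skew_map t u"
    using False by (simp add: skew_map_def divide_le_eq mult.commute not_less)
  ultimately show ?thesis using thr_le_1[of t "Suc 0"] by simp
qed

lemma skew_map_funpow_unit: "u \<in> {0..<1} \<Longrightarrow> (skew_map t ^^ i) u \<in> {0..<1}"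
  by (induction i) (use skew_map_unit in auto)

lemma code_skew_map: "u \<in> {0..<1} \<Longrightarrow> code t (skew_map t u) = shift (code t u)"
  using skew_map_unit[of u t]
  by (auto simp: code_def fun_eq_iff shift_apply funpow_Suc_right simp del: funpow.simps)

text \<open>While the digits agree, the orbit of u stays strictly below the orbit of 1. At a zero of
  \<open>q\<close> the threshold is at most \<open>1 / lam \<beta> t\<close> and forces the digit 0,
  so the first difference occurs at a one of \<open>q\<close>.\<close>

lemma code_le_q:
  assumes u: "u \<in> {0..<1}"
  shows "lex_le (code t u) q"
proof (rule lex_leI)
  fix j assume ne: "code t u j \<noteq> q j" and same: "\<And>i. i < j \<Longrightarrow> code t u i = q i"
  have less: "(skew_map t ^^ i) u < thr t i" if "i \<le> j" for i
    using that
  proof (induction i)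
    case 0
    show ?case using u by simp
  next
    case (Suc i)
    have "q i = (if (skew_map t ^^ i) u < 1 / lam \<beta> t then 0 else 1)"
      using same[of i] Suc.prems u by (simp add: code_def)
    then show ?case
      using Suc skew_map_funpow_unit[OF u, of i t] by (simp add: skew_map_less_thr)
  qed
  have "code t u j = 0" if "q j = 0"
    using less[of j] thr_digit_0[OF that, of t] u by (simp add: code_def)
  with ne q_digit[of j] have "q j = 1" "code t u j \<noteq> 1" by auto
  moreover have "code t u j = 0 \<or> code t u j = 1" by (simp add: code_def)
  ultimately show "code t u j < q j" by auto
qed

lemma code_in_beta_shift: "code t u \<in> X"
proof (cases "u \<in> {0..<1}")
  case True
  have "(shift ^^ n) (code t u) = code t ((skew_map t ^^ n) u)" for n
  proof (induction n)
    case (Suc n)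
    show ?case
      by (simp only: funpow.simps o_apply Suc code_skew_map[OF skew_map_funpow_unit[OF True]])
  qed simp
  then have "lex_le ((shift ^^ n) (code t u)) q" for n
    using code_le_q skew_map_funpow_unit[OF True] by simp
  then show ?thesis by (auto simp: beta_shift_def code_def)
next
  case False
  then have "code t u = (\<lambda>_. 0)" by (auto simp: code_def)
  then show ?thesis by (simp add: zero_in_beta_shift)
qed

section \<open>Measurability and Lebesgue measure of coded cylinders\<close>

lemma measurable_skew_map [measurable]: "skew_map t \<in> borel_measurable borel"
  unfolding skew_map_def[abs_def] by measurable

lemma measurable_code: "code t \<in> measurable borel shift_borel"
proof (rule measurable_restrict_space2)
  show "code t \<in> borel_measurable borel"
    unfolding measurable_fun_borel_iff
  proof
    fix i
    have "(\<lambda>u. code t u i) = (\<lambda>u. if u \<in> {0..<1} \<and> \<not> (skew_map t ^^ i) u < 1 / lam \<beta> t then 1 else 0)"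
      by (auto simp: code_def fun_eq_iff)
    also have "\<dots> \<in> measurable borel (count_space UNIV)" by measurable
    finally show "(\<lambda>u. code t u i) \<in> measurable borel (count_space UNIV)" .
  qed
qed (use code_in_beta_shift in auto)

text \<open>Pulling back along the affine branch of the first digit divides Lebesgue measure by its
  slope \<open>lam \<beta> t / exp (t * x 0)\<close>. There is only an inequality because the branch
  of the digit 1 need not be onto and digits above 1 have empty cylinders.\<close>

lemma emeasure_code_cyl:
  "emeasure lborel {u \<in> {0..<1}. code t u \<in> cyl n x} \<le> ennreal (H n t x / lam \<beta> t ^ n)"
proof (induction n arbitrary: x)
  case 0
  have "emeasure lborel {u \<in> {0..<1}. code t u \<in> cyl 0 x} \<le> emeasure lborel {0..<1::real}"
    by (intro emeasure_mono) auto
  then show ?case by simp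
next
  case (Suc n)
  let ?C = "{u \<in> {0..<1}. code t u \<in> cyl n (shift x)}"
  have C: "?C \<in> sets borel"
  proof -
    have "?C = {0..<1} \<inter> (code t -` cyl n (shift x) \<inter> space borel)" by auto
    moreover have "code t -` cyl n (shift x) \<inter> space borel \<in> sets borel"
      by (rule measurable_sets[OF measurable_code cyl_sets])
    ultimately show ?thesis by simp
  qed
  have step: "skew_map t u \<in> ?C" "x 0 = (if u < 1 / lam \<beta> t then 0 else 1)"
    if "u \<in> {0..<1}" "code t u \<in> cyl (Suc n) x" for u
  proof -
    show "skew_map t u \<in> ?C"
      using that skew_map_unit[OF that(1), of t] code_in_beta_shift
      by (auto simp: code_skew_map cyl_def shift_apply)
    show "x 0 = (if u < 1 / lam \<beta> t then 0 else 1)"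
      using that by (auto simp: cyl_def code_def)
  qed
  consider "x 0 = 0" | "x 0 = 1" | "x 0 > 1" by linarith
  then have "emeasure lborel {u \<in> {0..<1}. code t u \<in> cyl (Suc n) x}
      \<le> ennreal (exp (t * real (x 0)) / lam \<beta> t) * emeasure lborel ?C"
  proof cases
    case 1
    have "{u \<in> {0..<1}. code t u \<in> cyl (Suc n) x} \<subseteq> {u. lam \<beta> t * u + 0 \<in> ?C}"
    proof safe
      fix u assume u: "u \<in> {0..<1}" "code t u \<in> cyl (Suc n) x"
      then show "lam \<beta> t * u + 0 \<in> {0..<1}" "code t (lam \<beta> t * u + 0) \<in> cyl n (shift x)"
        using step[OF u] 1 by (auto simp: skew_map_def split: if_splits)
    qed
    then have "emeasure lborel {u \<in> {0..<1}. code t u \<in> cyl (Suc n) x}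
        \<le> emeasure lborel {u. lam \<beta> t * u + 0 \<in> ?C}"
      by (rule emeasure_mono) (simp only: sets_lborel affine_vimage_sets[OF C])
    also have "\<dots> = ennreal (1 / lam \<beta> t) * emeasure lborel ?C"
      using C by (intro emeasure_lborel_affine_vimage) auto
    finally show ?thesis using 1 by simp
  next
    case 2
    have "{u \<in> {0..<1}. code t u \<in> cyl (Suc n) x}
        \<subseteq> {u. (lam \<beta> t / exp t) * u + (- 1 / exp t) \<in> ?C}"
    proof safe
      fix u assume u: "u \<in> {0..<1}" "code t u \<in> cyl (Suc n) x"
      then have "skew_map t u = (lam \<beta> t / exp t) * u + (- 1 / exp t)"
        using step[OF u] 2 by (auto simp: skew_map_def diff_divide_distrib split: if_splits)
      then show "(lam \<beta> t / exp t) * u + (- 1 / exp t) \<in> {0..<1}"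
        "code t ((lam \<beta> t / exp t) * u + (- 1 / exp t)) \<in> cyl n (shift x)"
        using step[OF u] by auto
    qed
    then have "emeasure lborel {u \<in> {0..<1}. code t u \<in> cyl (Suc n) x}
        \<le> emeasure lborel {u. (lam \<beta> t / exp t) * u + (- 1 / exp t) \<in> ?C}"
      by (rule emeasure_mono) (simp only: sets_lborel affine_vimage_sets[OF C])
    also have "\<dots> = ennreal (1 / (lam \<beta> t / exp t)) * emeasure lborel ?C"
      using C by (intro emeasure_lborel_affine_vimage) auto
    finally show ?thesis using 2 by simp
  next
    case 3
    then have empty: "{u \<in> {0..<1}. code t u \<in> cyl (Suc n) x} = {}"
      using step(2) by (force split: if_splits)
    show ?thesis unfolding empty by simp
  qed
  also have "\<dots> \<le> ennreal (exp (t * real (x 0)) / lam \<beta> t) * ennreal (H n t (shift x) / lam \<beta> t ^ n)"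
    using Suc[of "shift x"] by (rule mult_left_mono) simp
  also have "\<dots> = ennreal (H (Suc n) t x / lam \<beta> t ^ Suc n)"
    using H_add[of 1 n t x] by (simp add: ennreal_mult[symmetric] H_Suc[of 0])
  finally show ?case .
qed

text \<open>The transfer operator on the indicator of \<open>{0..<thr t n}\<close>. For
  \<open>q n = 0\<close> the interval lies in the branch of 0 and is mapped onto
  \<open>{0..<thr t (Suc n)}\<close>. For \<open>q n = 1\<close> it contains that whole branch,
  mapped onto the unit interval, and an initial piece of the branch of 1, mapped onto
  \<open>{0..<thr t (Suc n)}\<close>.\<close>

lemma emeasure_skew_map_vimage:
  assumes B: "B \<in> sets borel" "B \<subseteq> {0..<1}"
  shows "emeasure lborel {u \<in> {0..<thr t n}. skew_map t u \<in> B}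
    = ennreal (real (q n) / lam \<beta> t) * emeasure lborel B
      + ennreal (exp (t * real (q n)) / lam \<beta> t) * emeasure lborel (B \<inter> {0..<thr t (Suc n)})"
proof -
  let ?B = "B \<inter> {0..<thr t (Suc n)}"
  have B': "?B \<in> sets borel" using B by simp
  consider "q n = 0" | "q n = 1" using q_digit[of n] by auto
  then show ?thesis
  proof cases
    case 1
    have "{u \<in> {0..<thr t n}. skew_map t u \<in> B} = {u. lam \<beta> t * u + 0 \<in> ?B}"
    proof (intro set_eqI iffI)
      fix u assume u: "u \<in> {u \<in> {0..<thr t n}. skew_map t u \<in> B}"
      then have "u < 1 / lam \<beta> t" using thr_digit_0[OF 1, of t] by auto
      then show "u \<in> {u. lam \<beta> t * u + 0 \<in> ?B}"
        using u thr_rec[of t n] 1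
        by (auto simp: skew_map_def less_divide_eq mult.commute)
    next
      fix u assume u: "u \<in> {u. lam \<beta> t * u + 0 \<in> ?B}"
      then have "0 \<le> lam \<beta> t * u" by auto
      then have "0 \<le> u" using lam_gt_1[of t] by (simp add: zero_le_mult_iff)
      moreover have "u < thr t n"
        using u thr_rec[of t n] 1 by (auto simp: less_divide_eq mult.commute)
      moreover have "u < 1 / lam \<beta> t" using thr_digit_0[OF 1, of t] calculation by auto
      ultimately show "u \<in> {u \<in> {0..<thr t n}. skew_map t u \<in> B}"
        using u by (auto simp: skew_map_def)
    qed
    then show ?thesis
      using emeasure_lborel_affine_vimage[of "lam \<beta> t" ?B 0] B' 1 by simp
  next
    case 2
    let ?L = "{u. lam \<beta> t * u + 0 \<in> B}"
    let ?R = "{u. (lam \<beta> t / exp t) * u + (- 1 / exp t) \<in> ?B}"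
    have affine: "(lam \<beta> t / exp t) * u + (- 1 / exp t) = (lam \<beta> t * u - 1) / exp t" for u
      by (simp add: diff_divide_distrib)
    have R: "u \<in> ?R \<longleftrightarrow> 1 / lam \<beta> t \<le> u \<and> u < thr t n \<and> (lam \<beta> t * u - 1) / exp t \<in> B" for u
    proof -
      have "0 \<le> (lam \<beta> t * u - 1) / exp t \<longleftrightarrow> 1 / lam \<beta> t \<le> u"
        by (simp add: zero_le_divide_iff divide_le_eq mult.commute)
      moreover have "(lam \<beta> t * u - 1) / exp t < thr t (Suc n) \<longleftrightarrow> u < thr t n"
        using thr_rec[of t n] 2 by (simp add: divide_less_eq less_divide_eq mult.commute algebra_simps)
      ultimately show ?thesis unfolding affine by auto
    qed
    have L: "u \<in> ?L \<longleftrightarrow> 0 \<le> u \<and> u < 1 / lam \<beta> t \<and> lam \<beta> t * u \<in> B" for u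
    proof -
      have "0 \<le> u \<and> u < 1 / lam \<beta> t" if "lam \<beta> t * u \<in> B"
      proof -
        have "0 \<le> lam \<beta> t * u" "lam \<beta> t * u < 1" using that B(2) by auto
        then show ?thesis
          using lam_gt_1[of t] by (auto simp: zero_le_mult_iff less_divide_eq mult.commute)
      qed
      then show ?thesis by auto
    qed
    have "{u \<in> {0..<thr t n}. skew_map t u \<in> B} = ?L \<union> ?R"
    proof (intro set_eqI)
      fix u
      have "0 < 1 / lam \<beta> t" by simp
      then have "0 \<le> u" if "\<not> u < 1 / lam \<beta> t" using that by linarith
      then show "u \<in> {u \<in> {0..<thr t n}. skew_map t u \<in> B} \<longleftrightarrow> u \<in> ?L \<union> ?R"
        using thr_digit_1[OF 2, of t] unfolding Un_iff L R by (auto simp: skew_map_def simp del: zero_less_divide_1_iff)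
    qed
    moreover have "?L \<inter> ?R = {}"
    proof -
      have False if "u \<in> ?L" "u \<in> ?R" for u
        using that unfolding L R by simp
      then show ?thesis by blast
    qed
    ultimately have "emeasure lborel {u \<in> {0..<thr t n}. skew_map t u \<in> B}
        = emeasure lborel ?L + emeasure lborel ?R"
      using affine_vimage_sets[OF B(1)] affine_vimage_sets[OF B'] 
      by (simp only: plus_emeasure[of _ lborel] sets_lborel)
    then show ?thesis
      using emeasure_lborel_affine_vimage[of "lam \<beta> t" B 0]
        emeasure_lborel_affine_vimage[of "lam \<beta> t / exp t" ?B "- 1 / exp t"] B B' 2 by simp
  qed
qed

section \<open>Parry's density and the normalised invariant measure\<close>

definition parry_density :: "real \<Rightarrow> real \<Rightarrow> ennreal" where
  "parry_density t u = (\<Sum>n. ennreal (H n t q / lam \<beta> t ^ n) * indicator {0..<thr t n} u)"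

definition parry :: "real \<Rightarrow> real measure" where
  "parry t = density lborel (parry_density t)"

definition gibbs :: "real \<Rightarrow> (nat \<Rightarrow> nat) measure" where
  "gibbs t = distr (scale_measure (inverse (emeasure (parry t) UNIV)) (parry t)) shift_borel (code t)"

lemma measurable_parry_density [measurable]: "parry_density t \<in> borel_measurable borel"
  unfolding parry_density_def[abs_def] by measurable

lemma sets_parry [simp, measurable_cong]: "sets (parry t) = sets borel"
  by (simp add: parry_def)

lemma space_parry [simp]: "space (parry t) = UNIV"
  by (simp add: parry_def)

lemma emeasure_parry:
  assumes [measurable]: "A \<in> sets borel"
  shows "emeasure (parry t) A = (\<Sum>n. ennreal (H n t q / lam \<beta> t ^ n) * emeasure lborel (A \<inter> {0..<thr t n}))"
proof -
  have "emeasure (parry t) A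
      = (\<integral>\<^sup>+u. (\<Sum>n. ennreal (H n t q / lam \<beta> t ^ n) * indicator (A \<inter> {0..<thr t n}) u) \<partial>lborel)"
    unfolding parry_def by (subst emeasure_density)
      (auto simp: parry_density_def indicator_def intro!: nn_integral_cong)
  also have "\<dots> = (\<Sum>n. \<integral>\<^sup>+u. ennreal (H n t q / lam \<beta> t ^ n) * indicator (A \<inter> {0..<thr t n}) u \<partial>lborel)"
    by (rule nn_integral_suminf) measurable
  also have "\<dots> = (\<Sum>n. ennreal (H n t q / lam \<beta> t ^ n) * emeasure lborel (A \<inter> {0..<thr t n}))"
    by (intro suminf_cong nn_integral_cmult_indicator) simp
  finally show ?thesis .
qed

lemma emeasure_parry_le:
  assumes "A \<in> sets borel"
  shows "emeasure (parry t) A \<le> ennreal (\<Sum>n. H n t q / lam \<beta> t ^ n) * emeasure lborel (A \<inter> {0..<1})"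
proof -
  have "emeasure (parry t) A \<le> (\<Sum>n. ennreal (H n t q / lam \<beta> t ^ n) * emeasure lborel (A \<inter> {0..<1}))"
    unfolding emeasure_parry[OF assms] 
  proof (intro suminf_le mult_left_mono emeasure_mono)
    show "A \<inter> {0..<thr t n} \<subseteq> A \<inter> {0..<1}" for n
      using thr_le_1[of t n] by auto
  qed (use assms in auto)
  also have "\<dots> = ennreal (\<Sum>n. H n t q / lam \<beta> t ^ n) * emeasure lborel (A \<inter> {0..<1})"
    using H_summable[of t] by (simp add: suminf_ennreal2)
  finally show ?thesis .
qed

lemma parry_mass: "1 \<le> emeasure (parry t) UNIV" "emeasure (parry t) UNIV \<noteq> \<infinity>"
proof -
  let ?f = "\<lambda>n. ennreal (H n t q / lam \<beta> t ^ n) * emeasure lborel (UNIV \<inter> {0..<thr t n})"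
  have "sum ?f {0} \<le> suminf ?f" by (intro sum_le_suminf) auto
  then show "1 \<le> emeasure (parry t) UNIV" by (simp add: emeasure_parry)
  have "emeasure (parry t) UNIV \<le> ennreal (\<Sum>n. H n t q / lam \<beta> t ^ n)"
    using emeasure_parry_le[of UNIV t] by simp
  then show "emeasure (parry t) UNIV \<noteq> \<infinity>" by (auto simp: top_unique)
qed

text \<open>The preimage turns the n-th term of the density into its successor plus Lebesgue measure
  times the n-th coefficient of \<open>phi\<close> at \<open>1 / lam \<beta> t\<close>. These
  coefficients sum to 1, which restores the lost term of index 0 because
  \<open>thr t 0 = 1\<close>.\<close>

lemma parry_invariant:
  assumes B: "B \<in> sets borel" "B \<subseteq> {0..<1}"
  shows "emeasure (parry t) {u \<in> {0..<1}. skew_map t u \<in> B} = emeasure (parry t) B"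
proof -
  define h where "h n = H n t q / lam \<beta> t ^ n" for n
  define L where "L n = emeasure lborel (B \<inter> {0..<thr t n})" for n
  have h_nonneg: "0 \<le> h n" for n by (simp add: h_def)
  have [measurable]: "B \<in> sets borel" by fact
  have h_Suc: "h n * (exp (t * real (q n)) / lam \<beta> t) = h (Suc n)" for n
    by (simp add: h_def H_Suc)
  have h_coeff: "h n * (real (q n) / lam \<beta> t) = phi_coeff t n / lam \<beta> t ^ Suc n" for n
    by (simp add: h_def phi_coeff_def mult_ac)
  have L0: "L 0 = emeasure lborel B"
    using B(2) by (auto simp: L_def intro!: arg_cong[where f = "emeasure lborel"])
  have "emeasure (parry t) {u \<in> {0..<1}. skew_map t u \<in> B}
      = (\<Sum>n. ennreal (h n) * emeasure lborel {u \<in> {0..<thr t n}. skew_map t u \<in> B})"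
  proof -
    have "{u \<in> {0..<1}. skew_map t u \<in> B} \<inter> {0..<thr t n} = {u \<in> {0..<thr t n}. skew_map t u \<in> B}" for n
      using thr_le_1[of t n] by auto
    moreover have "{u \<in> {0..<1}. skew_map t u \<in> B} \<in> sets borel" by measurable
    ultimately show ?thesis by (simp add: emeasure_parry h_def)
  qed
  also have "\<dots> = (\<Sum>n. ennreal (phi_coeff t n / lam \<beta> t ^ Suc n) * L 0 + ennreal (h (Suc n)) * L (Suc n))"
  proof (intro suminf_cong)
    fix n
    show "ennreal (h n) * emeasure lborel {u \<in> {0..<thr t n}. skew_map t u \<in> B}
        = ennreal (phi_coeff t n / lam \<beta> t ^ Suc n) * L 0 + ennreal (h (Suc n)) * L (Suc n)"
      unfolding emeasure_skew_map_vimage[OF B] L0 L_def[of "Suc n"] distrib_left mult.assoc[symmetric]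
      by (simp only: ennreal_mult[symmetric] h_nonneg h_Suc h_coeff divide_nonneg_nonneg of_nat_0_le_iff lam_pos exp_ge_zero)
  qed
  also have "\<dots> = (\<Sum>n. ennreal (phi_coeff t n / lam \<beta> t ^ Suc n)) * L 0 + (\<Sum>n. ennreal (h (Suc n)) * L (Suc n))"
    by (subst suminf_add[symmetric]) (auto simp del: power_Suc)
  also have "(\<Sum>n. ennreal (phi_coeff t n / lam \<beta> t ^ Suc n)) = ennreal 1"
    using phi_sums[of t] by (intro suminf_ennreal_eq) (auto simp del: power_Suc)
  also have "ennreal 1 * L 0 + (\<Sum>n. ennreal (h (Suc n)) * L (Suc n)) = (\<Sum>n. ennreal (h n) * L n)"
  proof -
    have "(\<lambda>n. ennreal (h n) * L n) sums ((\<Sum>n. ennreal (h (Suc n)) * L (Suc n)) + ennreal (h 0) * L 0)"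
      by (intro sums_Suc summable_sums) auto
    then show ?thesis by (simp add: sums_iff h_def add.commute)
  qed
  also have "\<dots> = emeasure (parry t) B"
    by (simp add: emeasure_parry h_def L_def)
  finally show ?thesis .
qed

lemma sets_gibbs [simp, measurable_cong]: "sets (gibbs t) = sets shift_borel"
  by (simp add: gibbs_def)

lemma space_gibbs [simp]: "space (gibbs t) = X"
  by (simp add: gibbs_def)

lemma measurable_code_parry: "code t \<in> measurable (scale_measure c (parry t)) shift_borel"
  using measurable_code by (subst measurable_cong_sets[of _ borel]) auto

lemma emeasure_gibbs:
  assumes "A \<in> sets shift_borel"
  shows "emeasure (gibbs t) A = emeasure (parry t) (code t -` A) / emeasure (parry t) UNIV"
  using assms unfolding gibbs_def
  by (subst emeasure_distr[OF measurable_code_parry])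
     (simp_all add: space_scale_measure divide_ennreal_def mult.commute)

lemma prob_space_gibbs: "prob_space (gibbs t)"
proof
  have "code t -` X = UNIV" using code_in_beta_shift by auto
  moreover have "X \<in> sets shift_borel" by (metis sets.top space_shift_borel)
  ultimately have "emeasure (gibbs t) X = emeasure (parry t) UNIV / emeasure (parry t) UNIV"
    using emeasure_gibbs by simp
  also have "\<dots> = 1"
    using parry_mass[of t] by (intro ennreal_divide_self) (auto simp: less_top)
  finally show "emeasure (gibbs t) (space (gibbs t)) = 1" by simp
qed

lemma emeasure_parry_unit:
  assumes "A \<in> sets borel"
  shows "emeasure (parry t) A = emeasure (parry t) (A \<inter> {0..<1})"
proof -
  have "A \<inter> {0..<thr t n} = A \<inter> {0..<1} \<inter> {0..<thr t n}" for n
    using thr_le_1[of t n] by auto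
  then show ?thesis using assms by (simp add: emeasure_parry)
qed

lemma gibbs_invariant: "gibbs t \<in> invariant_measures X shift"
proof -
  have shift: "shift \<in> measurable (gibbs t) (gibbs t)"
    using measurable_shift_borel by (subst measurable_cong_sets[of _ shift_borel _ shift_borel]) auto
  have "distr (gibbs t) (gibbs t) shift = gibbs t"
  proof (rule measure_eqI)
    fix A assume "A \<in> sets (distr (gibbs t) (gibbs t) shift)"
    then have A: "A \<in> sets shift_borel" by simp
    have code_sets: "code t -` B \<in> sets borel" if "B \<in> sets shift_borel" for B
      using measurable_sets[OF measurable_code that] by simp
    have shift_A: "shift -` A \<inter> X \<in> sets shift_borel"
      using measurable_sets[OF measurable_shift_borel A] by simp
    let ?B = "code t -` A \<inter> {0..<1}"
    have "emeasure (distr (gibbs t) (gibbs t) shift) A = emeasure (gibbs t) (shift -` A \<inter> X)"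
      using A shift by (simp add: emeasure_distr)
    also have "\<dots> = emeasure (parry t) (code t -` (shift -` A \<inter> X)) / emeasure (parry t) UNIV"
      using shift_A by (rule emeasure_gibbs)
    \<comment> \<open>\<open>code t\<close> intertwines the two maps on [0, 1) only, and this
      interval carries the whole measure.\<close>
    also have "emeasure (parry t) (code t -` (shift -` A \<inter> X))
        = emeasure (parry t) (code t -` (shift -` A \<inter> X) \<inter> {0..<1})"
      using code_sets[OF shift_A] by (rule emeasure_parry_unit)
    also have "code t -` (shift -` A \<inter> X) \<inter> {0..<1} = {u \<in> {0..<1}. skew_map t u \<in> ?B}"
    proof (intro set_eqI)
      fix u
      show "u \<in> code t -` (shift -` A \<inter> X) \<inter> {0..<1} \<longleftrightarrow> u \<in> {u \<in> {0..<1}. skew_map t u \<in> ?B}"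
      proof (cases "u \<in> {0..<1}")
        case True
        then show ?thesis
          using code_skew_map[OF True, of t] skew_map_unit[OF True, of t] code_in_beta_shift[of t u] by simp
      next
        case False
        then show ?thesis by auto
      qed
    qed
    also have "emeasure (parry t) \<dots> = emeasure (parry t) ?B"
      using code_sets[OF A] by (intro parry_invariant) auto
    also have "\<dots> = emeasure (parry t) (code t -` A)"
      using code_sets[OF A] by (rule emeasure_parry_unit[symmetric])
    also have "\<dots> / emeasure (parry t) UNIV = emeasure (gibbs t) A"
      using A by (rule emeasure_gibbs[symmetric])
    finally show "emeasure (distr (gibbs t) (gibbs t) shift) A = emeasure (gibbs t) A" .
  qed simp
  then show ?thesis
    using shift prob_space_gibbs by (simp add: invariant_measures_def)
qed

text \<open>Parry's density is bounded and its total mass is at least 1. This upper half of the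
  Gibbs property feeds both the lower bound for the entropy and the mass distribution
  principle.\<close>

lemma gibbs_cyl_le:
  obtains C where "1 \<le> C" "\<And>n x. measure (gibbs t) (cyl n x) \<le> C * (H n t x / lam \<beta> t ^ n)"
proof -
  define C where "C = (\<Sum>n. H n t q / lam \<beta> t ^ n)"
  have "(\<Sum>n\<in>{0}. H n t q / lam \<beta> t ^ n) \<le> C"
    unfolding C_def using H_summable by (intro sum_le_suminf) auto
  then have "1 \<le> C" by simp
  moreover have "measure (gibbs t) (cyl n x) \<le> C * (H n t x / lam \<beta> t ^ n)" for n x
  proof -
    have code: "code t -` cyl n x \<in> sets borel"
      using measurable_sets[OF measurable_code cyl_sets] by simp
    have "emeasure (gibbs t) (cyl n x) = emeasure (parry t) (code t -` cyl n x) / emeasure (parry t) UNIV"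
      by (rule emeasure_gibbs[OF cyl_sets])
    also have "\<dots> \<le> emeasure (parry t) (code t -` cyl n x) * 1"
    proof -
      obtain r where r: "emeasure (parry t) UNIV = ennreal r" "0 \<le> r"
        using parry_mass(2)[of t] by (cases "emeasure (parry t) UNIV") auto
      then have "1 \<le> r" using parry_mass(1)[of t] by simp
      then have "inverse (emeasure (parry t) UNIV) \<le> 1"
        using r \<open>1 \<le> r\<close> by (simp add: inverse_ennreal inverse_le_1_iff)
      then show ?thesis unfolding divide_ennreal_def by (intro mult_left_mono) auto
    qed
    also have "\<dots> \<le> ennreal C * emeasure lborel (code t -` cyl n x \<inter> {0..<1})"
      using emeasure_parry_le[OF code] by (simp add: C_def)
    also have "code t -` cyl n x \<inter> {0..<1} = {u \<in> {0..<1}. code t u \<in> cyl n x}"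
      by auto
    also have "ennreal C * emeasure lborel \<dots> \<le> ennreal C * ennreal (H n t x / lam \<beta> t ^ n)"
      by (intro mult_left_mono emeasure_code_cyl) simp
    also have "\<dots> = ennreal (C * (H n t x / lam \<beta> t ^ n))"
      using \<open>1 \<le> C\<close> by (subst ennreal_mult) auto
    finally show ?thesis
      using \<open>1 \<le> C\<close> by (simp add: measure_def enn2real_leI)
  qed
  ultimately show ?thesis using that by blast
qed

end

section \<open>Entropy of labelled processes\<close>

definition pr :: "'a measure \<Rightarrow> ('a \<Rightarrow> 'b) \<Rightarrow> 'b \<Rightarrow> real" where
  "pr M f v = measure M (f -` {v} \<inter> space M)"

text \<open>Entropy is attached to a label map rather than to a partition: joins become pairs, and
  refinement becomes functional dependence.\<close>

definition ent :: "'a measure \<Rightarrow> ('a \<Rightarrow> 'b) \<Rightarrow> real" where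
  "ent M f = - (\<Sum>v\<in>f ` space M. pr M f v * ln (pr M f v))"

lemma pr_nonneg [simp]: "0 \<le> pr M f v"
  by (simp add: pr_def)

lemma pr_cong: "(\<And>x. x \<in> space M \<Longrightarrow> f x = g x) \<Longrightarrow> pr M f v = pr M g v"
  unfolding pr_def by (rule arg_cong[where f = "measure M"]) auto

lemma ent_cong: "(\<And>x. x \<in> space M \<Longrightarrow> f x = g x) \<Longrightarrow> ent M f = ent M g"
  unfolding ent_def using pr_cong[of M f g] by (simp cong: image_cong)

lemma pr_eq_0: "v \<notin> f ` space M \<Longrightarrow> pr M f v = 0"
proof -
  assume "v \<notin> f ` space M"
  then have "f -` {v} \<inter> space M = {}" by auto
  then show ?thesis unfolding pr_def by simp
qed

lemma ent_superset:
  assumes "finite A" "f ` space M \<subseteq> A"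
  shows "ent M f = - (\<Sum>v\<in>A. pr M f v * ln (pr M f v))"
  unfolding ent_def using assms pr_eq_0[of _ f M] by (subst sum.mono_neutral_left[of A "f ` space M"]) auto

context prob_space
begin

lemma pr_le_1: "pr M f v \<le> 1"
  by (simp add: pr_def)

lemma pr_le_pr_comp: "simple_function M f \<Longrightarrow> simple_function M (\<lambda>x. g (f x)) \<Longrightarrow> pr M f v \<le> pr M (\<lambda>x. g (f x)) (g v)"
  unfolding pr_def by (intro finite_measure_mono) (auto dest: simple_functionD)

lemma ent_nonneg: "0 \<le> ent M f"
proof -
  have "pr M f v * ln (pr M f v) \<le> 0" for v
    using pr_le_1[of f v] by (cases "pr M f v = 0") (auto simp: mult_le_0_iff ln_le_zero_iff order_less_le)
  then show ?thesis unfolding ent_def by (simp add: sum_nonpos)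
qed

lemma expectation_simple:
  assumes f: "simple_function M f"
  shows "(\<integral>x. (g (f x) :: real) \<partial>M) = (\<Sum>v\<in>f ` space M. pr M f v * g v)"
proof -
  have fin: "finite (f ` space M)" and sets: "\<And>v. f -` {v} \<inter> space M \<in> sets M"
    using f by (auto dest: simple_functionD)
  have "(\<integral>x. g (f x) \<partial>M) = (\<integral>x. (\<Sum>v\<in>f ` space M. indicator (f -` {v} \<inter> space M) x * g v) \<partial>M)"
  proof (rule Bochner_Integration.integral_cong[OF refl])
    fix x assume x: "x \<in> space M"
    have "(\<Sum>v\<in>f ` space M. indicator (f -` {v} \<inter> space M) x * g v)
        = (\<Sum>v\<in>f ` space M. if v = f x then g v else 0)"
      using x by (intro sum.cong) (auto simp: indicator_def)
    also have "\<dots> = g (f x)" using x fin by simp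
    finally show "g (f x) = (\<Sum>v\<in>f ` space M. indicator (f -` {v} \<inter> space M) x * g v)" by simp
  qed
  also have "\<dots> = (\<Sum>v\<in>f ` space M. (\<integral>x. indicator (f -` {v} \<inter> space M) x * g v \<partial>M))"
    using sets by (intro Bochner_Integration.integral_sum integrable_mult_left integrable_real_indicator)
      (auto simp: emeasure_eq_measure)
  also have "\<dots> = (\<Sum>v\<in>f ` space M. pr M f v * g v)"
    using sets by (intro sum.cong) (auto simp: pr_def)
  finally show ?thesis .
qed

lemma sum_pr: "simple_function M f \<Longrightarrow> (\<Sum>v\<in>f ` space M. pr M f v) = 1"
  using expectation_simple[of f "\<lambda>_. 1"] prob_space by simp

text \<open>Lets the entropies of several coarser labels be compared termwise over the values of one
  common refinement.\<close>

lemma ent_as_sum: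
  assumes J: "simple_function M J" and f: "simple_function M (\<lambda>x. \<pi> (J x))"
  shows "ent M (\<lambda>x. \<pi> (J x)) = - (\<Sum>j\<in>J ` space M. pr M J j * ln (pr M (\<lambda>x. \<pi> (J x)) (\<pi> j)))"
proof -
  let ?f = "\<lambda>x. \<pi> (J x)"
  have "ent M ?f = - (\<integral>x. ln (pr M ?f (?f x)) \<partial>M)"
    unfolding ent_def by (subst expectation_simple[OF f, of "\<lambda>v. ln (pr M ?f v)"]) simp
  also have "(\<integral>x. ln (pr M ?f (?f x)) \<partial>M) = (\<Sum>j\<in>J ` space M. pr M J j * ln (pr M ?f (\<pi> j)))"
    by (subst expectation_simple[OF J, of "\<lambda>j. ln (pr M ?f (\<pi> j))"]) simp
  finally show ?thesis .
qed

text \<open>Nonnegativity of the conditional mutual information of X and Y given Z, taken to base e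
  so that its logarithm is \<open>ln\<close>.\<close>

lemma ent_submodular:
  assumes X: "simple_function M X" and Y: "simple_function M Y" and Z: "simple_function M Z"
  shows "ent M (\<lambda>x. (X x, Y x, Z x)) + ent M Z \<le> ent M (\<lambda>x. (X x, Z x)) + ent M (\<lambda>x. (Y x, Z x))"
proof -
  interpret information_space M "exp 1"
    by unfold_locales simp
  let ?J = "\<lambda>x. (X x, Y x, Z x)" and ?XZ = "\<lambda>x. (X x, Z x)" and ?YZ = "\<lambda>x. (Y x, Z x)"
  note sf = X Y Z simple_function_Pair[OF X Z] simple_function_Pair[OF Y Z]
    simple_function_Pair[OF X simple_function_Pair[OF Y Z]]
  have sd: "simple_distributed M f (pr M f)" if "simple_function M f" for f :: "'a \<Rightarrow> 'z"
    using that by (intro simple_distributedI) (auto simp: pr_def)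
  have "0 \<le> (\<Sum>j\<in>?J ` space M. pr M ?J j *
      ln (pr M ?J j / (pr M ?XZ (fst j, snd (snd j)) * (pr M ?YZ (snd j) / pr M Z (snd (snd j))))))"
    using conditional_mutual_information_nonneg[OF X Y Z]
    unfolding conditional_mutual_information_eq[OF sd[OF sf(3)] sd[OF sf(5)] sd[OF sf(4)] sd[OF sf(6)]]
    by (simp add: log_ln[symmetric] case_prod_beta)
  also have "\<dots> = (\<Sum>j\<in>?J ` space M. pr M ?J j * ln (pr M ?J j)
      - pr M ?J j * ln (pr M ?XZ (fst j, snd (snd j)))
      - pr M ?J j * ln (pr M ?YZ (snd j)) + pr M ?J j * ln (pr M Z (snd (snd j))))"
  proof (intro sum.cong refl)
    fix j
    show "pr M ?J j * ln (pr M ?J j / (pr M ?XZ (fst j, snd (snd j)) * (pr M ?YZ (snd j) / pr M Z (snd (snd j)))))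
      = pr M ?J j * ln (pr M ?J j) - pr M ?J j * ln (pr M ?XZ (fst j, snd (snd j)))
      - pr M ?J j * ln (pr M ?YZ (snd j)) + pr M ?J j * ln (pr M Z (snd (snd j)))"
    \<comment> \<open>Terms of probability zero vanish on both sides; otherwise the marginals are
      positive as well and the logarithm splits.\<close>
    proof (cases "pr M ?J j = 0")
      case False
      then have pos: "0 < pr M ?J j" using pr_nonneg[of M ?J j] by linarith
      have "0 < pr M ?XZ (fst j, snd (snd j))"
        using pos pr_le_pr_comp[OF sf(6), of "\<lambda>j. (fst j, snd (snd j))" j] sf(4) by simp
      moreover have "0 < pr M ?YZ (snd j)"
        using pos pr_le_pr_comp[OF sf(6), of "\<lambda>j. snd j" j] sf(5) by simp
      moreover have "0 < pr M Z (snd (snd j))"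
        using pos pr_le_pr_comp[OF sf(6), of "\<lambda>j. snd (snd j)" j] sf(3) by simp
      ultimately show ?thesis
        using pos by (simp add: ln_div ln_mult algebra_simps)
    qed simp
  qed
  also have "\<dots> = - ent M ?J + ent M ?XZ + ent M ?YZ - ent M Z"
  proof -
    have "ent M ?J = - (\<Sum>j\<in>?J ` space M. pr M ?J j * ln (pr M ?J j))"
      by (simp add: ent_def)
    moreover have "ent M ?XZ = - (\<Sum>j\<in>?J ` space M. pr M ?J j * ln (pr M ?XZ (fst j, snd (snd j))))"
      using ent_as_sum[OF sf(6), of "\<lambda>j. (fst j, snd (snd j))"] sf(4) by simp
    moreover have "ent M ?YZ = - (\<Sum>j\<in>?J ` space M. pr M ?J j * ln (pr M ?YZ (snd j)))"
      using ent_as_sum[OF sf(6), of "\<lambda>j. snd j"] sf(5) by simp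
    moreover have "ent M Z = - (\<Sum>j\<in>?J ` space M. pr M ?J j * ln (pr M Z (snd (snd j))))"
      using ent_as_sum[OF sf(6), of "\<lambda>j. snd (snd j)"] sf(3) by simp
    ultimately show ?thesis
      by (simp add: sum.distrib sum_subtractf)
  qed
  finally show ?thesis by simp
qed

text \<open>Since g is a function of f on the space, the cell of g around a point contains the cell
  of f, and the logarithm of its probability is larger.\<close>

lemma ent_mono:
  assumes f: "simple_function M f" and g: "simple_function M g"
    and refines: "\<And>x y. x \<in> space M \<Longrightarrow> y \<in> space M \<Longrightarrow> f x = f y \<Longrightarrow> g x = g y"
  shows "ent M g \<le> ent M f"
proof -
  define \<pi> where "\<pi> v = g (SOME x. x \<in> space M \<and> f x = v)" for v
  have eq: "g x = \<pi> (f x)" if "x \<in> space M" for x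
  proof -
    have "\<exists>y. y \<in> space M \<and> f y = f x" using that by blast
    then have "(SOME y. y \<in> space M \<and> f y = f x) \<in> space M \<and> f (SOME y. y \<in> space M \<and> f y = f x) = f x"
      by (rule someI_ex)
    then show ?thesis unfolding \<pi>_def using that by (intro refines) auto
  qed
  have \<pi>: "simple_function M (\<lambda>x. \<pi> (f x))"
    using g eq by (subst simple_function_cong[of M _ g]) auto
  have "ent M g = ent M (\<lambda>x. \<pi> (f x))"
    using eq by (rule ent_cong)
  also have "\<dots> = - (\<Sum>j\<in>f ` space M. pr M f j * ln (pr M (\<lambda>x. \<pi> (f x)) (\<pi> j)))"
    using f \<pi> by (rule ent_as_sum)
  also have "\<dots> \<le> - (\<Sum>j\<in>f ` space M. pr M f j * ln (pr M f j))"
  proof (intro le_imp_neg_le sum_mono)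
    fix j
    show "pr M f j * ln (pr M f j) \<le> pr M f j * ln (pr M (\<lambda>x. \<pi> (f x)) (\<pi> j))"
    proof (cases "pr M f j = 0")
      case False
      then have "0 < pr M f j" using pr_nonneg[of M f j] by linarith
      then show ?thesis
        using pr_le_pr_comp[OF f \<pi>, of j] by (intro mult_left_mono ln_mono) auto
    qed simp
  qed
  finally show ?thesis by (simp add: ent_def)
qed

lemma ent_subadditive:
  assumes "simple_function M f" "simple_function M g"
  shows "ent M (\<lambda>x. (f x, g x)) \<le> ent M f + ent M g"
proof -
  have c: "simple_function M (\<lambda>x. ())" by simp
  have "ent M (\<lambda>x. (f x, g x)) \<le> ent M (\<lambda>x. (f x, g x, ()))"
    using assms by (intro ent_mono simple_function_Pair) auto
  also have "\<dots> \<le> \<dots> + ent M (\<lambda>x. ())"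
    using ent_nonneg by simp
  also have "\<dots> \<le> ent M (\<lambda>x. (f x, ())) + ent M (\<lambda>x. (g x, ()))"
    using ent_submodular[OF assms c] by simp
  also have "\<dots> \<le> ent M f + ent M g"
    using assms by (intro add_mono ent_mono simple_function_Pair) auto
  finally show ?thesis .
qed

end

text \<open>Fekete's lemma: division of n by a fixed m with a nearly minimal quotient bounds
  \<open>a n / n\<close> by that quotient up to a constant over n.\<close>

lemma fekete_convergent:
  fixes a :: "nat \<Rightarrow> real"
  assumes sub: "\<And>m n. a (m + n) \<le> a m + a n" and nonneg: "\<And>n. 0 \<le> a n"
  shows "convergent (\<lambda>n. a n / real n)"
proof -
  define l where "l = (INF n\<in>{1..}. a n / real n)"
  have bdd: "bdd_below ((\<lambda>n. a n / real n) ` {1..})"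
    using nonneg by (intro bdd_belowI[of _ 0]) auto
  \<comment> \<open>Subadditivity yields only \<open>a 0 \<le> 2 * a 0\<close>, so
    \<open>a 0\<close> may be positive and is carried along as an additive constant.\<close>
  have mult: "a (k * m) \<le> real k * a m + a 0" for k m
  proof (induction k)
    case (Suc k)
    then show ?case using sub[of m "k * m"] by (simp add: algebra_simps)
  qed simp
  have "(\<lambda>n. a n / real n) \<longlonglongrightarrow> l"
  proof (rule LIMSEQ_I)
    fix e :: real assume "0 < e"
    have "l < l + e / 2" using \<open>0 < e\<close> by simp
    then obtain m where m: "m \<ge> 1" "a m / real m < l + e / 2"
      unfolding l_def using cInf_lessD[of "(\<lambda>n. a n / real n) ` {1..}"] by fastforce
    define C where "C = a 0 + (\<Sum>r<m. a r)"
    obtain N where N: "2 * C / e < real N" using reals_Archimedean2 by blast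
    show "\<exists>no. \<forall>n\<ge>no. norm (a n / real n - l) < e"
    proof (intro exI[of _ "max 1 N"] allI impI)
      fix n assume n: "max 1 N \<le> n"
      then have "l \<le> a n / real n"
        unfolding l_def using bdd by (intro cINF_lower) auto
      have r: "n mod m < m" using m by simp
      have "a n = a ((n div m) * m + n mod m)" by simp
      also have "\<dots> \<le> a ((n div m) * m) + a (n mod m)" by (rule sub)
      also have "a ((n div m) * m) \<le> real (n div m) * a m + a 0" by (rule mult)
      also have "a (n mod m) \<le> (\<Sum>r<m. a r)"
        using r nonneg by (intro member_le_sum) auto
      also have "real (n div m) * a m \<le> real n * (a m / real m)"
      proof -
        have "real (n div m) \<le> real n / real m" by (rule of_nat_div_le_of_nat)
        then have "real (n div m) * a m \<le> real n / real m * a m"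
          using nonneg by (intro mult_right_mono) auto
        then show ?thesis by simp
      qed
      finally have "a n \<le> real n * (a m / real m) + C" by (simp add: C_def)
      then have "a n / real n \<le> a m / real m + C / real n"
        using n by (simp add: field_simps)
      moreover have "C / real n < e / 2"
      proof -
        have "2 * C / e < real n" using N n by linarith
        moreover have "0 < real n" using n by simp
        ultimately show ?thesis using \<open>0 < e\<close> by (simp add: field_simps)
      qed
      moreover have "a m / real m < l + e / 2" by (rule m)
      ultimately show "norm (a n / real n - l) < e"
        using \<open>l \<le> a n / real n\<close> unfolding real_norm_def by linarith
    qed
  qed
  then show ?thesis by (rule convergentI)
qed

section \<open>Itineraries of a measure-preserving map\<close>

definition itin :: "('a \<Rightarrow> 'a) \<Rightarrow> ('a \<Rightarrow> 'b) \<Rightarrow> nat \<Rightarrow> 'a \<Rightarrow> 'b list" where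
  "itin T f n x = map (\<lambda>i. f ((T ^^ i) x)) [0..<n]"

lemma itin_eq_iff: "itin T f n x = itin T f n y \<longleftrightarrow> (\<forall>i<n. f ((T ^^ i) x) = f ((T ^^ i) y))"
  by (auto simp: itin_def)

lemma itin_Suc: "itin T f (Suc n) x = itin T f n x @ [f ((T ^^ n) x)]"
  by (simp add: itin_def)

definition label :: "'a set set \<Rightarrow> 'a \<Rightarrow> 'a set" where
  "label P x = (THE A. A \<in> P \<and> x \<in> A)"

locale pmp = prob_space M for M :: "'a measure" +
  fixes T :: "'a \<Rightarrow> 'a"
  assumes T_measurable: "T \<in> measurable M M" and T_distr: "distr M M T = M"
begin

lemma T_space: "x \<in> space M \<Longrightarrow> (T ^^ n) x \<in> space M"
  by (induction n) (auto dest: measurable_space[OF T_measurable])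

lemma T_funpow_measurable: "T ^^ n \<in> measurable M M"
proof (induction n)
  case (Suc n)
  then show ?case unfolding funpow.simps by (rule measurable_comp[OF _ T_measurable])
qed simp

lemma simple_function_T:
  assumes f: "simple_function M f"
  shows "simple_function M (\<lambda>x. f ((T ^^ n) x))"
proof -
  have "(\<lambda>x. f ((T ^^ n) x)) ` space M \<subseteq> f ` space M" using T_space by auto
  moreover have "(\<lambda>x. f ((T ^^ n) x)) -` {v} \<inter> space M \<in> sets M" for v
  proof -
    have "(\<lambda>x. f ((T ^^ n) x)) -` {v} \<inter> space M = (T ^^ n) -` (f -` {v} \<inter> space M) \<inter> space M"
      using T_space by auto
    then show ?thesis
      using measurable_sets[OF T_funpow_measurable simple_functionD(2)[OF f]] by simp
  qed
  ultimately show ?thesis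
    using f finite_subset by (auto simp: simple_function_def)
qed

lemma prob_T:
  assumes "A \<in> sets M"
  shows "prob ((T ^^ n) -` A \<inter> space M) = prob A"
proof (induction n)
  case (Suc n)
  have sets: "(T ^^ n) -` A \<inter> space M \<in> sets M"
    using measurable_sets[OF T_funpow_measurable assms] .
  have "(T ^^ Suc n) -` A \<inter> space M = T -` ((T ^^ n) -` A \<inter> space M) \<inter> space M"
    unfolding funpow_Suc_right using measurable_space[OF T_measurable] by auto
  then have "prob ((T ^^ Suc n) -` A \<inter> space M) = measure (distr M M T) ((T ^^ n) -` A \<inter> space M)"
    using sets T_measurable by (simp add: measure_distr)
  then show ?case unfolding T_distr using Suc by (simp only:)
qed (use assms sets.sets_into_space in \<open>auto simp: Int_absorb2\<close>)

lemma ent_T: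
  assumes f: "simple_function M f"
  shows "ent M (\<lambda>x. f ((T ^^ n) x)) = ent M f"
proof -
  have "pr M (\<lambda>x. f ((T ^^ n) x)) v = pr M f v" for v
  proof -
    have "(\<lambda>x. f ((T ^^ n) x)) -` {v} \<inter> space M = (T ^^ n) -` (f -` {v} \<inter> space M) \<inter> space M"
      using T_space by auto
    then show ?thesis
      unfolding pr_def using prob_T[OF simple_functionD(2)[OF f]] by simp
  qed
  moreover have "ent M (\<lambda>x. f ((T ^^ n) x)) = - (\<Sum>v\<in>f ` space M. pr M (\<lambda>x. f ((T ^^ n) x)) v * ln (pr M (\<lambda>x. f ((T ^^ n) x)) v))"
    using T_space f by (intro ent_superset) (auto dest: simple_functionD)
  ultimately show ?thesis by (simp add: ent_def)
qed

lemma simple_function_itin: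
  assumes f: "simple_function M f"
  shows "simple_function M (itin T f n)"
proof (induction n)
  case 0
  have "itin T f 0 = (\<lambda>_. [])" by (simp add: itin_def fun_eq_iff)
  then show ?case by simp
next
  case (Suc n)
  from simple_function_compose1[OF simple_function_Pair[OF Suc simple_function_T[OF f, of n]], of "\<lambda>(v, w). v @ [w]"]
  show ?case unfolding itin_Suc[abs_def] by simp
qed

lemma ent_itin_subadditive:
  assumes f: "simple_function M f"
  shows "ent M (itin T f (m + n)) \<le> ent M (itin T f m) + ent M (itin T f n)"
proof -
  note sf = simple_function_itin[OF f]
  have "ent M (itin T f (m + n)) \<le> ent M (\<lambda>x. (itin T f m x, itin T f n ((T ^^ m) x)))"
  proof (rule ent_mono)
    fix x y assume "(itin T f m x, itin T f n ((T ^^ m) x)) = (itin T f m y, itin T f n ((T ^^ m) y))"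
    then have 1: "\<And>i. i < m \<Longrightarrow> f ((T ^^ i) x) = f ((T ^^ i) y)"
      and 2: "\<And>i. i < n \<Longrightarrow> f ((T ^^ (i + m)) x) = f ((T ^^ (i + m)) y)"
      by (auto simp: itin_eq_iff funpow_add)
    show "itin T f (m + n) x = itin T f (m + n) y"
      unfolding itin_eq_iff
    proof (intro allI impI)
      fix i assume "i < m + n"
      then show "f ((T ^^ i) x) = f ((T ^^ i) y)"
        using 1[of i] 2[of "i - m"] by (cases "i < m") auto
    qed
  qed (intro sf simple_function_Pair simple_function_T)+
  also have "\<dots> \<le> ent M (itin T f m) + ent M (\<lambda>x. itin T f n ((T ^^ m) x))"
    by (intro ent_subadditive sf simple_function_T)
  also have "ent M (\<lambda>x. itin T f n ((T ^^ m) x)) = ent M (itin T f n)"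
    by (intro ent_T sf)
  finally show ?thesis .
qed

lemma label_eq_iff:
  assumes P: "finite_measurable_partition M P" and "x \<in> space M" "A \<in> P"
  shows "label P x = A \<longleftrightarrow> x \<in> A"
proof -
  have part: "partition_on (space M) P"
    using P by (simp add: finite_measurable_partition_def)
  note disj = partition_onD2[OF part] and cover = partition_onD1[OF part]
  have unique: "B = C" if "B \<in> P" "C \<in> P" "x \<in> B" "x \<in> C" for B C
    using disjointD[OF disj that(1,2)] that(3,4) by auto
  have eq: "label P x = B" if "B \<in> P" "x \<in> B" for B
    unfolding label_def using that unique by (intro the_equality) blast+
  obtain B where "B \<in> P" "x \<in> B" using cover assms(2) by auto
  then show ?thesis using eq assms(3) by blast
qed

lemma label_in:
  assumes P: "finite_measurable_partition M P" and "x \<in> space M"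
  shows "label P x \<in> P"
proof -
  have "partition_on (space M) P"
    using P by (simp add: finite_measurable_partition_def)
  from partition_onD1[OF this] obtain A where "A \<in> P" "x \<in> A" using assms(2) by auto
  then show ?thesis using label_eq_iff[OF assms] by blast
qed

lemma simple_function_label:
  assumes P: "finite_measurable_partition M P"
  shows "simple_function M (label P)"
proof -
  have "label P ` space M \<subseteq> P" using label_in[OF P] by auto
  moreover have "label P -` {A} \<inter> space M \<in> sets M" if "A \<in> P" for A
  proof -
    have "A \<subseteq> space M" "A \<in> sets M"
      using P that by (auto simp: finite_measurable_partition_def dest: sets.sets_into_space)
    then have "label P -` {A} \<inter> space M = A" using label_eq_iff[OF P _ that] by auto
    then show ?thesis using \<open>A \<in> sets M\<close> by simp
  qed
  moreover have "finite P" using P by (simp add: finite_measurable_partition_def)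
  ultimately show ?thesis
    unfolding simple_function_def by (auto intro: finite_subset)
qed

text \<open>The nonempty cells of the join correspond bijectively to the itineraries that occur; a
  possible empty cell drops out because \<open>0 * ln 0 = 0\<close>.\<close>

lemma partition_entropy_iterated_join:
  assumes P: "finite_measurable_partition M P"
  shows "partition_entropy M (iterated_join M T P n) = ent M (itin T (label P) n)"
proof -
  let ?f = "itin T (label P) n"
  let ?J = "iterated_join M T P n"
  define B where "B v = ?f -` {v} \<inter> space M" for v
  have cell: "(\<Inter>i\<in>{..<n}. (T ^^ i) -` c i) \<inter> space M = B (?f x)"
    if "x \<in> space M" "\<forall>i<n. c i \<in> P" "\<forall>i<n. (T ^^ i) x \<in> c i" for c x
  proof (intro set_eqI)
    fix y
    have lx: "label P ((T ^^ i) x) = c i" if "i < n" for i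
      using label_eq_iff[OF P T_space[OF \<open>x \<in> space M\<close>]] that \<open>\<forall>i<n. c i \<in> P\<close> \<open>\<forall>i<n. (T ^^ i) x \<in> c i\<close> by blast
    have ly: "label P ((T ^^ i) y) = c i \<longleftrightarrow> (T ^^ i) y \<in> c i" if "i < n" "y \<in> space M" for i
      using label_eq_iff[OF P T_space[OF \<open>y \<in> space M\<close>]] that \<open>\<forall>i<n. c i \<in> P\<close> by blast
    show "y \<in> (\<Inter>i\<in>{..<n}. (T ^^ i) -` c i) \<inter> space M \<longleftrightarrow> y \<in> B (?f x)"
      using lx ly by (auto simp: B_def itin_eq_iff)
  qed
  have image: "?J - {{}} = B ` ?f ` space M"
  proof (intro set_eqI iffI)
    fix A assume "A \<in> ?J - {{}}"
    then obtain c where c: "\<forall>i<n. c i \<in> P" "A = (\<Inter>i\<in>{..<n}. (T ^^ i) -` c i) \<inter> space M" "A \<noteq> {}"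
      by (auto simp: iterated_join_def)
    then obtain x where "x \<in> A" by blast
    then have "x \<in> space M" "\<forall>i<n. (T ^^ i) x \<in> c i" using c(2) by auto
    then have "A = B (?f x)" using cell c by auto
    then show "A \<in> B ` ?f ` space M" using \<open>x \<in> space M\<close> by blast
  next
    fix A assume "A \<in> B ` ?f ` space M"
    then obtain x where x: "x \<in> space M" "A = B (?f x)" by blast
    have c: "\<forall>i<n. label P ((T ^^ i) x) \<in> P" "\<forall>i<n. (T ^^ i) x \<in> label P ((T ^^ i) x)"
      using label_in[OF P T_space[OF x(1)]] label_eq_iff[OF P T_space[OF x(1)]] by blast+
    then have A: "A = (\<Inter>i\<in>{..<n}. (T ^^ i) -` label P ((T ^^ i) x)) \<inter> space M"
      using cell[OF x(1), of "\<lambda>i. label P ((T ^^ i) x)"] x(2) by simp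
    have "A \<in> ?J"
      unfolding iterated_join_def mem_Collect_eq
      by (intro exI[of _ "\<lambda>i. label P ((T ^^ i) x)"] conjI A c(1))
    moreover have "x \<in> A" using x by (simp add: B_def)
    ultimately show "A \<in> ?J - {{}}" by auto
  qed
  have fin: "finite (?f ` space M)"
    using simple_function_itin[OF simple_function_label[OF P]] by (rule simple_functionD)
  have "finite (?J - {{}})" unfolding image using fin by simp
  then have "finite ?J" by simp
  then have "(\<Sum>A\<in>?J. measure M A * ln (measure M A)) = (\<Sum>A\<in>?J - {{}}. measure M A * ln (measure M A))"
    by (intro sum.mono_neutral_right) auto
  also have "\<dots> = (\<Sum>v\<in>?f ` space M. measure M (B v) * ln (measure M (B v)))"
    unfolding image
  proof (subst sum.reindex)
    show "inj_on B (?f ` space M)"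
      by (rule inj_onI) (auto simp: B_def)
  qed simp
  finally show ?thesis
    by (simp add: partition_entropy_def ent_def pr_def B_def)
qed

text \<open>The definition uses \<open>lim\<close>, which carries information only for a convergent
  sequence; subadditivity along itineraries supplies the convergence.\<close>

lemma entropy_wrt_partition_LIMSEQ:
  assumes P: "finite_measurable_partition M P"
  shows "(\<lambda>n. ent M (itin T (label P) n) / real n) \<longlonglongrightarrow> entropy_wrt_partition M T P"
  unfolding entropy_wrt_partition_def partition_entropy_iterated_join[OF P] convergent_LIMSEQ_iff[symmetric]
  by (intro fekete_convergent ent_itin_subadditive simple_function_label P ent_nonneg)

end

lemma tendsto_mult_ln:
  fixes p :: "'a \<Rightarrow> real"
  assumes "(p \<longlongrightarrow> l) G" "\<And>x. 0 \<le> p x" "0 \<le> l"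
  shows "((\<lambda>x. p x * ln (p x)) \<longlongrightarrow> l * ln l) G"
proof (cases "l = 0")
  case False
  with assms show ?thesis by (intro tendsto_intros) auto
next
  case True
  \<comment> \<open>Continuity of y ln y at 0. The estimate
    \<open>ln (1 / sqrt y) \<le> 1 / sqrt y\<close> bounds the negative part by
    \<open>2 * sqrt y\<close>, and \<open>ln y \<le> y\<close> bounds the positive part.\<close>
  have bound: "norm (y * ln y) \<le> 2 * sqrt y + y * y" if "0 \<le> y" for y :: real
  proof (cases "y = 0")
    case False
    then have y: "0 < y" using that by simp
    have "ln (1 / sqrt y) \<le> 1 / sqrt y" using y by (intro ln_bound) simp
    then have "- ln y \<le> 2 * (1 / sqrt y)"
      using y by (simp add: ln_div ln_sqrt)
    then have "y * - ln y \<le> y * (2 * (1 / sqrt y))"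
      using y by (intro mult_left_mono) auto
    also have "\<dots> = 2 * (y / sqrt y)" by simp
    also have "\<dots> = 2 * sqrt y" using y real_div_sqrt[of y] by simp
    finally have 1: "- (y * ln y) \<le> 2 * sqrt y" by simp
    have "y * ln y \<le> y * y" using y ln_bound[of y] by (intro mult_left_mono) auto
    moreover have "0 \<le> sqrt y" "0 \<le> y * y" using y by auto
    ultimately show ?thesis using 1 unfolding real_norm_def by linarith
  qed simp
  have "((\<lambda>x. 2 * sqrt (p x) + p x * p x) \<longlongrightarrow> 2 * sqrt 0 + 0 * 0) G"
    using assms(1) True by (intro tendsto_intros) auto
  then have "((\<lambda>x. p x * ln (p x)) \<longlongrightarrow> 0) G"
    by (intro Lim_null_comparison[OF always_eventually[OF allI[OF bound[OF assms(2)]]]]) simp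
  then show ?thesis using True by simp
qed

lemma (in prob_space) pr_diff_le:
  assumes "simple_function M f" "simple_function M g"
  shows "\<bar>pr M f v - pr M g v\<bar> \<le> prob {x \<in> space M. f x \<noteq> g x}"
proof -
  have sets: "f -` {v} \<inter> space M \<in> sets M" "g -` {v} \<inter> space M \<in> sets M"
    using assms by (auto dest: simple_functionD)
  have "simple_function M (\<lambda>x. (f x, g x))" using assms by (rule simple_function_Pair)
  from simple_functionD(2)[OF this, of "{p. fst p \<noteq> snd p}"]
  have ne: "{x \<in> space M. f x \<noteq> g x} \<in> sets M"
    by (simp add: vimage_def Int_def conj_commute)
  have "pr M f v \<le> prob ((g -` {v} \<inter> space M) \<union> {x \<in> space M. f x \<noteq> g x})"
    unfolding pr_def using sets ne by (intro finite_measure_mono) auto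
  also have "\<dots> \<le> pr M g v + prob {x \<in> space M. f x \<noteq> g x}"
    unfolding pr_def using sets ne by (intro measure_Un_le)
  finally have 1: "pr M f v \<le> pr M g v + prob {x \<in> space M. f x \<noteq> g x}" .
  have "pr M g v \<le> prob ((f -` {v} \<inter> space M) \<union> {x \<in> space M. f x \<noteq> g x})"
    unfolding pr_def using sets ne by (intro finite_measure_mono) auto
  also have "\<dots> \<le> pr M f v + prob {x \<in> space M. f x \<noteq> g x}"
    unfolding pr_def using sets ne by (intro measure_Un_le)
  finally show ?thesis using 1 by linarith
qed

section \<open>Invariant measures on the beta-shift and their words\<close>

context beta_expansion
begin

lemma pressure_sum_pos: "0 < pressure_sum N t"
proof -
  have "0 < (1 + exp t) ^ (\<Sum>i<N. q i)" using add_pos_pos[OF zero_less_one exp_gt_zero] by (rule zero_less_power)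
  then show ?thesis using power_le_pressure_sum[where N = N and t = t] by linarith
qed

lemma one_cylinder_sets: "one_cylinder \<beta> \<in> sets shift_borel"
proof -
  have "one_cylinder \<beta> = cyl 1 (\<lambda>_. 1)"
    by (auto simp: one_cylinder_def cyl_def)
  then show ?thesis by (simp add: cyl_sets)
qed

end

locale shift_measure = beta_expansion +
  fixes m :: "(nat \<Rightarrow> nat) measure"
  assumes m_invariant: "m \<in> invariant_measures (beta_shift \<beta>) shift"

sublocale shift_measure \<subseteq> pmp m shift
  using m_invariant by (simp add: invariant_measures_def pmp_def pmp_axioms_def)

context shift_measure
begin

lemma sets_m [simp]: "sets m = sets shift_borel"
  using m_invariant by (simp add: invariant_measures_def)

lemma space_m [simp]: "space m = X"
  using sets_eq_imp_space_eq[OF sets_m] by simp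

lemma trunc_vimage: "trunc n -` {trunc n x} \<inter> X = cyl n x"
  by (auto simp: cyl_def trunc_eq_iff)

lemma simple_function_trunc: "simple_function m (trunc n)"
proof -
  have "trunc n ` X \<subseteq> words n" using trunc_in_words by auto
  moreover have "trunc n -` {v} \<inter> X \<in> sets shift_borel" for v
  proof (cases "v \<in> trunc n ` X")
    case True
    then show ?thesis by (auto simp: trunc_vimage cyl_sets)
  next
    case False
    then have "trunc n -` {v} \<inter> X = {}" by auto
    then show ?thesis by (simp only: sets.empty_sets)
  qed
  ultimately show ?thesis
    unfolding simple_function_def by (auto intro: finite_subset[OF _ finite_words])
qed

lemma simple_function_determined:
  assumes "\<And>x y. x \<in> X \<Longrightarrow> y \<in> X \<Longrightarrow> trunc k x = trunc k y \<Longrightarrow> g x = g y"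
  shows "simple_function m g"
proof -
  define \<pi> where "\<pi> v = g (SOME x. x \<in> X \<and> trunc k x = v)" for v
  have "g x = \<pi> (trunc k x)" if "x \<in> X" for x
  proof -
    have "\<exists>y. y \<in> X \<and> trunc k y = trunc k x" using that by blast
    then have "(SOME y. y \<in> X \<and> trunc k y = trunc k x) \<in> X
        \<and> trunc k (SOME y. y \<in> X \<and> trunc k y = trunc k x) = trunc k x"
      by (rule someI_ex)
    then show ?thesis unfolding \<pi>_def using that by (intro assms) auto
  qed
  then show ?thesis
    using simple_function_compose1[OF simple_function_trunc, of \<pi> k]
    by (subst simple_function_cong[of m _ "\<lambda>x. \<pi> (trunc k x)"]) auto
qed

definition freq :: real where
  "freq = (\<integral>x. indicator (one_cylinder \<beta>) x \<partial>m)"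

text \<open>By invariance, every coordinate equals 1 with the same probability.\<close>

lemma expectation_ones:
  "(\<integral>x. (\<Sum>i<n. real (trunc n x i)) \<partial>m) = real n * freq"
proof -
  define A where "A i = (shift ^^ i) -` one_cylinder \<beta> \<inter> space m" for i
  have A: "A i \<in> sets m" for i
    unfolding A_def using measurable_sets[OF T_funpow_measurable] one_cylinder_sets by simp
  have "(\<integral>x. (\<Sum>i<n. real (trunc n x i)) \<partial>m) = (\<integral>x. (\<Sum>i<n. indicator (A i) x) \<partial>m)"
  proof (intro Bochner_Integration.integral_cong refl sum.cong)
    fix x i assume "x \<in> space m" "i \<in> {..<n}"
    then show "real (trunc n x i) = indicator (A i) x"
      using beta_shift_digit[of x i] shift_in_beta_shift[of x i]
      by (auto simp: A_def indicator_def one_cylinder_def trunc_def)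
  qed
  also have "\<dots> = (\<Sum>i<n. (\<integral>x. indicator (A i) x \<partial>m))"
    using A by (intro Bochner_Integration.integral_sum integrable_real_indicator) (auto simp: emeasure_eq_measure)
  also have "\<dots> = (\<Sum>i<n. prob (A i))"
    by (intro sum.cong) (auto simp: A_def Int_absorb2)
  also have "\<dots> = real n * freq"
    unfolding A_def freq_def using one_cylinder_sets prob_T[of "one_cylinder \<beta>"]
    by (simp add: one_cylinder_def inf_absorb1)
  finally show ?thesis .
qed

lemma sum_pr_ones:
  "(\<Sum>v\<in>trunc n ` X. pr m (trunc n) v * (\<Sum>i<n. real (v i))) = real n * freq"
  using expectation_simple[OF simple_function_trunc, of "\<lambda>v. \<Sum>i<n. real (v i)" n]
  by (simp add: expectation_ones)

text \<open>Gibbs' inequality against the weights \<open>H n s v / pressure_sum n s\<close>.\<close>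

lemma ent_trunc_le: "ent m (trunc n) + s * (real n * freq) \<le> ln (pressure_sum n s)"
proof -
  let ?V = "trunc n ` X" and ?p = "pr m (trunc n)"
  have V: "?V \<subseteq> words n" using trunc_in_words by auto
  have Z: "0 < pressure_sum n s" by (rule pressure_sum_pos)
  have "- (?p v * ln (?p v)) + ?p v * (s * (\<Sum>i<n. real (v i))) - ?p v * ln (pressure_sum n s)
      \<le> H n s v / pressure_sum n s - ?p v" for v
  proof (cases "?p v = 0")
    case True
    then show ?thesis using Z by simp
  next
    case False
    then have p: "0 < ?p v" using pr_nonneg[of m "trunc n" v] by linarith
    \<comment> \<open>The inequality ln y \<le> y - 1 at the likelihood ratio of the two
      distributions.\<close>
    have "ln (H n s v / (?p v * pressure_sum n s)) \<le> H n s v / (?p v * pressure_sum n s) - 1"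
      using p Z by (intro ln_le_minus_one) simp
    then have "?p v * ln (H n s v / (?p v * pressure_sum n s))
        \<le> ?p v * (H n s v / (?p v * pressure_sum n s) - 1)"
      using p by (intro mult_left_mono) auto
    moreover have "ln (H n s v) = s * (\<Sum>i<n. real (v i))" by (simp add: H_def)
    then have "ln (H n s v / (?p v * pressure_sum n s))
        = s * (\<Sum>i<n. real (v i)) - ln (?p v) - ln (pressure_sum n s)"
      using p Z by (simp add: ln_div ln_mult)
    then have "?p v * ln (H n s v / (?p v * pressure_sum n s))
        = ?p v * (s * (\<Sum>i<n. real (v i))) - ?p v * ln (?p v) - ?p v * ln (pressure_sum n s)"
      by (simp only: right_diff_distrib)
    moreover have "?p v * (H n s v / (?p v * pressure_sum n s) - 1) = H n s v / pressure_sum n s - ?p v"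
      using p Z by (simp add: field_simps)
    ultimately show ?thesis by linarith
  qed
  then have "(\<Sum>v\<in>?V. - (?p v * ln (?p v)) + ?p v * (s * (\<Sum>i<n. real (v i))) - ?p v * ln (pressure_sum n s))
      \<le> (\<Sum>v\<in>?V. H n s v / pressure_sum n s - ?p v)"
    by (rule sum_mono)
  moreover have "(\<Sum>v\<in>?V. - (?p v * ln (?p v)) + ?p v * (s * (\<Sum>i<n. real (v i))) - ?p v * ln (pressure_sum n s))
      = ent m (trunc n) + s * (real n * freq) - ln (pressure_sum n s)"
  proof -
    have "(\<Sum>v\<in>?V. ?p v * (s * (\<Sum>i<n. real (v i)))) = s * (real n * freq)"
      unfolding sum_pr_ones[symmetric] sum_distrib_left by (simp add: ac_simps sum_distrib_left)
    moreover have "(\<Sum>v\<in>?V. ?p v * ln (pressure_sum n s)) = ln (pressure_sum n s)"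
      unfolding sum_distrib_right[symmetric] using sum_pr[OF simple_function_trunc] by simp
    ultimately show ?thesis
      by (simp only: sum.distrib sum_subtractf sum_negf ent_def space_m)
  qed
  moreover have "(\<Sum>v\<in>?V. H n s v / pressure_sum n s - ?p v) \<le> 0"
  proof -
    have "(\<Sum>v\<in>?V. H n s v) \<le> pressure_sum n s"
      unfolding pressure_sum_def using V by (intro sum_mono2) auto
    then have "(\<Sum>v\<in>?V. H n s v) / pressure_sum n s \<le> 1" using Z by simp
    then show ?thesis
      using sum_pr[OF simple_function_trunc, of n] by (simp add: sum_subtractf sum_divide_distrib)
  qed
  ultimately show ?thesis by linarith
qed

text \<open>Finite unions of cylinders of length k, described by independence of the later
  coordinates.\<close>

definition determined :: "nat \<Rightarrow> (nat \<Rightarrow> nat) set \<Rightarrow> bool" where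
  "determined k B \<longleftrightarrow> B \<in> sets m \<and> (\<forall>x\<in>X. \<forall>y\<in>X. trunc k x = trunc k y \<longrightarrow> x \<in> B \<longrightarrow> y \<in> B)"

lemma determinedI:
  "B \<in> sets m \<Longrightarrow> (\<And>x y. x \<in> X \<Longrightarrow> y \<in> X \<Longrightarrow> trunc k x = trunc k y \<Longrightarrow> x \<in> B \<Longrightarrow> y \<in> B) \<Longrightarrow> determined k B"
  unfolding determined_def by blast

lemma determined_sets: "determined k B \<Longrightarrow> B \<in> sets m"
  unfolding determined_def by blast

lemma determinedD: "determined k B \<Longrightarrow> x \<in> X \<Longrightarrow> y \<in> X \<Longrightarrow> trunc k x = trunc k y \<Longrightarrow> x \<in> B \<Longrightarrow> y \<in> B"
  unfolding determined_def by blast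

lemma determined_mono:
  assumes "determined k B" "k \<le> l"
  shows "determined l B"
proof (rule determinedI)
  fix x y assume xy: "x \<in> X" "y \<in> X" "trunc l x = trunc l y" "x \<in> B"
  have "trunc k x = trunc k y" using xy(3) assms(2) by (simp add: trunc_eq_iff)
  then show "y \<in> B" using xy by (intro determinedD[OF assms(1) xy(1,2)])
qed (rule determined_sets[OF assms(1)])

text \<open>The sets that can be approximated to every precision form a sigma-algebra containing the
  coordinate cylinders. The induction follows the generation of the product sigma-algebra, with all
  sets intersected with \<open>X\<close>.\<close>

lemma approx_by_cylinders:
  assumes "A \<in> sets m" "0 < e"
  obtains k B where "determined k B" "prob (sym_diff A B) < e"
proof -
  have "\<forall>e>0. \<exists>k B. determined k B \<and> prob (sym_diff (X \<inter> A) B) < e"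
    if "A \<in> sigma_sets (\<Pi>\<^sub>E i\<in>UNIV. space (borel :: nat measure))
      {{f \<in> \<Pi>\<^sub>E i\<in>UNIV. space borel. f i \<in> V} | i V. i \<in> UNIV \<and> V \<in> sets borel}" for A :: "(nat \<Rightarrow> nat) set"
    using that
  proof (induction A rule: sigma_sets.induct)
    case (Basic A)
    then obtain i V where A: "A = {f. f i \<in> V}" by auto
    show ?case
    proof (intro allI impI exI conjI)
      fix e :: real assume "0 < e"
      have "simple_function m (\<lambda>x. x i \<in> V)"
        by (rule simple_function_determined[of "Suc i"]) (auto simp: trunc_eq_iff)
      from simple_functionD(2)[OF this, of "{True}"]
      have "X \<inter> A \<in> sets m" by (simp add: A vimage_def Int_def conj_commute)
      then show "determined (Suc i) (X \<inter> A)" by (intro determinedI) (auto simp: A trunc_eq_iff)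
      show "prob (sym_diff (X \<inter> A) (X \<inter> A)) < e" using \<open>0 < e\<close> by simp
    qed
  next
    case Empty
    have "determined 0 {}" by (rule determinedI) auto
    then show ?case by (intro allI impI exI[of _ 0] exI[of _ "{}"]) simp
  next
    case (Compl A)
    show ?case
    proof (intro allI impI)
      fix e :: real assume "0 < e"
      then obtain k B where B: "determined k B" "prob (sym_diff (X \<inter> A) B) < e" using Compl.IH by blast
      have "B \<subseteq> X" using sets.sets_into_space[OF determined_sets[OF B(1)]] by simp
      then have "sym_diff (X \<inter> (Pi\<^sub>E UNIV (\<lambda>i. space borel) - A)) (X - B) = sym_diff (X \<inter> A) B"
        by auto
      moreover have "determined k (X - B)"
      proof (rule determinedI)
        show "X - B \<in> sets m" using sets.compl_sets[OF determined_sets[OF B(1)]] by simp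
        fix x y assume xy: "x \<in> X" "y \<in> X" "trunc k x = trunc k y" "x \<in> X - B"
        then show "y \<in> X - B" using determinedD[OF B(1) xy(2,1) xy(3)[symmetric]] by blast
      qed
      ultimately show "\<exists>k B. determined k B \<and> prob (sym_diff (X \<inter> (Pi\<^sub>E UNIV (\<lambda>i. space borel) - A)) B) < e"
        using B(2) by (intro exI[of _ k] exI[of _ "X - B"]) simp
    qed
  next
    case (Union A)
    show ?case
    proof (intro allI impI)
      fix e :: real assume e: "0 < e"
      have meas: "X \<inter> A i \<in> sets m" for i
      proof -
        have "A i \<in> sets (Pi\<^sub>M UNIV (\<lambda>_. borel))"
          using Union.hyps[of i] unfolding sets_PiM_single by simp
        then have "A i \<in> sets borel" by (simp only: sets_PiM_equal_borel)
        then show ?thesis by (auto simp: sets_restrict_space)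
      qed
      let ?U = "\<lambda>n. \<Union>i<n. X \<inter> A i"
      have U: "?U n \<in> sets m" for n
        by (rule sets.finite_UN) (rule finite_lessThan, rule meas)
      have "(\<lambda>n. prob (?U n)) \<longlonglongrightarrow> prob (\<Union>n. ?U n)"
      proof (rule finite_Lim_measure_incseq)
        show "range ?U \<subseteq> sets m" using U by blast
        show "incseq ?U" by (intro monoI UN_mono) auto
      qed
      moreover have "(\<Union>n. ?U n) = X \<inter> \<Union>(range A)" by auto
      ultimately have "\<forall>\<^sub>F n in sequentially. prob (X \<inter> \<Union>(range A)) - e / 2 < prob (?U n)"
        using e by (intro order_tendstoD(1)) auto
      then obtain n where n: "prob (X \<inter> \<Union>(range A)) - e / 2 < prob (?U n)"
        using eventually_sequentially by auto
      \<comment> \<open>Half of e pays for cutting the union off after n sets, the other half is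
        shared by the n approximations; the summand 1 covers n = 0.\<close>
      define d where "d = e / (2 * (real n + 1))"
      have "0 < d" using e by (simp add: d_def)
      then have "\<exists>k B. determined k B \<and> prob (sym_diff (X \<inter> A i) B) < d" for i
        using Union.IH[of i] by blast
      then have "\<exists>p. determined (fst p) (snd p) \<and> prob (sym_diff (X \<inter> A i) (snd p)) < d" for i
        by (metis fst_conv snd_conv)
      then obtain p where p: "\<And>i. determined (fst (p i)) (snd (p i))" "\<And>i. prob (sym_diff (X \<inter> A i) (snd (p i))) < d"
        by metis
      define K where "K = Max (insert 0 ((\<lambda>i. fst (p i)) ` {..<n}))"
      let ?B = "\<Union>i<n. snd (p i)"
      have detK: "determined K (snd (p i))" if "i < n" for i
        by (rule determined_mono[OF p(1)]) (use that in \<open>auto simp: K_def intro!: Max_ge\<close>)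
      have detB: "determined K ?B"
      proof (rule determinedI)
        show "?B \<in> sets m" by (intro sets.finite_UN finite_lessThan determined_sets[OF p(1)])
        fix x y assume xy: "x \<in> X" "y \<in> X" "trunc K x = trunc K y" "x \<in> ?B"
        then obtain i where i: "i < n" "x \<in> snd (p i)" by blast
        then show "y \<in> ?B" using determinedD[OF detK[OF i(1)] xy(1-3) i(2)] by blast
      qed
      have sd: "sym_diff (X \<inter> A i) (snd (p i)) \<in> sets m" for i
        using meas[of i] determined_sets[OF p(1)[of i]] by (intro sets.Un sets.Diff)
      have all: "X \<inter> \<Union>(range A) \<in> sets m"
      proof -
        have "X \<inter> \<Union>(range A) = (\<Union>i. X \<inter> A i)" by auto
        moreover have "(\<Union>i. X \<inter> A i) \<in> sets m" by (rule sets.countable_UN) (use meas in blast)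
        ultimately show ?thesis by (simp only:)
      qed
      have "prob (sym_diff (X \<inter> \<Union>(range A)) ?B)
          \<le> prob ((X \<inter> \<Union>(range A) - ?U n) \<union> (\<Union>i<n. sym_diff (X \<inter> A i) (snd (p i))))"
      proof (rule finite_measure_mono)
        show "(X \<inter> \<Union>(range A) - ?U n) \<union> (\<Union>i<n. sym_diff (X \<inter> A i) (snd (p i))) \<in> sets m"
          by (intro sets.Un sets.Diff sets.finite_UN U all finite_lessThan)
             (use meas determined_sets[OF p(1)] in auto)
      qed auto
      also have "\<dots> \<le> prob (X \<inter> \<Union>(range A) - ?U n) + prob (\<Union>i<n. sym_diff (X \<inter> A i) (snd (p i)))"
        by (intro measure_Un_le sets.Diff U all sets.finite_UN finite_lessThan sd)
      also have "prob (X \<inter> \<Union>(range A) - ?U n) = prob (X \<inter> \<Union>(range A)) - prob (?U n)"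
        by (intro finite_measure_Diff U all) auto
      also have "prob (\<Union>i<n. sym_diff (X \<inter> A i) (snd (p i))) \<le> (\<Sum>i<n. prob (sym_diff (X \<inter> A i) (snd (p i))))"
        by (intro measure_UNION_le finite_lessThan sd)
      also have "\<dots> \<le> (\<Sum>i<n. d)" using p(2) by (intro sum_mono less_imp_le)
      also have "\<dots> = real n * d" by simp
      also have "real n * d \<le> e / 2" using e by (simp add: d_def field_simps)
      finally have "prob (sym_diff (X \<inter> \<Union>(range A)) ?B) < e" using n by linarith
      then show "\<exists>k B. determined k B \<and> prob (sym_diff (X \<inter> \<Union>(range A)) B) < e"
        using detB by blast
    qed
  qed
  moreover obtain A' where A': "A = X \<inter> A'" "A' \<in> sets borel"
    using assms(1) by (auto simp: sets_restrict_space)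
  have "A' \<in> sets (Pi\<^sub>M UNIV (\<lambda>_. borel))" using A'(2) by (simp only: sets_PiM_equal_borel)
  ultimately obtain k B where "determined k B" "prob (sym_diff (X \<inter> A') B) < e"
    using assms(2) unfolding sets_PiM_single by blast
  then show ?thesis using that[of k B] A'(1) by simp
qed

end

section \<open>The variational principle\<close>

text \<open>The labels differ with vanishing probability and take values in one finite set, so the
  entropies are sums of a fixed number of convergent terms.\<close>

lemma (in prob_space) ent_LIMSEQ:
  assumes G: "\<And>n. simple_function M (G n)" and g: "simple_function M g"
    and err: "err \<longlonglongrightarrow> 0" "\<And>n. prob {x \<in> space M. G n x \<noteq> g x} \<le> err n"
    and W: "finite W" "\<And>n. G n ` space M \<subseteq> W" "g ` space M \<subseteq> W"
  shows "(\<lambda>n. ent M (G n)) \<longlonglongrightarrow> ent M g"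
proof -
  have "(\<lambda>n. pr M (G n) v) \<longlonglongrightarrow> pr M g v" for v
  proof (rule LIM_zero_cancel, rule Lim_null_comparison[OF always_eventually[OF allI] err(1)])
    show "norm (pr M (G n) v - pr M g v) \<le> err n" for n
      using pr_diff_le[OF G[of n] g, of v] err(2)[of n] by simp
  qed
  then have "(\<lambda>n. - (\<Sum>v\<in>W. pr M (G n) v * ln (pr M (G n) v))) \<longlonglongrightarrow> - (\<Sum>v\<in>W. pr M g v * ln (pr M g v))"
    by (intro tendsto_minus tendsto_sum tendsto_mult_ln pr_nonneg)
  then show ?thesis
    using ent_superset[OF W(1,2)] ent_superset[OF W(1,3)] by simp
qed

context shift_measure
begin

lemma simple_function_determined_family:
  fixes B :: "'i \<Rightarrow> (nat \<Rightarrow> nat) set"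
  assumes "\<And>A. A \<in> P \<Longrightarrow> determined k (B A)"
  shows "simple_function m (\<lambda>x. {A \<in> P. x \<in> B A})"
    and "x \<in> X \<Longrightarrow> y \<in> X \<Longrightarrow> trunc k x = trunc k y \<Longrightarrow> {A \<in> P. x \<in> B A} = {A \<in> P. y \<in> B A}"
proof -
  have eq: "{A \<in> P. x \<in> B A} = {A \<in> P. y \<in> B A}"
    if "x \<in> X" "y \<in> X" "trunc k x = trunc k y" for x y
  proof (intro Collect_cong conj_cong refl)
    fix A assume "A \<in> P"
    show "x \<in> B A \<longleftrightarrow> y \<in> B A"
      using determinedD[OF assms[OF \<open>A \<in> P\<close>] that] determinedD[OF assms[OF \<open>A \<in> P\<close>] that(2,1) that(3)[symmetric]]
      by blast
  qed
  then show "simple_function m (\<lambda>x. {A \<in> P. x \<in> B A})"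
    by (rule simple_function_determined)
  show "x \<in> X \<Longrightarrow> y \<in> X \<Longrightarrow> trunc k x = trunc k y \<Longrightarrow> {A \<in> P. x \<in> B A} = {A \<in> P. y \<in> B A}"
    by (rule eq)
qed

text \<open>A point is mislabelled only inside some \<open>sym_diff A (B A)\<close>: either the
  approximation of its own cell misses it, or the approximation of the chosen cell contains it
  although that cell does not.\<close>

lemma approx_label:
  assumes P: "finite_measurable_partition m P" and "0 < e"
  obtains k f' where "simple_function m f'" "\<And>x. f' x \<in> insert {} P"
    "\<And>x y. x \<in> X \<Longrightarrow> y \<in> X \<Longrightarrow> trunc k x = trunc k y \<Longrightarrow> f' x = f' y"
    "prob {x \<in> space m. label P x \<noteq> f' x} < e"
proof -
  have fin: "finite P" and P_sets: "P \<subseteq> sets m"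
    using P by (auto simp: finite_measurable_partition_def)
  define d where "d = e / 2 / (real (card P) + 1)"
  have "0 < d" using \<open>0 < e\<close> by (simp add: d_def)
  have "\<exists>p. determined (fst p) (snd p) \<and> prob (sym_diff A (snd p)) < d" if "A \<in> P" for A
  proof -
    have A: "A \<in> sets m" using P_sets that by (rule subsetD)
    obtain k B where "determined k B" "prob (sym_diff A B) < d"
      by (rule approx_by_cylinders[OF A \<open>0 < d\<close>])
    then show ?thesis by (intro exI[of _ "(k, B)"]) simp
  qed
  then obtain p where p: "\<And>A. A \<in> P \<Longrightarrow> determined (fst (p A)) (snd (p A))"
    "\<And>A. A \<in> P \<Longrightarrow> prob (sym_diff A (snd (p A))) < d"
    by metis
  define k where "k = Max (insert 0 ((\<lambda>A. fst (p A)) ` P))"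
  define B where "B A = snd (p A)" for A
  have B: "determined k (B A)" if "A \<in> P" for A
    unfolding B_def by (rule determined_mono[OF p(1)[OF that]]) (use that fin in \<open>auto simp: k_def intro!: Max_ge\<close>)
  \<comment> \<open>The sets \<open>B A\<close> may overlap or miss a point: one of the available
    cells is chosen, and the empty set records that there is none.\<close>
  define pick where "pick Q = (if Q = {} then {} else (SOME A. A \<in> Q))" for Q :: "(nat \<Rightarrow> nat) set set"
  define f' where "f' x = pick {A \<in> P. x \<in> B A}" for x
  have pick_in: "pick Q \<in> Q" if "Q \<noteq> {}" for Q
    using that unfolding pick_def by (simp add: some_in_eq)
  have 1: "simple_function m f'"
    unfolding f'_def by (rule simple_function_compose1) (rule simple_function_determined_family(1)[OF B])
  have 2: "f' x \<in> insert {} P" for x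
  proof (cases "{A \<in> P. x \<in> B A} = {}")
    case True
    then have "f' x = {}" unfolding f'_def pick_def by (simp only: if_True simp_thms)
    then show ?thesis by simp
  next
    case False
    then have "f' x \<in> {A \<in> P. x \<in> B A}" unfolding f'_def by (rule pick_in)
    then show ?thesis by simp
  qed
  have 3: "f' x = f' y" if "x \<in> X" "y \<in> X" "trunc k x = trunc k y" for x y
    unfolding f'_def using simple_function_determined_family(2)[OF B that, where P = P] by (simp only:)
  have sd: "sym_diff A (B A) \<in> sets m" if "A \<in> P" for A
    using P_sets that determined_sets[OF B[OF that]] by (intro sets.Un sets.Diff) auto
  have "{x \<in> space m. label P x \<noteq> f' x} \<subseteq> (\<Union>A\<in>P. sym_diff A (B A))"
  proof
    fix x assume "x \<in> {x \<in> space m. label P x \<noteq> f' x}"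
    then have x: "x \<in> space m" "label P x \<noteq> f' x" by auto
    let ?A = "label P x"
    have A: "?A \<in> P" "x \<in> ?A"
      using label_in[OF P x(1)] label_eq_iff[OF P x(1)] by blast+
    show "x \<in> (\<Union>A\<in>P. sym_diff A (B A))"
    proof (cases "x \<in> B ?A")
      case True
      then have "f' x \<in> {A \<in> P. x \<in> B A}" unfolding f'_def using A(1) by (intro pick_in) auto
      then have f': "f' x \<in> P" "x \<in> B (f' x)" by auto
      moreover have "x \<notin> f' x" using label_eq_iff[OF P x(1) f'(1)] x(2) by blast
      ultimately show ?thesis by blast
    next
      case False
      then show ?thesis using A by blast
    qed
  qed
  then have "prob {x \<in> space m. label P x \<noteq> f' x} \<le> prob (\<Union>A\<in>P. sym_diff A (B A))"
    by (rule finite_measure_mono) (intro sets.finite_UN fin sd)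
  also have "\<dots> \<le> (\<Sum>A\<in>P. prob (sym_diff A (B A)))"
    by (intro measure_UNION_le fin sd)
  also have "\<dots> \<le> (\<Sum>A\<in>P. d)" using p(2) by (intro sum_mono less_imp_le) (auto simp: B_def)
  also have "\<dots> < e"
  proof -
    have "real (card P) + 1 \<noteq> 0" using of_nat_0_le_iff[of "card P"] by linarith
    then have "d * (real (card P) + 1) = e / 2" unfolding d_def by (rule nonzero_eq_divide_eq[THEN iffD1]) simp
    then show ?thesis using \<open>0 < d\<close> \<open>0 < e\<close> by (simp add: algebra_simps)
  qed
  finally have 4: "prob {x \<in> space m. label P x \<noteq> f' x} < e" .
  show ?thesis
  proof (rule that)
    show "f' x = f' y" if "x \<in> X" "y \<in> X" "trunc k x = trunc k y" for x y
      by (rule 3[OF that])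
  qed (rule 1 2 4)+
qed

text \<open>The difference is the conditional entropy of the label given k coordinates. The label is
  nearly a function of finitely many coordinates, and conditioning on better and better
  approximations of the label leaves nothing in the limit.\<close>

lemma entropy_gap:
  assumes P: "finite_measurable_partition m P" and "0 < e"
  obtains k where "ent m (\<lambda>x. (label P x, trunc k x)) - ent m (trunc k) \<le> e"
proof -
  let ?f = "label P"
  note f = simple_function_label[OF P]
  define V where "V = insert {} P"
  have V: "finite V" "?f ` space m \<subseteq> V"
    using P label_in[OF P] by (auto simp: V_def finite_measurable_partition_def)
  define good where "good n k g \<longleftrightarrow> simple_function m g \<and> (\<forall>x. g x \<in> V) \<and>
      (\<forall>x y. x \<in> X \<longrightarrow> y \<in> X \<longrightarrow> trunc k x = trunc k y \<longrightarrow> g x = g y) \<and>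
      prob {x \<in> space m. ?f x \<noteq> g x} < 1 / real (Suc n)" for n k g
  have "\<exists>p. good n (fst p) (snd p)" for n
  proof (rule approx_label[OF P, of "1 / real (Suc n)"])
    fix k g assume a: "simple_function m g" "\<And>x. g x \<in> insert {} P"
      "\<And>x y. x \<in> X \<Longrightarrow> y \<in> X \<Longrightarrow> trunc k x = trunc k y \<Longrightarrow> g x = g y"
      "prob {x \<in> space m. ?f x \<noteq> g x} < 1 / real (Suc n)"
    then have "good n k g" unfolding good_def V_def by (intro conjI allI impI a)
    then show ?thesis by (intro exI[of _ "(k, g)"]) simp
  qed simp
  then obtain p where p: "\<And>n. good n (fst (p n)) (snd (p n))" by metis
  define K where "K n = fst (p n)" for n
  define F where "F n = snd (p n)" for n
  have F: "simple_function m (F n)" "F n x \<in> V"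
    "x \<in> X \<Longrightarrow> y \<in> X \<Longrightarrow> trunc (K n) x = trunc (K n) y \<Longrightarrow> F n x = F n y"
    "prob {x \<in> space m. ?f x \<noteq> F n x} < 1 / real (Suc n)" for n x y
    using p[of n] unfolding good_def K_def F_def by blast+
  define err where "err n = prob {x \<in> space m. ?f x \<noteq> F n x}" for n
  have err: "err \<longlonglongrightarrow> 0"
  proof (rule Lim_null_comparison)
    show "\<forall>\<^sub>F n in sequentially. norm (err n) \<le> 1 / real (Suc n)"
      unfolding err_def using F(4) by (intro always_eventually allI) (simp add: less_imp_le del: of_nat_Suc)
    show "(\<lambda>n. 1 / real (Suc n)) \<longlonglongrightarrow> 0" by (rule lim_1_over_n[THEN LIMSEQ_Suc])
  qed
  have lim1: "(\<lambda>n. ent m (\<lambda>x. (?f x, F n x))) \<longlonglongrightarrow> ent m (\<lambda>x. (?f x, ?f x))"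
    using V F(2)
    by (intro ent_LIMSEQ[OF _ _ err, where W = "V \<times> V"] simple_function_Pair f F(1)) (auto simp: err_def eq_commute)
  have lim2: "(\<lambda>n. ent m (F n)) \<longlonglongrightarrow> ent m ?f"
    using V F(2)
    by (intro ent_LIMSEQ[OF _ _ err, where W = V] f F(1)) (auto simp: err_def eq_commute)
  have "ent m (\<lambda>x. (?f x, ?f x)) \<le> ent m ?f"
    by (intro ent_mono simple_function_Pair f) auto
  then have "(\<lambda>n. ent m (\<lambda>x. (?f x, F n x)) - ent m (F n)) \<longlonglongrightarrow> ent m (\<lambda>x. (?f x, ?f x)) - ent m ?f"
    "ent m (\<lambda>x. (?f x, ?f x)) - ent m ?f < e"
    using tendsto_diff[OF lim1 lim2] \<open>0 < e\<close> by auto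
  then have "\<forall>\<^sub>F n in sequentially. ent m (\<lambda>x. (?f x, F n x)) - ent m (F n) < e"
    by (rule order_tendstoD(2))
  then obtain n where n: "ent m (\<lambda>x. (?f x, F n x)) - ent m (F n) < e"
    using eventually_happens'[OF sequentially_bot] by blast
  note tr = simple_function_trunc
  \<comment> \<open>Conditioning on \<open>trunc (K n)\<close>, which determines \<open>F n\<close>,
    instead of \<open>F n\<close> only lowers the conditional entropy; this is
    submodularity.\<close>
  have "ent m (\<lambda>x. (?f x, trunc (K n) x)) + ent m (F n)
      \<le> ent m (\<lambda>x. (?f x, trunc (K n) x, F n x)) + ent m (F n)"
    by (intro add_right_mono ent_mono simple_function_Pair f tr F(1)) auto
  also have "\<dots> \<le> ent m (\<lambda>x. (?f x, F n x)) + ent m (\<lambda>x. (trunc (K n) x, F n x))"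
    by (rule ent_submodular[OF f tr F(1)])
  also have "ent m (\<lambda>x. (trunc (K n) x, F n x)) \<le> ent m (trunc (K n))"
  proof (rule ent_mono)
    fix x y assume xy: "x \<in> space m" "y \<in> space m" "trunc (K n) x = trunc (K n) y"
    have "F n x = F n y" by (rule F(3)) (use xy in simp_all)
    with xy(3) show "(trunc (K n) x, F n x) = (trunc (K n) y, F n y)" by simp
  qed (intro simple_function_Pair tr F(1))+
  finally show ?thesis using n by (intro that[of "K n"]) simp
qed

text \<open>A chain rule: revealing the label at time i costs at most its conditional entropy given
  the k coordinates from i on. By invariance this cost does not depend on i, and for i < n those
  coordinates lie among the first n + k.\<close>

lemma ent_itin_le:
  assumes f: "simple_function m f" and "i \<le> n"
  shows "ent m (\<lambda>x. (itin shift f i x, trunc (n + k) x)) \<le>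
    ent m (trunc (n + k)) + real i * (ent m (\<lambda>x. (f x, trunc k x)) - ent m (trunc k))"
  using assms(2)
proof (induction i)
  case 0
  show ?case
    by (simp, intro ent_mono simple_function_Pair simple_function_itin f simple_function_trunc)
       (auto simp: itin_def)
next
  case (Suc i)
  note tr = simple_function_trunc and it = simple_function_itin[OF f]
  let ?T = "trunc (n + k)" and ?f = "\<lambda>x. f ((shift ^^ i) x)" and ?h = "\<lambda>x. trunc k ((shift ^^ i) x)"
  let ?G = "\<lambda>x. (itin shift f i x, ?T x)"
  have G: "simple_function m ?G" by (intro simple_function_Pair it tr)
  have f': "simple_function m ?f" by (rule simple_function_T[OF f])
  have h: "simple_function m ?h" by (rule simple_function_T[OF tr])
  have "ent m (\<lambda>x. (itin shift f (Suc i) x, ?T x)) + ent m ?h \<le> ent m (\<lambda>x. (?f x, ?G x, ?h x)) + ent m ?h"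
    by (intro add_right_mono ent_mono simple_function_Pair it f' h tr) (auto simp: itin_Suc)
  also have "\<dots> \<le> ent m (\<lambda>x. (?f x, ?h x)) + ent m (\<lambda>x. (?G x, ?h x))"
    by (rule ent_submodular[OF f' G h])
  also have "ent m (\<lambda>x. (?f x, ?h x)) = ent m (\<lambda>x. (f x, trunc k x))"
    using ent_T[OF simple_function_Pair[OF f tr[of k]], of i] .
  also have "ent m (\<lambda>x. (?G x, ?h x)) \<le> ent m ?G"
  proof (intro ent_mono simple_function_Pair it h tr G)
    fix x y assume "?G x = ?G y"
    then show "(?G x, ?h x) = (?G y, ?h y)"
      using Suc.prems by (auto simp: trunc_eq_iff)
  qed
  also have "ent m ?G \<le> ent m ?T + real i * (ent m (\<lambda>x. (f x, trunc k x)) - ent m (trunc k))"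
    using Suc by simp
  also have "ent m ?h = ent m (trunc k)" by (rule ent_T[OF tr])
  finally show ?case by (simp add: algebra_simps)
qed

text \<open>Up to an error e per step, itineraries of length n have at most the entropy of words of
  length n + k, which Gibbs' inequality bounds by the logarithm of the partition sum at s. The extra
  k coordinates vanish after division by n.\<close>

lemma entropy_wrt_partition_le:
  assumes P: "finite_measurable_partition m P"
  shows "entropy_wrt_partition m shift P \<le> ln (lam \<beta> s) - s * freq"
proof (rule field_le_epsilon)
  fix e :: real assume "0 < e"
  let ?f = "label P"
  note f = simple_function_label[OF P]
  obtain k where k: "ent m (\<lambda>x. (?f x, trunc k x)) - ent m (trunc k) \<le> e"
    using entropy_gap[OF P \<open>0 < e\<close>] by blast
  define C where "C = (\<Sum>n. H n s q / lam \<beta> s ^ n)"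
  define p where "p = ln (lam \<beta> s) - s * freq"
  have C: "pressure_sum N s \<le> C * lam \<beta> s ^ N" for N
    unfolding C_def by (rule pressure_sum_le_lam)
  have "0 < C" using C[of 0] pressure_sum_pos[of 0 s] by simp
  have bound: "ent m (itin shift ?f n) / real n \<le> (ln C + real k * p) / real n + (p + e)" if "n > 0" for n
  proof -
    have "ent m (itin shift ?f n) \<le> ent m (\<lambda>x. (itin shift ?f n x, trunc (n + k) x))"
      by (intro ent_mono simple_function_Pair simple_function_itin f simple_function_trunc) auto
    also have "\<dots> \<le> ent m (trunc (n + k)) + real n * (ent m (\<lambda>x. (?f x, trunc k x)) - ent m (trunc k))"
      by (rule ent_itin_le[OF f order_refl])
    also have "\<dots> \<le> (ln C + real (n + k) * p) + real n * e"
    proof (intro add_mono mult_left_mono k)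
      have "ln (pressure_sum (n + k) s) \<le> ln (C * lam \<beta> s ^ (n + k))"
        using C pressure_sum_pos by (intro ln_mono) auto
      also have "\<dots> = ln C + real (n + k) * ln (lam \<beta> s)"
        using \<open>0 < C\<close> by (simp add: ln_mult ln_realpow)
      finally show "ent m (trunc (n + k)) \<le> ln C + real (n + k) * p"
        using ent_trunc_le[of "n + k" s] by (simp add: p_def algebra_simps)
    qed simp
    finally have "ent m (itin shift ?f n) \<le> (ln C + real k * p) + real n * (p + e)"
      by (simp add: algebra_simps)
    then show ?thesis using that by (simp add: field_simps)
  qed
  have "(\<lambda>n. (ln C + real k * p) / real n + (p + e)) \<longlonglongrightarrow> 0 + (p + e)"
    by (intro tendsto_intros lim_const_over_n)
  then have "entropy_wrt_partition m shift P \<le> 0 + (p + e)"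
    by (rule LIMSEQ_le[OF entropy_wrt_partition_LIMSEQ[OF P]]) (use bound in \<open>auto intro!: exI[of _ 1]\<close>)
  then show "entropy_wrt_partition m shift P \<le> ln (lam \<beta> s) - s * freq + e"
    by (simp add: p_def)
qed

lemma ks_entropy_le: "ks_entropy m shift \<le> ereal (ln (lam \<beta> s) - s * freq)"
  unfolding ks_entropy_def using entropy_wrt_partition_le by (intro SUP_least) auto

lemma ks_entropy_nonneg: "0 \<le> ks_entropy m shift"
proof -
  have P: "finite_measurable_partition m {X}"
  proof -
    have "X \<noteq> {}" using zero_in_beta_shift by blast
    moreover have "X \<in> sets m" using sets.top[of m] by (simp only: space_m)
    ultimately show ?thesis
      by (simp add: finite_measurable_partition_def partition_on_def disjoint_def)
  qed
  have "0 \<le> entropy_wrt_partition m shift {X}"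
    by (rule LIMSEQ_le_const[OF entropy_wrt_partition_LIMSEQ[OF P]]) (intro exI[of _ 0] allI impI divide_nonneg_nonneg ent_nonneg of_nat_0_le_iff)
  then have "0 \<le> ereal (entropy_wrt_partition m shift {X})" by simp
  also have "\<dots> \<le> ks_entropy m shift"
    unfolding ks_entropy_def using P by (intro SUP_upper) auto
  finally show ?thesis .
qed

end

section \<open>The competitor measure and the subgradient inequality\<close>

context beta_expansion
begin

text \<open>Itineraries for the partition by the first digit determine the prefix of length n. The
  upper bound for cylinders bounds minus the logarithm of each probability from below by
  \<open>n * ln (lam \<beta> t)\<close> minus t times the number of ones, up to a constant;
  averaging gives the claim.\<close>

lemma ks_entropy_gibbs:
  "ereal (ln (lam \<beta> t) - t * (\<integral>x. indicator (one_cylinder \<beta>) x \<partial>gibbs t)) \<le> ks_entropy (gibbs t) shift"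
proof -
  interpret G: shift_measure \<beta> "gibbs t"
    by unfold_locales (rule gibbs_invariant)
  let ?P = "{one_cylinder \<beta>, X - one_cylinder \<beta>}"
  have sub: "one_cylinder \<beta> \<subseteq> X" by (auto simp: one_cylinder_def)
  have ne: "q \<in> one_cylinder \<beta>" "(\<lambda>_. 0) \<in> X - one_cylinder \<beta>"
    using q_in_beta_shift zero_in_beta_shift by (auto simp: one_cylinder_def)
  have P: "finite_measurable_partition (gibbs t) ?P"
    unfolding finite_measurable_partition_def
  proof (intro conjI)
    show "?P \<subseteq> sets (gibbs t)"
      using one_cylinder_sets sets.compl_sets[of "one_cylinder \<beta>" shift_borel] by simp
    show "partition_on (space (gibbs t)) ?P"
      using sub ne by (auto simp: partition_on_def disjoint_def)
  qed simp
  obtain C where C: "1 \<le> C" "\<And>n x. measure (gibbs t) (cyl n x) \<le> C * (H n t x / lam \<beta> t ^ n)"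
    using gibbs_cyl_le[of t] by blast
  let ?a = "G.freq"
  have bound: "ln (lam \<beta> t) - t * ?a - ln C / real n \<le> ent (gibbs t) (itin shift (label ?P) n) / real n"
    if "n > 0" for n
  proof -
    let ?p = "pr (gibbs t) (trunc n)" and ?V = "trunc n ` X"
    have cell_bound: "?p v * (real n * ln (lam \<beta> t) - ln C) - t * (?p v * (\<Sum>i<n. real (v i))) \<le> - (?p v * ln (?p v))"
      if "v \<in> ?V" for v
    proof (cases "?p v = 0")
      case False
      then have p: "0 < ?p v" using pr_nonneg[of "gibbs t" "trunc n" v] by linarith
      obtain x where x: "x \<in> X" "v = trunc n x" using \<open>v \<in> ?V\<close> by blast
      have "?p v \<le> C * (H n t v / lam \<beta> t ^ n)"
        using C(2)[of n x] x by (simp add: pr_def G.trunc_vimage)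
      then have "ln (?p v) \<le> ln (C * (H n t v / lam \<beta> t ^ n))"
        using p C(1) by (intro ln_mono) auto
      also have "\<dots> = ln C + t * (\<Sum>i<n. real (v i)) - real n * ln (lam \<beta> t)"
      proof -
        have "ln (H n t v) = t * (\<Sum>i<n. real (v i))" by (simp add: H_def)
        then show ?thesis using C(1) by (simp add: ln_mult ln_div ln_realpow)
      qed
      finally have "?p v * ln (?p v) \<le> ?p v * (ln C + t * (\<Sum>i<n. real (v i)) - real n * ln (lam \<beta> t))"
        using p by (intro mult_left_mono) auto
      then show ?thesis by (simp add: algebra_simps)
    qed simp
    have "(\<Sum>v\<in>?V. ?p v * (real n * ln (lam \<beta> t) - ln C) - t * (?p v * (\<Sum>i<n. real (v i))))
        \<le> (\<Sum>v\<in>?V. - (?p v * ln (?p v)))"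
      by (intro sum_mono cell_bound)
    also have "\<dots> = ent (gibbs t) (trunc n)" by (simp add: ent_def sum_negf)
    also have "(\<Sum>v\<in>?V. ?p v * (real n * ln (lam \<beta> t) - ln C) - t * (?p v * (\<Sum>i<n. real (v i))))
        = real n * ln (lam \<beta> t) - ln C - t * (real n * ?a)"
      unfolding sum_subtractf sum_distrib_right[symmetric] sum_distrib_left[symmetric] G.sum_pr_ones
      using G.sum_pr[OF G.simple_function_trunc, of n] by simp
    also have "ent (gibbs t) (trunc n) \<le> ent (gibbs t) (itin shift (label ?P) n)"
    proof (intro G.ent_mono G.simple_function_itin G.simple_function_label P G.simple_function_trunc)
      fix x y assume xy: "x \<in> space (gibbs t)" "y \<in> space (gibbs t)"
        "itin shift (label ?P) n x = itin shift (label ?P) n y"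
      show "trunc n x = trunc n y"
        unfolding trunc_eq_iff
      proof (intro allI impI)
        fix i assume "i < n"
        then have "label ?P ((shift ^^ i) x) = label ?P ((shift ^^ i) y)"
          using xy(3) by (simp add: itin_eq_iff)
        then have "(shift ^^ i) x \<in> one_cylinder \<beta> \<longleftrightarrow> (shift ^^ i) y \<in> one_cylinder \<beta>"
          using G.label_eq_iff[OF P G.T_space[OF xy(1)], of "one_cylinder \<beta>" i]
            G.label_eq_iff[OF P G.T_space[OF xy(2)], of "one_cylinder \<beta>" i] by simp
        then show "x i = y i"
          using xy(1,2) beta_shift_digit[of x i] beta_shift_digit[of y i]
            shift_in_beta_shift[of x i] shift_in_beta_shift[of y i]
          by (auto simp: one_cylinder_def)
      qed
    qed
    finally have "(real n * ln (lam \<beta> t) - ln C - t * (real n * ?a)) / real n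
        \<le> ent (gibbs t) (itin shift (label ?P) n) / real n"
      by (intro divide_right_mono) auto
    moreover have "(real n * ln (lam \<beta> t) - ln C - t * (real n * ?a)) / real n
        = ln (lam \<beta> t) - t * ?a - ln C / real n"
      using that by (simp add: field_simps)
    ultimately show ?thesis by simp
  qed
  have "(\<lambda>n. ln (lam \<beta> t) - t * ?a - ln C / real n) \<longlonglongrightarrow> ln (lam \<beta> t) - t * ?a - 0"
    by (intro tendsto_intros lim_const_over_n)
  then have "ln (lam \<beta> t) - t * ?a - 0 \<le> entropy_wrt_partition (gibbs t) shift ?P"
    by (rule LIMSEQ_le[OF _ G.entropy_wrt_partition_LIMSEQ[OF P]]) (use bound in \<open>auto intro!: exI[of _ 1]\<close>)
  then have "ereal (ln (lam \<beta> t) - t * ?a) \<le> ereal (entropy_wrt_partition (gibbs t) shift ?P)"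
    by simp
  also have "\<dots> \<le> ks_entropy (gibbs t) shift"
    unfolding ks_entropy_def using P by (intro SUP_upper) auto
  finally show ?thesis by (simp add: G.freq_def)
qed

text \<open>Let h be the entropy of \<mu>. The competitor \<open>gibbs t\<close> gives
  \<open>ln (lam \<beta> t) \<le> h + t * \<alpha>\<close>, the upper bound at s gives
  \<open>h \<le> ln (lam \<beta> s) - s * \<alpha>\<close>, and eliminating h proves the first
  claim. The second one combines h \<ge> 0 with the upper bound at t.\<close>

lemma equilibrium_subgradient:
  assumes eq: "equilibrium_state X shift (\<lambda>x. t * indicator (one_cylinder \<beta>) x) \<mu>"
    and \<alpha>: "\<alpha> = (\<integral>x. indicator (one_cylinder \<beta>) x \<partial>\<mu>)"
  shows "ln (lam \<beta> t) + (s - t) * \<alpha> \<le> ln (lam \<beta> s)" "0 \<le> ln (lam \<beta> t) - t * \<alpha>"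
proof -
  have inv: "\<mu> \<in> invariant_measures X shift"
    using eq by (simp add: equilibrium_state_def)
  interpret M: shift_measure \<beta> \<mu> by unfold_locales (rule inv)
  have freq: "M.freq = \<alpha>" by (simp add: M.freq_def \<alpha>)
  let ?g = "\<integral>x. indicator (one_cylinder \<beta>) x \<partial>gibbs t"
  have "ereal (ln (lam \<beta> t)) = ereal (ln (lam \<beta> t) - t * ?g) + ereal (t * ?g)" by simp
  also have "\<dots> \<le> ks_entropy (gibbs t) shift + ereal (t * ?g)"
    by (intro add_right_mono ks_entropy_gibbs)
  also have "\<dots> = ks_entropy (gibbs t) shift + ereal (\<integral>x. t * indicator (one_cylinder \<beta>) x \<partial>gibbs t)"
    by simp
  also have "\<dots> \<le> (SUP m\<in>invariant_measures X shift.
      ks_entropy m shift + ereal (\<integral>x. t * indicator (one_cylinder \<beta>) x \<partial>m))"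
    by (rule SUP_upper) (rule gibbs_invariant)
  also have "\<dots> = ks_entropy \<mu> shift + ereal (\<integral>x. t * indicator (one_cylinder \<beta>) x \<partial>\<mu>)"
    using eq by (simp only: equilibrium_state_def)
  also have "\<dots> = ks_entropy \<mu> shift + ereal (t * \<alpha>)" by (simp add: \<alpha>)
  finally have lower: "ereal (ln (lam \<beta> t)) \<le> ks_entropy \<mu> shift + ereal (t * \<alpha>)" .
  have "ereal (ln (lam \<beta> t)) \<le> ereal (ln (lam \<beta> s) - s * \<alpha>) + ereal (t * \<alpha>)"
    using lower M.ks_entropy_le[of s] unfolding freq by (meson add_right_mono order_trans)
  then show "ln (lam \<beta> t) + (s - t) * \<alpha> \<le> ln (lam \<beta> s)" by (simp add: algebra_simps)
  have "0 \<le> ereal (ln (lam \<beta> t) - t * \<alpha>)"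
    using M.ks_entropy_nonneg M.ks_entropy_le[of t] unfolding freq by (rule order_trans)
  then show "0 \<le> ln (lam \<beta> t) - t * \<alpha>" by simp
qed

end

section \<open>The frequency of ones in an equilibrium state\<close>

text \<open>The exponents grow at most linearly while the weights p have geometric slack r, so the
  Weierstrass test permits termwise differentiation near 0.\<close>

lemma exp_series_derivative:
  fixes p b :: "nat \<Rightarrow> real"
  assumes p: "\<And>n. 0 \<le> p n" and K: "0 < K" "\<And>n. \<bar>b n\<bar> \<le> K * real (Suc n)"
    and r: "1 < r" and sum: "summable (\<lambda>n. p n * r ^ n)"
  shows "summable (\<lambda>n. p n * b n)"
    and "((\<lambda>x. \<Sum>n. p n * exp (x * b n)) has_real_derivative (\<Sum>n. p n * b n)) (at 0)"
    and "\<exists>e>0. \<forall>x. \<bar>x\<bar> < e \<longrightarrow> summable (\<lambda>n. p n * exp (x * b n))"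
proof -
  \<comment> \<open>The slack is split in two: one factor \<open>exp (\<eta> * real (Suc n))\<close>
    absorbs \<open>exp (x * b n)\<close>, the other absorbs the linear factor \<open>b n\<close>
    produced by differentiation, at the price of the constant \<open>K / \<eta>\<close>.\<close>
  define \<eta> where "\<eta> = ln r / 2"
  have \<eta>: "0 < \<eta>" using r by (simp add: \<eta>_def)
  define e where "e = \<eta> / K"
  have e: "0 < e" using \<eta> K by (simp add: e_def)
  define S where "S = {- e..e}"
  define M where "M n = p n * r ^ n * (K / \<eta> * r)" for n
  have M: "summable M" unfolding M_def by (intro summable_mult2 sum)
  have exp_bound: "exp (x * b n) \<le> exp (\<eta> * real (Suc n))" if "x \<in> S" for x n
  proof -
    have "x * b n \<le> \<bar>x\<bar> * \<bar>b n\<bar>" by (simp add: abs_mult[symmetric])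
    also have "\<dots> \<le> e * (K * real (Suc n))"
      using that K(2)[of n] e by (intro mult_mono) (auto simp: S_def)
    also have "\<dots> = \<eta> * real (Suc n)" using K by (simp add: e_def)
    finally show ?thesis by simp
  qed
  have exp_r: "exp (\<eta> * real (Suc n)) * exp (\<eta> * real (Suc n)) = r ^ Suc n" for n
  proof -
    have "exp (\<eta> * real (Suc n)) * exp (\<eta> * real (Suc n)) = exp (real (Suc n) * ln r)"
      by (simp only: exp_add[symmetric] \<eta>_def) (simp add: field_simps)
    also have "\<dots> = r ^ Suc n" using r by (simp only: exp_of_nat_mult exp_ln)
    finally show ?thesis .
  qed
  have deriv_bound: "norm (p n * (exp (x * b n) * b n)) \<le> M n" if "x \<in> S" for n x
  proof -
    have "\<eta> * real (Suc n) \<le> exp (\<eta> * real (Suc n))"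
      using exp_ge_add_one_self[of "\<eta> * real (Suc n)"] by linarith
    then have "real (Suc n) \<le> exp (\<eta> * real (Suc n)) / \<eta>"
      using \<eta> by (simp add: pos_le_divide_eq mult.commute)
    then have "\<bar>b n\<bar> \<le> K * (exp (\<eta> * real (Suc n)) / \<eta>)"
      using K(2)[of n] K(1) by (meson mult_left_mono less_imp_le order_trans)
    then have "exp (x * b n) * \<bar>b n\<bar> \<le> exp (\<eta> * real (Suc n)) * (K * (exp (\<eta> * real (Suc n)) / \<eta>))"
      using exp_bound[OF that] by (intro mult_mono) auto
    also have "\<dots> = K / \<eta> * (exp (\<eta> * real (Suc n)) * exp (\<eta> * real (Suc n)))" by simp
    also have "\<dots> = K / \<eta> * (r * r ^ n)" unfolding exp_r by simp
    finally have "p n * (exp (x * b n) * \<bar>b n\<bar>) \<le> p n * (K / \<eta> * (r * r ^ n))"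
      using p by (intro mult_left_mono)
    then show ?thesis using p[of n] by (simp add: M_def abs_mult mult_ac)
  qed
  have "summable p"
  proof (rule summable_comparison_test'[OF sum, of 0])
    fix n show "norm (p n) \<le> p n * r ^ n"
      using p[of n] r mult_left_mono[OF one_le_power[of r n] p[of n]] by simp
  qed
  have unif: "uniformly_convergent_on S (\<lambda>n x. \<Sum>i<n. p i * (exp (x * b i) * b i))"
    by (rule Weierstrass_m_test'[OF deriv_bound M])
  have deriv: "((\<lambda>x. p n * exp (x * b n)) has_field_derivative p n * (exp (x * b n) * b n)) (at x within S)" for n x
    by (auto intro!: derivative_eq_intros)
  have S: "convex S" "0 \<in> S" unfolding S_def using e by auto
  have sum0: "summable (\<lambda>n. p n * exp (0 * b n))" using \<open>summable p\<close> by simp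
  note series = has_field_derivative_series'[OF S(1) deriv unif S(2) sum0]
  have int: "x \<in> interior S" if "\<bar>x\<bar> < e" for x
    using that by (auto simp: S_def interior_atLeastAtMost_real)
  show "((\<lambda>x. \<Sum>n. p n * exp (x * b n)) has_real_derivative (\<Sum>n. p n * b n)) (at 0)"
    using series(2)[OF int[of 0]] e by simp
  show "\<exists>e>0. \<forall>x. \<bar>x\<bar> < e \<longrightarrow> summable (\<lambda>n. p n * exp (x * b n))"
    using series(1)[OF int] e by blast
  show "summable (\<lambda>n. p n * b n)"
    by (rule summable_comparison_test'[OF M, of 0]) (use deriv_bound[OF S(2)] in simp)
qed

text \<open>The series equals 1 at 0 and is at least 1 wherever it converges, so 0 is a local
  minimum.\<close>

lemma exp_series_critical:
  fixes p b :: "nat \<Rightarrow> real"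
  assumes p: "\<And>n. 0 \<le> p n" "p sums 1" and K: "0 < K" "\<And>n. \<bar>b n\<bar> \<le> K * real (Suc n)"
    and r: "1 < r" "summable (\<lambda>n. p n * r ^ n)"
    and min: "\<And>x. summable (\<lambda>n. p n * exp (x * b n)) \<Longrightarrow> 1 \<le> (\<Sum>n. p n * exp (x * b n))"
  shows "(\<Sum>n. p n * b n) = 0"
proof -
  note d = exp_series_derivative[OF p(1) K r]
  obtain e where e: "0 < e" "\<And>x. \<bar>x\<bar> < e \<Longrightarrow> summable (\<lambda>n. p n * exp (x * b n))"
    using d(3) by blast
  have "(\<Sum>n. p n * exp (0 * b n)) = 1" using p(2) by (simp add: sums_iff)
  then have "\<forall>y. \<bar>0 - y\<bar> < e \<longrightarrow> (\<Sum>n. p n * exp (0 * b n)) \<le> (\<Sum>n. p n * exp (y * b n))"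
    using min e(2) by simp
  then show ?thesis by (rule DERIV_local_min[OF d(2) e(1)])
qed

lemma sum_triangle:
  fixes p :: "nat \<Rightarrow> real"
  shows "(\<Sum>l<N. a l * (\<Sum>k\<in>{l..<N}. p k)) = (\<Sum>k<N. p k * (\<Sum>l\<le>k. a l))"
proof -
  have "(\<Sum>l<N. a l * (\<Sum>k\<in>{l..<N}. p k)) = (\<Sum>l<N. \<Sum>k<N. if l \<le> k then a l * p k else 0)"
  proof (intro sum.cong refl)
    fix l
    have "(\<Sum>k<N. if l \<le> k then a l * p k else 0) = (\<Sum>k\<in>{..<N} \<inter> {k. l \<le> k}. a l * p k)"
      by (simp add: sum.inter_restrict)
    also have "{..<N} \<inter> {k. l \<le> k} = {l..<N}" by auto
    finally show "a l * (\<Sum>k\<in>{l..<N}. p k) = (\<Sum>k<N. if l \<le> k then a l * p k else 0)"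
      by (simp add: sum_distrib_left)
  qed
  also have "\<dots> = (\<Sum>k<N. \<Sum>l<N. if l \<le> k then a l * p k else 0)" by (rule sum.swap)
  also have "\<dots> = (\<Sum>k<N. p k * (\<Sum>l\<le>k. a l))"
  proof (intro sum.cong refl)
    fix k assume "k \<in> {..<N}"
    have "(\<Sum>l<N. if l \<le> k then a l * p k else 0) = (\<Sum>l\<in>{..<N} \<inter> {l. l \<le> k}. a l * p k)"
      by (simp add: sum.inter_restrict)
    also have "{..<N} \<inter> {l. l \<le> k} = {..k}" using \<open>k \<in> {..<N}\<close> by auto
    finally show "(\<Sum>l<N. if l \<le> k then a l * p k else 0) = p k * (\<Sum>l\<le>k. a l)"
      by (simp add: sum_distrib_left mult.commute)
  qed
  finally show ?thesis .
qed

section \<open>The balance of ones and the formulas for the frequency\<close>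

context beta_expansion
begin

lemma sum_q_le: "(\<Sum>i<n. real (q i)) \<le> real n"
  using sum_mono[of "{..<n}" "\<lambda>i. real (q i)" "\<lambda>_. 1"] q_le_1 by simp

lemma phi_coeff_summable_beyond:
  obtains r where "1 < r" "summable (\<lambda>n. H n t q * (r / lam \<beta> t) ^ n)"
    "summable (\<lambda>n. phi_coeff t n / lam \<beta> t ^ Suc n * r ^ n)"
proof -
  obtain r where r: "1 < r" "summable (\<lambda>n. H n t q * (r / lam \<beta> t) ^ n)"
    using H_summable_beyond by blast
  have "summable (\<lambda>n. phi_coeff t n / lam \<beta> t ^ Suc n * r ^ n)"
  proof (rule summable_comparison_test'[OF r(2), of 0])
    fix n
    have "phi_coeff t n / lam \<beta> t ^ Suc n * r ^ n = phi_coeff t n * (r / lam \<beta> t) ^ n / lam \<beta> t"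
      by (simp add: power_divide)
    also have "\<dots> \<le> phi_coeff t n * (r / lam \<beta> t) ^ n / 1"
      using lam_gt_1[of t] r(1) by (intro divide_left_mono) (auto intro!: mult_nonneg_nonneg)
    also have "\<dots> \<le> H n t q * (r / lam \<beta> t) ^ n"
      using phi_coeff_le_H r(1) by (simp add: mult_right_mono)
    finally show "norm (phi_coeff t n / lam \<beta> t ^ Suc n * r ^ n) \<le> H n t q * (r / lam \<beta> t) ^ n"
      using r(1) by (simp add: abs_mult)
  qed
  with r show ?thesis using that by blast
qed

text \<open>The factor \<open>exp (\<delta> * (S - (n + 1) * \<alpha>))\<close> moves the term of \<open>phi\<close> from \<open>t\<close> and \<open>1 / lam \<beta> t\<close> to
  \<open>t + \<delta>\<close> and \<open>exp (- (ln (lam \<beta> t) + \<delta> * \<alpha>))\<close>, which is at least \<open>1 / lam \<beta> (t + \<delta>)\<close>.\<close>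

lemma tilted_term_ge:
  assumes sub: "ln (lam \<beta> t) + \<delta> * \<alpha> \<le> ln (lam \<beta> (t + \<delta>))"
  shows "H n (t + \<delta>) x / lam \<beta> (t + \<delta>) ^ Suc n
    \<le> H n t x / lam \<beta> t ^ Suc n * exp (\<delta> * ((\<Sum>i<n. real (x i)) - real (Suc n) * \<alpha>))"
proof -
  let ?S = "\<Sum>i<n. real (x i)"
  have lam: "lam \<beta> s ^ Suc n = exp (real (Suc n) * ln (lam \<beta> s))" for s
    by (simp only: exp_of_nat_mult exp_ln lam_pos)
  have "real (Suc n) * (ln (lam \<beta> t) + \<delta> * \<alpha>) \<le> real (Suc n) * ln (lam \<beta> (t + \<delta>))"
    using sub by (intro mult_left_mono) auto
  then have "(t + \<delta>) * ?S - real (Suc n) * ln (lam \<beta> (t + \<delta>))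
      \<le> t * ?S - real (Suc n) * ln (lam \<beta> t) + \<delta> * (?S - real (Suc n) * \<alpha>)"
    by (simp add: algebra_simps)
  then have "exp ((t + \<delta>) * ?S - real (Suc n) * ln (lam \<beta> (t + \<delta>)))
      \<le> exp (t * ?S - real (Suc n) * ln (lam \<beta> t) + \<delta> * (?S - real (Suc n) * \<alpha>))"
    by simp
  then show ?thesis unfolding lam H_def by (simp only: exp_diff exp_add)
qed

text \<open>Formulated for any binary x that solves the equation \<open>one\<close> at all
  parameters, so that it covers both the quasi-greedy expansion and the finite greedy expansion of
  1. By \<open>tilted_term_ge\<close> the tilted series dominates the series at
  \<open>t + \<delta>\<close>, whose sum is 1, and hence is critical at \<delta> = 0.\<close>

lemma frequency_balance:
  assumes sub: "\<And>s. ln (lam \<beta> t) + (s - t) * \<alpha> \<le> ln (lam \<beta> s)"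
    and x: "\<And>n. x n \<le> Suc 0"
    and one: "\<And>s. (\<lambda>n. real (x n) * H n s x / lam \<beta> s ^ Suc n) sums 1"
    and r: "1 < r" "summable (\<lambda>n. real (x n) * H n t x / lam \<beta> t ^ Suc n * r ^ n)"
  defines "p \<equiv> \<lambda>n. real (x n) * H n t x / lam \<beta> t ^ Suc n"
  shows "(\<Sum>n. (\<Sum>i<n. real (x i)) * p n) = \<alpha> * (\<Sum>n. real (Suc n) * p n)"
proof -
  let ?S = "\<lambda>n. \<Sum>i<n. real (x i)"
  let ?b = "\<lambda>n. ?S n - real (Suc n) * \<alpha>"
  have p_nonneg: "0 \<le> p n" for n by (simp add: p_def)
  have S: "0 \<le> ?S n" "?S n \<le> real (Suc n)" for n
    using sum_mono[of "{..<n}" "\<lambda>i. real (x i)" "\<lambda>_. 1"] x by (auto intro: sum_nonneg)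
  have K: "\<bar>?b n\<bar> \<le> (1 + \<bar>\<alpha>\<bar>) * real (Suc n)" for n
  proof -
    have "\<bar>?b n\<bar> \<le> \<bar>?S n\<bar> + \<bar>real (Suc n) * \<alpha>\<bar>" by (rule abs_triangle_ineq4)
    also have "\<dots> \<le> real (Suc n) + real (Suc n) * \<bar>\<alpha>\<bar>"
      using S[of n] by (simp add: abs_mult)
    finally show ?thesis by (simp add: algebra_simps)
  qed
  have K0: "0 < 1 + \<bar>\<alpha>\<bar>" by simp
  have sums: "p sums 1" using one[of t] by (simp add: p_def del: power_Suc)
  have summable: "summable (\<lambda>n. p n * r ^ n)" using r(2) by (simp add: p_def del: power_Suc)
  have "(\<Sum>n. p n * ?b n) = 0"
  proof (rule exp_series_critical[OF p_nonneg sums K0 K r(1) summable])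
    fix \<delta> assume sm: "summable (\<lambda>n. p n * exp (\<delta> * ?b n))"
    have sub': "ln (lam \<beta> t) + \<delta> * \<alpha> \<le> ln (lam \<beta> (t + \<delta>))" using sub[of "t + \<delta>"] by simp
    have "1 = (\<Sum>n. real (x n) * H n (t + \<delta>) x / lam \<beta> (t + \<delta>) ^ Suc n)"
      using one by (rule sums_unique)
    also have "\<dots> \<le> (\<Sum>n. p n * exp (\<delta> * ?b n))"
    proof (rule suminf_le[OF _ sums_summable[OF one] sm])
      fix n
      have "real (x n) * (H n (t + \<delta>) x / lam \<beta> (t + \<delta>) ^ Suc n)
          \<le> real (x n) * (H n t x / lam \<beta> t ^ Suc n * exp (\<delta> * ?b n))"
        by (intro mult_left_mono tilted_term_ge sub') simp
      then show "real (x n) * H n (t + \<delta>) x / lam \<beta> (t + \<delta>) ^ Suc n \<le> p n * exp (\<delta> * ?b n)"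
        by (simp only: p_def mult.assoc times_divide_eq_right times_divide_eq_left)
    qed
    finally show "1 \<le> (\<Sum>n. p n * exp (\<delta> * ?b n))" .
  qed
  moreover have sS: "summable (\<lambda>n. p n * ?S n)"
    by (rule exp_series_derivative(1)[OF p_nonneg zero_less_one _ r(1) summable]) (use S in \<open>simp add: abs_of_nonneg\<close>)
  moreover have sB: "summable (\<lambda>n. p n * real (Suc n))"
    by (rule exp_series_derivative(1)[OF p_nonneg zero_less_one _ r(1) summable]) simp
  have "summable (\<lambda>n. p n * (real (Suc n) * \<alpha>))"
    using summable_mult2[OF sB, of \<alpha>] by (simp only: mult.assoc)
  from suminf_diff[OF sS this] have "(\<Sum>n. p n * ?S n) - (\<Sum>n. p n * (real (Suc n) * \<alpha>)) = (\<Sum>n. p n * ?b n)"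
    by (simp only: right_diff_distrib)
  moreover have "(\<Sum>n. p n * (real (Suc n) * \<alpha>)) = (\<Sum>n. p n * real (Suc n)) * \<alpha>"
    using suminf_mult2[OF sB, of \<alpha>] by (simp only: mult.assoc)
  ultimately have "(\<Sum>n. p n * ?S n) = (\<Sum>n. p n * real (Suc n)) * \<alpha>" by linarith
  then show ?thesis by (simp only: mult.commute)
qed

lemma phi_frequency_balance:
  assumes sub: "\<And>s. ln (lam \<beta> t) + (s - t) * \<alpha> \<le> ln (lam \<beta> s)"
  shows "(\<Sum>n. phi_coeff t n / lam \<beta> t ^ Suc n * (\<Sum>i<n. real (q i)))
    = \<alpha> * (\<Sum>n. phi_coeff t n / lam \<beta> t ^ Suc n * real (Suc n))"
proof -
  obtain r where r: "1 < r" "summable (\<lambda>n. phi_coeff t n / lam \<beta> t ^ Suc n * r ^ n)"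
    using phi_coeff_summable_beyond[of t] by blast
  have "(\<lambda>n. real (q n) * H n s q / lam \<beta> s ^ Suc n) sums 1" for s
    using phi_sums[of s] by (simp only: phi_coeff_def)
  moreover have "q n \<le> Suc 0" for n using q_le_1[of n] by simp
  moreover have "summable (\<lambda>n. real (q n) * H n t q / lam \<beta> t ^ Suc n * r ^ n)"
    using r(2) by (simp only: phi_coeff_def)
  ultimately have "(\<Sum>n. (\<Sum>i<n. real (q i)) * (real (q n) * H n t q / lam \<beta> t ^ Suc n))
      = \<alpha> * (\<Sum>n. real (Suc n) * (real (q n) * H n t q / lam \<beta> t ^ Suc n))"
    using r(1) sub by (intro frequency_balance)
  then show ?thesis by (simp only: phi_coeff_def mult.commute)
qed

lemma frequency_formula:
  assumes sub: "\<And>s. ln (lam \<beta> t) + (s - t) * \<alpha> \<le> ln (lam \<beta> s)"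
  shows "\<alpha> = 1 / F \<beta> t *
           (\<Sum>n. (real (\<Sum>i = 1..Suc n. quasi_greedy_digit \<beta> i) - 1)
                 * (real (quasi_greedy_digit \<beta> (Suc n)) * H n t q / lam \<beta> t ^ Suc n))"
proof -
  let ?p = "\<lambda>n. real (q n) * H n t q / lam \<beta> t ^ Suc n"
  obtain r where r: "1 < r" "summable (\<lambda>n. phi_coeff t n / lam \<beta> t ^ Suc n * r ^ n)"
    using phi_coeff_summable_beyond[of t] by blast
  have r': "summable (\<lambda>n. ?p n * r ^ n)"
    using r(2) by (simp only: phi_coeff_def)
  have balance: "(\<Sum>n. (\<Sum>i<n. real (q i)) * ?p n) = \<alpha> * (\<Sum>n. real (Suc n) * ?p n)"
    using phi_frequency_balance[OF sub] by (simp only: phi_coeff_def mult.commute)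
  have F: "F \<beta> t = (\<Sum>n. real (Suc n) * ?p n)"
    unfolding F_def quasi_greedy_digit_def diff_Suc_1 by (simp only: mult.assoc times_divide_eq_right)
  have "summable (\<lambda>n. ?p n * real (Suc n))"
    by (rule exp_series_derivative(1)[OF _ zero_less_one _ r(1) r']) auto
  then have sF: "summable (\<lambda>n. real (Suc n) * ?p n)" by (simp only: mult.commute)
  have "(\<Sum>n\<in>{0}. real (Suc n) * ?p n) \<le> F \<beta> t"
    unfolding F by (intro sum_le_suminf sF) auto
  moreover have "0 < (\<Sum>n\<in>{0}. real (Suc n) * ?p n)" by simp
  ultimately have "F \<beta> t \<noteq> 0" by linarith
  \<comment> \<open>If the last digit is 1, subtracting 1 removes it from the count; if it is 0, the
    factor \<open>?p n\<close> vanishes.\<close>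
  have num: "(real (\<Sum>i = 1..Suc n. quasi_greedy_digit \<beta> i) - 1) * (real (quasi_greedy_digit \<beta> (Suc n)) * H n t q / lam \<beta> t ^ Suc n)
      = (\<Sum>i<n. real (q i)) * ?p n" for n
  proof -
    have "(\<Sum>i = 1..Suc n. quasi_greedy_digit \<beta> i) = (\<Sum>i<Suc n. q i)"
      unfolding quasi_greedy_digit_def by (rule sum.reindex_bij_witness[of _ Suc "\<lambda>i. i - 1"]) auto
    then show ?thesis
      using q_digit[of n] by (auto simp: quasi_greedy_digit_def)
  qed
  show ?thesis
    unfolding num balance using \<open>F \<beta> t \<noteq> 0\<close> by (simp only: F[symmetric]) simp
qed

text \<open>The balance is applied to the finite greedy expansion x of 1. Exchanging the order of
  summation in the double sums gives the term \<open>?p k\<close> the weight k + 1 in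
  \<open>F_hat\<close>, and in the numerator the number of ones of x before position k.\<close>

lemma simple_frequency_formula:
  assumes sub: "\<And>s. ln (lam \<beta> t) + (s - t) * \<alpha> \<le> ln (lam \<beta> s)"
    and n0: "2 \<le> n0" and "\<beta> < 2" and simple: "(beta_map \<beta> ^^ (n0 - 1)) 1 = 1 / \<beta>"
  shows "\<alpha> = 1 / F_hat \<beta> t n0 *
           (\<Sum>l = 1..n0 - 1.
              real (greedy_digit \<beta> (l + 1) 1) * H l t (greedy_seq \<beta> 1) / lam \<beta> t ^ l *
              (\<Sum>n = 1..n0 - l. real (greedy_digit \<beta> (n + l) 1)
                   * H (n - 1) t ((shift ^^ l) (greedy_seq \<beta> 1)) / lam \<beta> t ^ n))"
proof -
  let ?g = "greedy_seq \<beta> 1"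
  define x where "x = (\<lambda>n. if n < n0 then ?g n else 0)"
  note se = simple_expansion[OF \<open>\<beta> < 2\<close> n0 simple]
  define m where "m = n0 - 1"
  have m: "n0 = Suc m" "0 < m" using n0 by (auto simp: m_def)
  note g = se(1)[folded m_def] and g_last = se(2)[folded m_def] and q_last = se(3)[folded m_def]
  have x_lt: "x n = q n" if "n < m" for n using that g m by (simp add: x_def)
  have x_m: "x m = 1" using g_last m by (simp add: x_def)
  have x_ge: "x n = 0" if "n \<ge> n0" for n using that by (simp add: x_def)
  have x_digit: "x n = 0 \<or> x n = 1" for n
  proof -
    consider "n < m" | "n = m" | "n \<ge> n0" using m by linarith
    then show ?thesis using x_lt[of n] q_digit[of n] x_m x_ge[of n] by cases auto
  qed
  have H_x: "H n s x = H n s q" if "n \<le> m" for n s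
    by (rule H_cong) (use that x_lt in auto)
  have one: "(\<lambda>n. real (x n) * H n s x / lam \<beta> s ^ Suc n) sums 1" for s
  proof -
    let ?a = "\<lambda>n. phi_coeff s n / lam \<beta> s ^ Suc n"
    \<comment> \<open>Periodicity makes the series of \<open>phi\<close> geometric in blocks of
      length \<open>n0\<close>, so the first block plus \<open>H n0 s q / lam \<beta> s ^ n0\<close>
      equals 1. The final greedy digit 1 contributes exactly this last summand.\<close>
    have shifted: "?a (n + n0) = ?a n * (H n0 s q / lam \<beta> s ^ n0)" for n
    proof -
      have "q (n + n0) = q n" using fun_cong[OF se(4), of n] by simp
      then have "phi_coeff s (n + n0) = phi_coeff s n * H n0 s q"
        using H_add[of n0 n s q] se(4) by (simp add: phi_coeff_def add.commute)
      then show ?thesis by (simp add: power_add)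
    qed
    have "(\<lambda>n. ?a (n + n0)) sums (1 * (H n0 s q / lam \<beta> s ^ n0))"
      unfolding shifted by (intro sums_mult2 phi_sums)
    then have "?a sums (1 * (H n0 s q / lam \<beta> s ^ n0) + (\<Sum>j<n0. ?a j))"
      by (subst sums_iff_shift[symmetric])
    then have "1 * (H n0 s q / lam \<beta> s ^ n0) + (\<Sum>j<n0. ?a j) = 1"
      using phi_sums sums_unique2 by blast
    moreover have "H n0 s q = H m s q" using q_last by (simp add: m H_Suc)
    moreover have "(\<Sum>j<n0. ?a j) = (\<Sum>j<m. ?a j)" using q_last by (simp add: m phi_coeff_def)
    ultimately have total: "(\<Sum>j<m. ?a j) + H m s q / lam \<beta> s ^ Suc m = 1" using m by simp
    have "(\<lambda>n. real (x n) * H n s x / lam \<beta> s ^ Suc n) sums (\<Sum>n<n0. real (x n) * H n s x / lam \<beta> s ^ Suc n)"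
      by (rule sums_finite) (use x_ge in auto)
    also have "(\<Sum>n<n0. real (x n) * H n s x / lam \<beta> s ^ Suc n) = (\<Sum>j<m. ?a j) + H m s q / lam \<beta> s ^ Suc m"
      unfolding m sum.lessThan_Suc using x_lt x_m H_x by (simp add: phi_coeff_def del: power_Suc)
    finally show ?thesis unfolding total .
  qed
  let ?p = "\<lambda>n. real (x n) * H n t x / lam \<beta> t ^ Suc n"
  have x_le: "x n \<le> Suc 0" for n using x_digit[of n] by auto
  \<comment> \<open>Only finitely many terms are nonzero, so any ratio above 1 can serve as
    r.\<close>
  have sm: "summable (\<lambda>n. ?p n * 2 ^ n)"
    by (rule summable_finite[of "{..<n0}"]) (use x_ge in auto)
  have r: "(1::real) < 2" by simp
  have balance: "(\<Sum>n. (\<Sum>i<n. real (x i)) * ?p n) = \<alpha> * (\<Sum>n. real (Suc n) * ?p n)"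
    by (rule frequency_balance[OF sub x_le one r sm])
  then have balance: "(\<Sum>n<n0. (\<Sum>i<n. real (x i)) * ?p n) = \<alpha> * (\<Sum>n<n0. real (Suc n) * ?p n)"
    using suminf_finite[of "{..<n0}" "\<lambda>n. (\<Sum>i<n. real (x i)) * ?p n"]
      suminf_finite[of "{..<n0}" "\<lambda>n. real (Suc n) * ?p n"] x_ge by (simp del: power_Suc of_nat_Suc)
  have block: "H l t ?g / lam \<beta> t ^ l * (\<Sum>n = 1..n0 - l. real (greedy_digit \<beta> (n + l) 1)
      * H (n - 1) t ((shift ^^ l) ?g) / lam \<beta> t ^ n) = (\<Sum>k\<in>{l..<n0}. ?p k)" if "l < n0" for l
  proof -
    have "(\<Sum>n = 1..n0 - l. H l t ?g / lam \<beta> t ^ l * (real (greedy_digit \<beta> (n + l) 1)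
      * H (n - 1) t ((shift ^^ l) ?g) / lam \<beta> t ^ n)) = (\<Sum>k\<in>{l..<n0}. ?p k)"
    proof (rule sum.reindex_bij_witness[of _ "\<lambda>k. Suc k - l" "\<lambda>n. n + l - 1"])
      fix n assume n: "n \<in> {1..n0 - l}"
      then obtain i where i: "n = Suc i" by (cases n) auto
      have k: "n + l - 1 = l + i" "l + i < n0" using i n by auto
      have "H (l + i) t x = H (l + i) t ?g" by (rule H_cong) (use k in \<open>auto simp: x_def\<close>)
      then have Hx: "H (l + i) t x = H l t ?g * H i t ((shift ^^ l) ?g)" by (simp only: H_add)
      have xg: "x (l + i) = greedy_digit \<beta> (n + l) 1"
        using k i by (simp add: x_def greedy_seq_def add.commute)
      have pow: "lam \<beta> t ^ Suc (l + i) = lam \<beta> t ^ l * lam \<beta> t ^ n"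
        unfolding i by (metis add_Suc_right power_add)
      have pred: "n - 1 = i" using i by simp
      show "?p (n + l - 1) = H l t ?g / lam \<beta> t ^ l * (real (greedy_digit \<beta> (n + l) 1)
          * H (n - 1) t ((shift ^^ l) ?g) / lam \<beta> t ^ n)"
        unfolding k(1) Hx xg pow pred times_divide_times_eq by (simp only: mult.left_commute)
    qed auto
    then show ?thesis by (simp only: sum_distrib_left)
  qed
  have F_hat: "F_hat \<beta> t n0 = (\<Sum>n<n0. real (Suc n) * ?p n)"
  proof -
    have "F_hat \<beta> t n0 = (\<Sum>l<n0. 1 * (\<Sum>k\<in>{l..<n0}. ?p k))"
      unfolding F_hat_def by (rule sum.cong) (use block m in auto)
    also have "\<dots> = (\<Sum>k<n0. ?p k * (\<Sum>l\<le>k. 1))" by (rule sum_triangle)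
    also have "\<dots> = (\<Sum>n<n0. real (Suc n) * ?p n)"
      by (intro sum.cong) (auto simp: mult.commute)
    finally show ?thesis .
  qed
  have num: "(\<Sum>l = 1..n0 - 1. real (greedy_digit \<beta> (l + 1) 1) * H l t ?g / lam \<beta> t ^ l *
      (\<Sum>n = 1..n0 - l. real (greedy_digit \<beta> (n + l) 1) * H (n - 1) t ((shift ^^ l) ?g) / lam \<beta> t ^ n))
      = (\<Sum>n<n0. (\<Sum>i<n. real (x i)) * ?p n)"
  proof -
    \<comment> \<open>The outer sum starts at l = 1 and leaves out the one at position 0. This
      balances the inclusion of position k itself, whose digit is 1 unless \<open>?p k\<close>
      vanishes.\<close>
    define a where "a l = (if l = 0 then 0 else real (x l))" for l
    have "(\<Sum>l = 1..n0 - 1. real (greedy_digit \<beta> (l + 1) 1) * H l t ?g / lam \<beta> t ^ l *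
      (\<Sum>n = 1..n0 - l. real (greedy_digit \<beta> (n + l) 1) * H (n - 1) t ((shift ^^ l) ?g) / lam \<beta> t ^ n))
      = (\<Sum>l = 1..n0 - 1. a l * (\<Sum>k\<in>{l..<n0}. ?p k))"
    proof (rule sum.cong[OF refl])
      fix l assume "l \<in> {1..n0 - 1}"
      then have l: "l < n0" "l \<noteq> 0" using m by auto
      then have "a l = real (greedy_digit \<beta> (l + 1) 1)"
        by (simp add: a_def x_def greedy_seq_def)
      then show "real (greedy_digit \<beta> (l + 1) 1) * H l t ?g / lam \<beta> t ^ l *
          (\<Sum>n = 1..n0 - l. real (greedy_digit \<beta> (n + l) 1) * H (n - 1) t ((shift ^^ l) ?g) / lam \<beta> t ^ n)
          = a l * (\<Sum>k\<in>{l..<n0}. ?p k)"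
        unfolding block[OF l(1), symmetric] by (simp only: mult.assoc[symmetric] times_divide_eq_right)
    qed
    also have "\<dots> = (\<Sum>l<n0. a l * (\<Sum>k\<in>{l..<n0}. ?p k))"
      by (rule sum.mono_neutral_left) (auto simp: a_def m)
    also have "\<dots> = (\<Sum>k<n0. ?p k * (\<Sum>l\<le>k. a l))" by (rule sum_triangle)
    also have "\<dots> = (\<Sum>n<n0. (\<Sum>i<n. real (x i)) * ?p n)"
    proof (rule sum.cong[OF refl])
      fix k
      have "x 0 = 1" using x_lt[of 0] m by simp
      moreover have "(\<Sum>l\<le>k. a l) = (\<Sum>l<Suc k. real (x l)) - real (x 0)"
        by (induction k) (simp_all add: a_def)
      ultimately show "?p k * (\<Sum>l\<le>k. a l) = (\<Sum>i<k. real (x i)) * ?p k"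
        using x_digit[of k] by auto
    qed
    finally show ?thesis .
  qed
  have "(\<Sum>n\<in>{0}. real (Suc n) * ?p n) \<le> F_hat \<beta> t n0"
    unfolding F_hat using m by (intro sum_mono2) auto
  moreover have "0 < (\<Sum>n\<in>{0}. real (Suc n) * ?p n)" using x_lt[of 0] m by simp
  ultimately have "F_hat \<beta> t n0 \<noteq> 0" by linarith
  then show ?thesis unfolding num balance by (simp only: F_hat[symmetric]) simp
qed

end

section \<open>Hausdorff dimension of the frequency sets\<close>

lemma hausdorff_dim_eqI:
  assumes "0 \<le> D"
    and pos: "\<And>s. 0 \<le> s \<Longrightarrow> s < D \<Longrightarrow> hausdorff_measure X d s A \<noteq> 0"
    and zero: "\<And>s. D < s \<Longrightarrow> hausdorff_measure X d s A = 0"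
  shows "hausdorff_dim X d A = ereal D"
  unfolding hausdorff_dim_def
proof (rule antisym)
  show "(INF s\<in>{s. 0 \<le> s \<and> hausdorff_measure X d s A = 0}. ereal s) \<le> ereal D"
  proof (rule ereal_le_epsilon2)
    fix e :: real assume "0 < e"
    then have "(INF s\<in>{s. 0 \<le> s \<and> hausdorff_measure X d s A = 0}. ereal s) \<le> ereal (D + e)"
      using zero[of "D + e"] \<open>0 \<le> D\<close> by (intro INF_lower) auto
    then show "(INF s\<in>{s. 0 \<le> s \<and> hausdorff_measure X d s A = 0}. ereal s) \<le> ereal D + ereal e"
      by simp
  qed
  show "ereal D \<le> (INF s\<in>{s. 0 \<le> s \<and> hausdorff_measure X d s A = 0}. ereal s)"
  proof (rule INF_greatest)
    fix s assume "s \<in> {s. 0 \<le> s \<and> hausdorff_measure X d s A = 0}"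
    then show "ereal D \<le> ereal s" using pos[of s] by (cases "s < D") auto
  qed
qed

section \<open>Diameters of cylinders, large deviations and covers\<close>

context beta_expansion
begin

abbreviation ones :: "nat \<Rightarrow> (nat \<Rightarrow> nat) \<Rightarrow> real" where
  "ones n x \<equiv> \<Sum>i<n. real (x i)"

lemma beta_dist_le: "(\<And>i. i < n \<Longrightarrow> x i = y i) \<Longrightarrow> beta_dist \<beta> x y \<le> 1 / \<beta> ^ n"
proof (cases "x = y")
  case False
  assume same: "\<And>i. i < n \<Longrightarrow> x i = y i"
  let ?k = "LEAST k. x k \<noteq> y k"
  have "\<exists>k. x k \<noteq> y k" using False by auto
  then have "x ?k \<noteq> y ?k" by (rule LeastI_ex)
  then have "n \<le> ?k" using same by (meson not_less)
  then have "\<beta> ^ n \<le> \<beta> ^ ?k" using beta_gt_1 by (intro power_increasing) auto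
  then show ?thesis using False beta_gt_1 by (simp add: beta_dist_def frac_le)
qed (use beta_gt_1 in \<open>simp add: beta_dist_def\<close>)

lemma beta_dist_eq: "x k \<noteq> y k \<Longrightarrow> (\<And>i. i < k \<Longrightarrow> x i = y i) \<Longrightarrow> beta_dist \<beta> x y = 1 / \<beta> ^ k"
proof -
  assume ne: "x k \<noteq> y k" and same: "\<And>i. i < k \<Longrightarrow> x i = y i"
  have "(LEAST k. x k \<noteq> y k) = k"
    using ne same by (intro Least_equality) (auto simp: not_less[symmetric])
  then show ?thesis using ne by (auto simp: beta_dist_def)
qed

lemma beta_dist_self [simp]: "beta_dist \<beta> x x = 0"
  by (simp add: beta_dist_def)

lemma beta_power_powr: "(1 / \<beta> ^ n) powr s = exp (- (real n * (s * ln \<beta>)))"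
proof -
  have "ln (1 / \<beta> ^ n) = - (real n * ln \<beta>)"
    using beta_gt_1 by (simp add: ln_div ln_realpow)
  then show ?thesis using beta_gt_1 by (simp add: powr_def mult_ac)
qed

lemma diam_power_cyl_le:
  assumes "0 < s"
  shows "diam_power (beta_dist \<beta>) s (cyl n v) \<le> exp (- (real n * (s * ln \<beta>)))"
proof (cases "cyl n v = {}")
  case False
  then obtain x where x: "x \<in> cyl n v" by blast
  have le: "beta_dist \<beta> y z \<le> 1 / \<beta> ^ n" if "y \<in> cyl n v" "z \<in> cyl n v" for y z
    using that by (intro beta_dist_le) (simp add: cyl_def)
  have diam: "diam (beta_dist \<beta>) (cyl n v) = (SUP (y, z)\<in>cyl n v \<times> cyl n v. beta_dist \<beta> y z)"
    using False by (simp add: diam_def)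
  have "diam (beta_dist \<beta>) (cyl n v) \<le> 1 / \<beta> ^ n"
    unfolding diam using x le by (intro cSUP_least) auto
  moreover have "0 \<le> diam (beta_dist \<beta>) (cyl n v)"
  proof -
    have "(\<lambda>(y, z). beta_dist \<beta> y z) (x, x) \<le> diam (beta_dist \<beta>) (cyl n v)"
      unfolding diam using x le by (intro cSUP_upper bdd_aboveI2[where M = "1 / \<beta> ^ n"]) auto
    then show ?thesis by simp
  qed
  ultimately have "diam (beta_dist \<beta>) (cyl n v) powr s \<le> (1 / \<beta> ^ n) powr s"
    using assms by (intro powr_mono2) auto
  then show ?thesis using assms False by (simp add: diam_power_def beta_power_powr)
qed (simp add: diam_power_def)

text \<open>The pressure is differentiable at \<open>t\<close> with derivative \<open>\<alpha>\<close>; a one-sided consequence suffices.\<close>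

lemma pressure_sum_tilted_le:
  assumes sub: "\<And>s. ln (lam \<beta> t) + (s - t) * \<alpha> \<le> ln (lam \<beta> s)"
    and \<sigma>: "\<bar>\<sigma>\<bar> = 1" and e: "0 < e"
  obtains \<delta> C where "0 < \<delta>" "0 < C"
    "\<And>N. pressure_sum N (t + \<sigma> * \<delta>) \<le> C * exp (real N * (ln (lam \<beta> t) + \<delta> * (\<sigma> * \<alpha> + e)))"
proof -
  let ?p = "\<lambda>n. phi_coeff t n / lam \<beta> t ^ Suc n"
  let ?h = "\<lambda>n. H n t q / lam \<beta> t ^ n"
  \<comment> \<open>The slope allowed for the pressure in the direction \<sigma>. The exponents b
    and b' describe the series of \<open>phi\<close> and of \<open>H\<close> along the line of this
    slope through \<open>ln (lam \<beta> t)\<close>.\<close>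
  define c where "c = \<sigma> * \<alpha> + e"
  define b where "b n = \<sigma> * ones n q - real (Suc n) * c" for n
  define b' where "b' n = \<sigma> * ones n q - real n * c" for n
  obtain r where r: "1 < r" "summable (\<lambda>n. H n t q * (r / lam \<beta> t) ^ n)" "summable (\<lambda>n. ?p n * r ^ n)"
    using phi_coeff_summable_beyond[of t] by blast
  have r': "summable (\<lambda>n. ?h n * r ^ n)"
    using r(2) by (simp add: power_divide)
  have p_nonneg: "0 \<le> ?p n" and h_nonneg: "0 \<le> ?h n" for n by (simp_all del: power_Suc)
  have ones_bound: "\<bar>\<sigma> * ones n q\<bar> \<le> real (Suc n)" for n
    using sum_q_le[of n] \<sigma> by (simp add: abs_mult sum_nonneg abs_of_nonneg)
  have K0: "0 < 1 + \<bar>c\<bar>" by simp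
  have K: "\<bar>b n\<bar> \<le> (1 + \<bar>c\<bar>) * real (Suc n)" for n
  proof -
    have "\<bar>b n\<bar> \<le> \<bar>\<sigma> * ones n q\<bar> + \<bar>real (Suc n) * c\<bar>" unfolding b_def by (rule abs_triangle_ineq4)
    also have "\<dots> \<le> real (Suc n) + real (Suc n) * \<bar>c\<bar>"
      using ones_bound[of n] by (simp add: abs_mult)
    finally show ?thesis by (simp add: algebra_simps)
  qed
  have K': "\<bar>b' n\<bar> \<le> (1 + \<bar>c\<bar>) * real (Suc n)" for n
  proof -
    have "\<bar>b' n\<bar> \<le> \<bar>\<sigma> * ones n q\<bar> + \<bar>real n * c\<bar>" unfolding b'_def by (rule abs_triangle_ineq4)
    also have "\<dots> \<le> real (Suc n) + real (Suc n) * \<bar>c\<bar>"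
      using ones_bound[of n] by (auto simp: abs_mult intro!: add_mono mult_right_mono)
    finally show ?thesis by (simp add: algebra_simps)
  qed
  note dp = exp_series_derivative[OF p_nonneg K0 K r(1) r(3)]
  note dh = exp_series_derivative(3)[OF h_nonneg K0 K' r(1) r']
  have sS: "summable (\<lambda>n. ?p n * ones n q)"
    by (rule exp_series_derivative(1)[OF p_nonneg zero_less_one _ r(1) r(3)])
       (use ones_bound \<sigma> in \<open>simp add: abs_mult\<close>)
  have sB: "summable (\<lambda>n. ?p n * real (Suc n))"
    by (rule exp_series_derivative(1)[OF p_nonneg zero_less_one _ r(1) r(3)]) simp
  note balance = phi_frequency_balance[OF sub]
  \<comment> \<open>The balance of ones cancels the part of the derivative that contains \<alpha>,
    and only the margin e is left. The derivative is thus negative, and \<open>phi\<close> along the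
    line falls below 1 for small \<delta> > 0.\<close>
  have "(\<Sum>n. ?p n * b n) = - e * (\<Sum>n. ?p n * real (Suc n))"
  proof -
    have "(\<lambda>n. ?p n * ones n q * \<sigma> - ?p n * real (Suc n) * c)
        sums ((\<Sum>n. ?p n * ones n q) * \<sigma> - (\<Sum>n. ?p n * real (Suc n)) * c)"
      by (intro sums_diff sums_mult2 summable_sums sS sB)
    moreover have "?p n * ones n q * \<sigma> - ?p n * real (Suc n) * c = ?p n * b n" for n
      unfolding b_def right_diff_distrib by (simp only: mult_ac)
    ultimately have "(\<Sum>n. ?p n * b n) = (\<Sum>n. ?p n * ones n q) * \<sigma> - (\<Sum>n. ?p n * real (Suc n)) * c"
      by (simp only: sums_iff)
    then show ?thesis unfolding balance c_def by (simp add: algebra_simps)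
  qed
  moreover have "0 < (\<Sum>n. ?p n * real (Suc n))"
  proof -
    have "(\<Sum>n\<in>{0}. ?p n * real (Suc n)) \<le> (\<Sum>n. ?p n * real (Suc n))"
      by (intro sum_le_suminf sB) auto
    moreover have "0 < (\<Sum>n\<in>{0}. ?p n * real (Suc n))" by simp
    ultimately show ?thesis by linarith
  qed
  ultimately have neg: "(\<Sum>n. ?p n * b n) < 0" using e by simp
  obtain d1 where d1: "0 < d1" "\<And>h. 0 < h \<Longrightarrow> h < d1 \<Longrightarrow>
      (\<Sum>n. ?p n * exp ((0 + h) * b n)) < (\<Sum>n. ?p n * exp (0 * b n))"
    using DERIV_neg_dec_right[OF dp(2) neg] by blast
  obtain d2 where d2: "0 < d2" "\<And>x. \<bar>x\<bar> < d2 \<Longrightarrow> summable (\<lambda>n. ?p n * exp (x * b n))"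
    using dp(3) by blast
  obtain d3 where d3: "0 < d3" "\<And>x. \<bar>x\<bar> < d3 \<Longrightarrow> summable (\<lambda>n. ?h n * exp (x * b' n))"
    using dh by blast
  define \<delta> where "\<delta> = min d1 (min d2 d3) / 2"
  have \<delta>: "0 < \<delta>" "\<delta> < d1" "\<bar>\<delta>\<bar> < d2" "\<bar>\<delta>\<bar> < d3"
    using d1(1) d2(1) d3(1) by (auto simp: \<delta>_def)
  define z where "z = exp (- (ln (lam \<beta> t) + \<delta> * c))"
  have z: "0 < z" by (simp add: z_def)
  have tilt: "H n (t + \<sigma> * \<delta>) q * z ^ k = H n t q / lam \<beta> t ^ k * exp (\<delta> * (\<sigma> * ones n q - real k * c))" for n k
  proof -
    have lam: "lam \<beta> t ^ k = exp (real k * ln (lam \<beta> t))"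
      by (simp only: exp_of_nat_mult exp_ln lam_pos)
    have zk: "z ^ k = exp (real k * (- (ln (lam \<beta> t) + \<delta> * c)))"
      unfolding z_def by (simp only: exp_of_nat_mult)
    have "(t + \<sigma> * \<delta>) * ones n q + real k * (- (ln (lam \<beta> t) + \<delta> * c))
        = t * ones n q - real k * ln (lam \<beta> t) + \<delta> * (\<sigma> * ones n q - real k * c)"
      by (simp add: algebra_simps)
    then show ?thesis unfolding lam zk H_def by (simp only: exp_add[symmetric] exp_diff[symmetric])
  qed
  have tilt_phi: "phi_coeff (t + \<sigma> * \<delta>) n * z ^ Suc n = ?p n * exp (\<delta> * b n)" for n
    unfolding phi_coeff_def b_def mult.assoc tilt by (simp only: times_divide_eq_right times_divide_eq_left mult.assoc)
  have one: "(\<Sum>n. ?p n * exp (0 * b n)) = 1"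
    using phi_sums[of t] by (simp add: sums_iff)
  have "(\<Sum>j<N. phi_coeff (t + \<sigma> * \<delta>) j * z ^ Suc j) \<le> 1" for N
  proof -
    have "(\<Sum>j<N. ?p j * exp (\<delta> * b j)) \<le> (\<Sum>j. ?p j * exp (\<delta> * b j))"
      using d2(2)[OF \<delta>(3)] by (intro sum_le_suminf) (auto simp del: power_Suc)
    also have "\<dots> \<le> 1" using d1(2)[OF \<delta>(1,2)] unfolding one by simp
    finally show ?thesis unfolding tilt_phi .
  qed
  note P = pressure_sum_le[OF z this]
  define C where "C = 1 + (\<Sum>n. ?h n * exp (\<delta> * b' n))"
  have "0 < C"
    unfolding C_def by (intro add_pos_nonneg suminf_nonneg d3(2)[OF \<delta>(4)]) auto
  have "pressure_sum N (t + \<sigma> * \<delta>) \<le> C * exp (real N * (ln (lam \<beta> t) + \<delta> * (\<sigma> * \<alpha> + e)))" for N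
  proof -
    have "pressure_sum N (t + \<sigma> * \<delta>) * z ^ N \<le> (\<Sum>n\<le>N. H n (t + \<sigma> * \<delta>) q * z ^ n)" by (rule P)
    also have "\<dots> = (\<Sum>n\<le>N. ?h n * exp (\<delta> * b' n))" unfolding tilt b'_def ..
    also have "\<dots> \<le> (\<Sum>n. ?h n * exp (\<delta> * b' n))"
      using d3(2)[OF \<delta>(4)] by (intro sum_le_suminf) auto
    also have "\<dots> \<le> C" by (simp add: C_def)
    finally have "pressure_sum N (t + \<sigma> * \<delta>) \<le> C * (1 / z ^ N)"
      using z by (simp add: field_simps)
    moreover have "1 / z ^ N = exp (real N * (ln (lam \<beta> t) + \<delta> * (\<sigma> * \<alpha> + e)))"
    proof -
      have "z ^ N = exp (- (real N * (ln (lam \<beta> t) + \<delta> * (\<sigma> * \<alpha> + e))))"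
        unfolding z_def c_def exp_of_nat_mult[symmetric] by (simp only: mult_minus_right)
      then show ?thesis by (simp only: exp_minus inverse_eq_divide) simp
    qed
    ultimately show ?thesis by simp
  qed
  then show ?thesis using that[OF \<delta>(1) \<open>0 < C\<close>] by blast
qed

text \<open>A Chernoff bound: tilting by \<open>\<sigma> * \<delta>\<close> raises the weight of a
  deviating word by at least \<open>exp (n * \<delta> * (\<sigma> * \<alpha> + 2 * e))\<close>,
  whereas the bound for the partition sum rises only by
  \<open>exp (n * \<delta> * (\<sigma> * \<alpha> + e))\<close>. The quotient is
  \<open>\<rho> ^ n\<close>.\<close>

lemma gibbs_deviation:
  assumes sub: "\<And>s. ln (lam \<beta> t) + (s - t) * \<alpha> \<le> ln (lam \<beta> s)"
    and \<sigma>: "\<bar>\<sigma>\<bar> = 1" and e: "0 < e"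
  obtains D \<rho> where "0 < \<rho>" "\<rho> < 1"
    "\<And>n. measure (gibbs t) {x \<in> X. 2 * e * real n \<le> \<sigma> * (ones n x - real n * \<alpha>)} \<le> D * \<rho> ^ n"
proof -
  obtain \<delta> C where \<delta>: "0 < \<delta>" "0 < C"
    "\<And>N. pressure_sum N (t + \<sigma> * \<delta>) \<le> C * exp (real N * (ln (lam \<beta> t) + \<delta> * (\<sigma> * \<alpha> + e)))"
    using pressure_sum_tilted_le[OF sub \<sigma> e] by blast
  obtain C' where C': "1 \<le> C'" "\<And>n x. measure (gibbs t) (cyl n x) \<le> C' * (H n t x / lam \<beta> t ^ n)"
    using gibbs_cyl_le[of t] by blast
  interpret G: shift_measure \<beta> "gibbs t"
    by unfold_locales (rule gibbs_invariant)
  define \<rho> where "\<rho> = exp (- (\<delta> * e))"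
  have "measure (gibbs t) {x \<in> X. 2 * e * real n \<le> \<sigma> * (ones n x - real n * \<alpha>)} \<le> C' * C * \<rho> ^ n" for n
  proof -
    define W where "W = {v \<in> words n. 2 * e * real n \<le> \<sigma> * (ones n v - real n * \<alpha>)}"
    have fin: "finite W" by (simp add: W_def)
    have ones_trunc: "ones n (trunc n x) = ones n x" for x
      by (intro sum.cong) (auto simp: trunc_def)
    have "{x \<in> X. 2 * e * real n \<le> \<sigma> * (ones n x - real n * \<alpha>)} \<subseteq> (\<Union>v\<in>W. cyl n v)"
    proof
      fix x assume x: "x \<in> {x \<in> X. 2 * e * real n \<le> \<sigma> * (ones n x - real n * \<alpha>)}"
      then have "trunc n x \<in> W" using trunc_in_words[of x n] by (simp add: W_def ones_trunc)
      moreover have "x \<in> cyl n (trunc n x)" using x by (simp add: cyl_def trunc_def)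
      ultimately show "x \<in> (\<Union>v\<in>W. cyl n v)" by blast
    qed
    then have "G.prob {x \<in> X. 2 * e * real n \<le> \<sigma> * (ones n x - real n * \<alpha>)} \<le> G.prob (\<Union>v\<in>W. cyl n v)"
      by (rule G.finite_measure_mono) (intro sets.finite_UN fin, simp add: cyl_sets)
    also have "\<dots> \<le> (\<Sum>v\<in>W. G.prob (cyl n v))"
      by (intro measure_UNION_le fin) (simp add: cyl_sets)
    also have "\<dots> \<le> (\<Sum>v\<in>W. C' * (H n (t + \<sigma> * \<delta>) v * exp (- (real n * (ln (lam \<beta> t) + \<delta> * (\<sigma> * \<alpha> + 2 * e))))))"
    proof (rule sum_mono)
      fix v assume "v \<in> W"
      then have dev: "2 * e * real n \<le> \<sigma> * (ones n v - real n * \<alpha>)" by (simp add: W_def)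
      have "\<delta> * (2 * e * real n) \<le> \<delta> * (\<sigma> * (ones n v - real n * \<alpha>))"
        using dev \<delta>(1) by (intro mult_left_mono) auto
      then have "t * ones n v - real n * ln (lam \<beta> t)
          \<le> (t + \<sigma> * \<delta>) * ones n v + - (real n * (ln (lam \<beta> t) + \<delta> * (\<sigma> * \<alpha> + 2 * e)))"
        by (simp add: algebra_simps)
      then have "exp (t * ones n v - real n * ln (lam \<beta> t))
          \<le> exp ((t + \<sigma> * \<delta>) * ones n v + - (real n * (ln (lam \<beta> t) + \<delta> * (\<sigma> * \<alpha> + 2 * e))))"
        by simp
      moreover have "lam \<beta> t ^ n = exp (real n * ln (lam \<beta> t))"
        by (simp only: exp_of_nat_mult exp_ln lam_pos)
      ultimately have "H n t v / lam \<beta> t ^ n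
          \<le> H n (t + \<sigma> * \<delta>) v * exp (- (real n * (ln (lam \<beta> t) + \<delta> * (\<sigma> * \<alpha> + 2 * e))))"
        unfolding H_def by (simp only: exp_diff exp_add)
      then have "C' * (H n t v / lam \<beta> t ^ n)
          \<le> C' * (H n (t + \<sigma> * \<delta>) v * exp (- (real n * (ln (lam \<beta> t) + \<delta> * (\<sigma> * \<alpha> + 2 * e)))))"
        using C'(1) by (intro mult_left_mono) auto
      then show "G.prob (cyl n v)
          \<le> C' * (H n (t + \<sigma> * \<delta>) v * exp (- (real n * (ln (lam \<beta> t) + \<delta> * (\<sigma> * \<alpha> + 2 * e)))))"
        using C'(2)[of n v] by linarith
    qed
    also have "\<dots> = C' * exp (- (real n * (ln (lam \<beta> t) + \<delta> * (\<sigma> * \<alpha> + 2 * e)))) * (\<Sum>v\<in>W. H n (t + \<sigma> * \<delta>) v)"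
      unfolding sum_distrib_left by (intro sum.cong refl) (simp only: mult_ac)
    also have "\<dots> \<le> C' * exp (- (real n * (ln (lam \<beta> t) + \<delta> * (\<sigma> * \<alpha> + 2 * e))))
        * (C * exp (real n * (ln (lam \<beta> t) + \<delta> * (\<sigma> * \<alpha> + e))))"
    proof (rule mult_left_mono)
      have "(\<Sum>v\<in>W. H n (t + \<sigma> * \<delta>) v) \<le> pressure_sum n (t + \<sigma> * \<delta>)"
        unfolding pressure_sum_def by (intro sum_mono2) (auto simp: W_def)
      also note \<delta>(3)[of n]
      finally show "(\<Sum>v\<in>W. H n (t + \<sigma> * \<delta>) v) \<le> C * exp (real n * (ln (lam \<beta> t) + \<delta> * (\<sigma> * \<alpha> + e)))" .
    qed (use C'(1) in simp)
    also have "\<dots> = C' * C * (exp (- (real n * (ln (lam \<beta> t) + \<delta> * (\<sigma> * \<alpha> + 2 * e))))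
        * exp (real n * (ln (lam \<beta> t) + \<delta> * (\<sigma> * \<alpha> + e))))"
      by (simp only: mult_ac)
    also have "exp (- (real n * (ln (lam \<beta> t) + \<delta> * (\<sigma> * \<alpha> + 2 * e))))
        * exp (real n * (ln (lam \<beta> t) + \<delta> * (\<sigma> * \<alpha> + e))) = \<rho> ^ n"
    proof -
      have "- (real n * (ln (lam \<beta> t) + \<delta> * (\<sigma> * \<alpha> + 2 * e))) + real n * (ln (lam \<beta> t) + \<delta> * (\<sigma> * \<alpha> + e))
          = real n * (- (\<delta> * e))"
        by (simp add: algebra_simps)
      then have "exp (- (real n * (ln (lam \<beta> t) + \<delta> * (\<sigma> * \<alpha> + 2 * e))))
          * exp (real n * (ln (lam \<beta> t) + \<delta> * (\<sigma> * \<alpha> + e))) = exp (real n * (- (\<delta> * e)))"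
        by (simp only: exp_add[symmetric])
      then show ?thesis by (simp only: \<rho>_def exp_of_nat_mult)
    qed
    finally show ?thesis .
  qed
  moreover have "0 < \<rho>" "\<rho> < 1" using \<delta>(1) e by (simp_all add: \<rho>_def)
  ultimately show ?thesis using that by blast
qed

text \<open>The deviations in both directions, \<sigma> = 1 and \<sigma> = -1, have geometrically
  decaying probabilities, so the Borel-Cantelli lemma applies to each.\<close>

lemma gibbs_AE_close:
  assumes sub: "\<And>s. ln (lam \<beta> t) + (s - t) * \<alpha> \<le> ln (lam \<beta> s)" and e: "0 < e"
  shows "AE x in gibbs t. \<forall>\<^sub>F n in sequentially. \<bar>ones n x - real n * \<alpha>\<bar> \<le> e * real n"
proof -
  interpret G: shift_measure \<beta> "gibbs t"
    by unfold_locales (rule gibbs_invariant)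
  have one_sided: "AE x in gibbs t. \<forall>\<^sub>F n in sequentially. \<sigma> * (ones n x - real n * \<alpha>) \<le> e * real n"
    if \<sigma>: "\<bar>\<sigma>\<bar> = 1" for \<sigma>
  proof -
    define A where "A n = {x \<in> X. 2 * (e / 2) * real n \<le> \<sigma> * (ones n x - real n * \<alpha>)}" for n
    have e2: "0 < e / 2" using e by simp
    obtain D \<rho> where D: "0 < \<rho>" "\<rho> < 1" "\<And>n. G.prob (A n) \<le> D * \<rho> ^ n"
      unfolding A_def using gibbs_deviation[OF sub \<sigma> e2] by blast
    have A: "A n \<in> sets (gibbs t)" for n
    proof -
      have "simple_function (gibbs t) (\<lambda>x. 2 * (e / 2) * real n \<le> \<sigma> * (ones n x - real n * \<alpha>))"
      proof (rule G.simple_function_determined[of n])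
        fix x y assume "trunc n x = trunc n y"
        then have "ones n x = ones n y" by (intro sum.cong) (auto simp: trunc_eq_iff)
        then show "(2 * (e / 2) * real n \<le> \<sigma> * (ones n x - real n * \<alpha>))
            = (2 * (e / 2) * real n \<le> \<sigma> * (ones n y - real n * \<alpha>))" by simp
      qed
      from simple_functionD(2)[OF this, of "{True}"] show ?thesis
        by (simp add: A_def vimage_def Int_def conj_commute)
    qed
    have "summable (\<lambda>n. G.prob (A n))"
    proof (rule summable_comparison_test'[of "\<lambda>n. D * \<rho> ^ n" 0])
      show "summable (\<lambda>n. D * \<rho> ^ n)" using D(1,2) by (intro summable_mult summable_geometric) simp
    qed (use D(3) in simp)
    then have "AE x in gibbs t. \<forall>\<^sub>F n in sequentially. x \<in> space (gibbs t) - A n"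
      using A by (intro borel_cantelli_AE1) (auto simp: G.emeasure_eq_measure)
    then show ?thesis
    proof (rule AE_mp, intro AE_I2 impI)
      fix x assume "\<forall>\<^sub>F n in sequentially. x \<in> space (gibbs t) - A n"
      then show "\<forall>\<^sub>F n in sequentially. \<sigma> * (ones n x - real n * \<alpha>) \<le> e * real n"
        by (rule eventually_mono) (auto simp: A_def)
    qed
  qed
  show ?thesis
    using one_sided[OF abs_1] one_sided[OF abs_neg_one]
  proof eventually_elim
    case (elim x)
    then show ?case by eventually_elim (simp add: abs_le_iff)
  qed
qed

lemma gibbs_AE_frequency:
  assumes sub: "\<And>s. ln (lam \<beta> t) + (s - t) * \<alpha> \<le> ln (lam \<beta> s)"
  shows "AE x in gibbs t. x \<in> frequency_set \<beta> \<alpha>"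
proof -
  have "AE x in gibbs t. \<forall>j. \<forall>\<^sub>F n in sequentially. \<bar>ones n x - real n * \<alpha>\<bar> \<le> 1 / real (Suc j) * real n"
    unfolding AE_all_countable by (intro allI gibbs_AE_close sub) simp
  then show ?thesis
  proof (rule AE_mp, intro AE_I2 impI)
    fix x assume x: "x \<in> space (gibbs t)"
      and close: "\<forall>j. \<forall>\<^sub>F n in sequentially. \<bar>ones n x - real n * \<alpha>\<bar> \<le> 1 / real (Suc j) * real n"
    have "(\<lambda>n. ones n x / real n) \<longlonglongrightarrow> \<alpha>"
    proof (rule tendstoI)
      fix e :: real assume "0 < e"
      then obtain j where j: "1 / real (Suc j) < e" using nat_approx_posE by blast
      have "\<forall>\<^sub>F n in sequentially. \<bar>ones n x - real n * \<alpha>\<bar> \<le> 1 / real (Suc j) * real n \<and> 0 < n"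
        using close eventually_gt_at_top by (intro eventually_conj) auto
      then show "\<forall>\<^sub>F n in sequentially. dist (ones n x / real n) \<alpha> < e"
      proof (rule eventually_mono)
        fix n assume n: "\<bar>ones n x - real n * \<alpha>\<bar> \<le> 1 / real (Suc j) * real n \<and> 0 < n"
        have "ones n x / real n - \<alpha> = (ones n x - real n * \<alpha>) / real n"
          using n by (simp add: field_simps)
        then have "dist (ones n x / real n) \<alpha> = \<bar>ones n x - real n * \<alpha>\<bar> / real n"
          by (simp add: dist_real_def)
        also have "\<dots> \<le> 1 / real (Suc j)" using n by (simp add: pos_divide_le_eq del: of_nat_Suc)
        finally show "dist (ones n x / real n) \<alpha> < e" using j by linarith
      qed
    qed
    then show "x \<in> frequency_set \<beta> \<alpha>" using x by (simp add: frequency_set_def)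
  qed
qed

lemma frequency_set_hausdorff_pos:
  assumes sub: "\<And>s. ln (lam \<beta> t) + (s - t) * \<alpha> \<le> ln (lam \<beta> s)"
    and s: "0 \<le> s" "s * ln \<beta> < ln (lam \<beta> t) - t * \<alpha>"
  shows "hausdorff_measure X (beta_dist \<beta>) s (frequency_set \<beta> \<alpha>) \<noteq> 0"
proof -
  interpret G: shift_measure \<beta> "gibbs t"
    by unfold_locales (rule gibbs_invariant)
  \<comment> \<open>The surplus of the dimension over s is divided so that a frequency error e costs
    \<open>\<bar>t\<bar> * e\<close> in the exponent and e remains:
    \<open>\<eta> = s * ln \<beta> + e\<close>.\<close>
  define e where "e = (ln (lam \<beta> t) - t * \<alpha> - s * ln \<beta>) / (\<bar>t\<bar> + 1)"
  define \<eta> where "\<eta> = ln (lam \<beta> t) - t * \<alpha> - \<bar>t\<bar> * e"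
  have e: "0 < e" unfolding e_def using s(2) by (intro divide_pos_pos) auto
  have "e * (\<bar>t\<bar> + 1) = ln (lam \<beta> t) - t * \<alpha> - s * ln \<beta>"
    unfolding e_def by (rule nonzero_eq_divide_eq[THEN iffD1]) auto
  then have "\<eta> = s * ln \<beta> + e" by (simp add: \<eta>_def algebra_simps)
  then have \<eta>: "s * ln \<beta> < \<eta>" "0 < \<eta>"
    using e s(1) beta_gt_1 by (auto intro: add_nonneg_pos)
  obtain C where C: "1 \<le> C" "\<And>n x. G.prob (cyl n x) \<le> C * (H n t x / lam \<beta> t ^ n)"
    using gibbs_cyl_le[of t] by blast
  \<comment> \<open>Fixing the time from which the frequency is accurate makes the bound for
    cylinders uniform over the set.\<close>
  define E where "E N = {x \<in> X. \<forall>n\<ge>N. \<bar>ones n x - real n * \<alpha>\<bar> \<le> e * real n}" for N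
  have E: "E N \<in> sets (gibbs t)" for N
  proof -
    have "{x \<in> X. \<bar>ones n x - real n * \<alpha>\<bar> \<le> e * real n} \<in> sets (gibbs t)" for n
    proof -
      have "simple_function (gibbs t) (\<lambda>x. \<bar>ones n x - real n * \<alpha>\<bar> \<le> e * real n)"
      proof (rule G.simple_function_determined[of n])
        fix x y assume "trunc n x = trunc n y"
        then have "ones n x = ones n y" by (intro sum.cong) (auto simp: trunc_eq_iff)
        then show "(\<bar>ones n x - real n * \<alpha>\<bar> \<le> e * real n) = (\<bar>ones n y - real n * \<alpha>\<bar> \<le> e * real n)" by simp
      qed
      from simple_functionD(2)[OF this, of "{True}"] show ?thesis
        by (simp add: vimage_def Int_def conj_commute)
    qed
    moreover have "E N = (\<Inter>n\<in>{N..}. {x \<in> X. \<bar>ones n x - real n * \<alpha>\<bar> \<le> e * real n})"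
      by (auto simp: E_def)
    moreover have "(\<Inter>n\<in>{N..}. {x \<in> X. \<bar>ones n x - real n * \<alpha>\<bar> \<le> e * real n}) \<in> sets (gibbs t)"
      by (rule sets.countable_INT') (use calculation(1) in auto)
    ultimately show ?thesis by (simp only:)
  qed
  have "AE x in gibbs t. x \<in> frequency_set \<beta> \<alpha> \<and> (\<exists>N. x \<in> E N)"
    using gibbs_AE_frequency[OF sub] gibbs_AE_close[OF sub e] AE_space
  proof eventually_elim
    case (elim x)
    then show ?case by (auto simp: E_def eventually_sequentially)
  qed
  \<comment> \<open>Removing a measurable null set puts \<open>E N - Z\<close> inside the frequency
    set and keeps it measurable.\<close>
  then obtain Z where Z: "{x \<in> space (gibbs t). \<not> (x \<in> frequency_set \<beta> \<alpha> \<and> (\<exists>N. x \<in> E N))} \<subseteq> Z"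
    "Z \<in> sets (gibbs t)" "emeasure (gibbs t) Z = 0"
    by (rule AE_E) auto
  define A where "A N = E N - Z" for N
  have A: "A N \<in> sets (gibbs t)" for N unfolding A_def by (intro sets.Diff E Z(2))
  have A_freq: "A N \<subseteq> frequency_set \<beta> \<alpha>" for N
    using Z(1) by (auto simp: A_def E_def)
  have "\<exists>N. emeasure (gibbs t) (A N) \<noteq> 0"
  proof (rule ccontr)
    assume "\<nexists>N. emeasure (gibbs t) (A N) \<noteq> 0"
    then have zero: "emeasure (gibbs t) (\<Union>N. A N) = 0"
      using A by (intro emeasure_UN_eq_0) auto
    have "space (gibbs t) \<subseteq> (\<Union>N. A N) \<union> Z" using Z(1) by (auto simp: A_def)
    then have "emeasure (gibbs t) (space (gibbs t)) \<le> emeasure (gibbs t) ((\<Union>N. A N) \<union> Z)"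
      using A Z(2) by (intro emeasure_mono sets.Un sets.countable_UN) auto
    also have "\<dots> \<le> emeasure (gibbs t) (\<Union>N. A N) + emeasure (gibbs t) Z"
      using A Z(2) by (intro emeasure_subadditive sets.countable_UN) auto
    finally show False using zero Z(3) G.emeasure_space_1 by simp
  qed
  then obtain N where N: "emeasure (gibbs t) (A N) \<noteq> 0" by blast
  have pA: "0 < G.prob (A N)"
    using N by (simp add: G.emeasure_eq_measure zero_less_measure_iff)
  have cyl_small: "G.prob (cyl k x) \<le> C * exp (- (real k * \<eta>))" if "x \<in> E N" "k \<ge> N" for x k
  proof -
    have "\<bar>ones k x - real k * \<alpha>\<bar> \<le> e * real k" using that by (auto simp: E_def)
    then have "\<bar>t * (ones k x - real k * \<alpha>)\<bar> \<le> \<bar>t\<bar> * (e * real k)"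
      unfolding abs_mult by (intro mult_left_mono) auto
    then have "t * (ones k x - real k * \<alpha>) \<le> \<bar>t\<bar> * (e * real k)" by linarith
    then have "t * ones k x - real k * ln (lam \<beta> t) \<le> - (real k * \<eta>)"
      by (simp add: \<eta>_def algebra_simps)
    then have "exp (t * ones k x - real k * ln (lam \<beta> t)) \<le> exp (- (real k * \<eta>))" by simp
    moreover have "lam \<beta> t ^ k = exp (real k * ln (lam \<beta> t))"
      by (simp only: exp_of_nat_mult exp_ln lam_pos)
    ultimately have "H k t x / lam \<beta> t ^ k \<le> exp (- (real k * \<eta>))"
      unfolding H_def by (simp only: exp_diff)
    then have "C * (H k t x / lam \<beta> t ^ k) \<le> C * exp (- (real k * \<eta>))"
      using C(1) by (intro mult_left_mono) auto
    then show ?thesis using C(2)[of k x] by linarith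
  qed
  \<comment> \<open>The members of a cover are arbitrary sets, so each is enclosed in a measurable
    one, a cylinder or an intersection of cylinders, whose measure its diameter controls.\<close>
  have piece: "\<exists>V. V \<in> sets (gibbs t) \<and> U \<inter> A N \<subseteq> V \<and> G.prob V \<le> C * diam_power (beta_dist \<beta>) s U"
    if U: "U \<subseteq> X" "\<forall>x\<in>U. \<forall>y\<in>U. beta_dist \<beta> x y \<le> 1 / \<beta> ^ N" for U
  proof (cases "U \<inter> A N = {}")
    case True
    have "0 \<le> diam_power (beta_dist \<beta>) s U" by (simp add: diam_power_def)
    then show ?thesis using True C(1) by (intro exI[of _ "{}"]) auto
  next
    case False
    then obtain x where x: "x \<in> U" "x \<in> A N" by blast
    then have xE: "x \<in> E N" by (simp add: A_def)
    show ?thesis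
    proof (cases "U = {x}")
      \<comment> \<open>A single point has diameter 0; the intersection of its cylinders has measure
        0 because the bounds tend to 0.\<close>
      case True
      let ?V = "\<Inter>k\<in>{N..}. cyl k x"
      have V: "?V \<in> sets (gibbs t)" by (rule sets.countable_INT') (auto simp: cyl_sets)
      have "G.prob ?V \<le> C * exp (- (real k * \<eta>))" if "k \<ge> N" for k
      proof -
        have "G.prob ?V \<le> G.prob (cyl k x)"
          using that by (intro G.finite_measure_mono) (auto simp: cyl_sets)
        then show ?thesis using cyl_small[OF xE that] by linarith
      qed
      moreover have "(\<lambda>k. C * exp (- (real k * \<eta>))) \<longlonglongrightarrow> C * 0"
      proof (intro tendsto_mult tendsto_const)
        have "(\<lambda>k. exp (- \<eta>) ^ k) \<longlonglongrightarrow> 0" using \<eta>(2) by (intro LIMSEQ_realpow_zero) auto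
        then show "(\<lambda>k. exp (- (real k * \<eta>))) \<longlonglongrightarrow> 0" by (simp add: exp_of_nat_mult[symmetric])
      qed
      ultimately have "G.prob ?V \<le> C * 0" by (intro LIMSEQ_le_const) auto
      moreover have "0 \<le> C * diam_power (beta_dist \<beta>) s U"
        using C(1) by (intro mult_nonneg_nonneg) (auto simp: diam_power_def)
      moreover have "U \<inter> A N \<subseteq> ?V" using True U(1) by (auto simp: cyl_def)
      ultimately show ?thesis using V by (intro exI[of _ ?V]) auto
    next
      case False
      then obtain y where y: "y \<in> U" "y \<noteq> x" using x(1) by blast
      define diff where "diff k \<longleftrightarrow> (\<exists>y\<in>U. \<exists>z\<in>U. y k \<noteq> z k)" for k
      obtain i where "y i \<noteq> x i" using y(2) by auto
      then have "\<exists>k. diff k" using y(1) x(1) unfolding diff_def by blast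
      \<comment> \<open>The first coordinate at which two points of U differ: U lies in one cylinder
        of length k, and its diameter is at least \<open>1 / \<beta> ^ k\<close>.\<close>
      define k where "k = (LEAST k. diff k)"
      have "diff k" unfolding k_def using \<open>\<exists>k. diff k\<close> by (rule LeastI_ex)
      have same: "y i = z i" if "i < k" "y \<in> U" "z \<in> U" for i y z
      proof -
        have "\<not> diff i" using not_less_Least that(1) unfolding k_def by blast
        then show ?thesis using that(2,3) unfolding diff_def by blast
      qed
      obtain y z where yz: "y \<in> U" "z \<in> U" "y k \<noteq> z k" using \<open>diff k\<close> unfolding diff_def by blast
      have dyz: "beta_dist \<beta> y z = 1 / \<beta> ^ k" by (intro beta_dist_eq yz(3) same yz(1,2))
      then have "1 / \<beta> ^ k \<le> 1 / \<beta> ^ N" using U(2) yz by metis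
      then have "\<beta> ^ N \<le> \<beta> ^ k" using beta_gt_1 by (simp add: divide_le_eq_1 frac_le_eq divide_simps split: if_splits)
      then have "N \<le> k" using beta_gt_1 power_le_imp_le_exp by blast
      have dp: "exp (- (real k * \<eta>)) \<le> diam_power (beta_dist \<beta>) s U"
      proof (cases "s = 0")
        case True
        then show ?thesis using x(1) \<eta>(2) by (auto simp: diam_power_def)
      next
        case False
        have "(\<lambda>(y, z). beta_dist \<beta> y z) (y, z) \<le> (SUP (y, z)\<in>U \<times> U. beta_dist \<beta> y z)"
          using yz U(2) by (intro cSUP_upper bdd_aboveI2[where M = "1 / \<beta> ^ N"]) auto
        then have "1 / \<beta> ^ k \<le> diam (beta_dist \<beta>) U" using x(1) dyz by (auto simp: diam_def)
        then have "(1 / \<beta> ^ k) powr s \<le> diam (beta_dist \<beta>) U powr s"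
          using s(1) beta_gt_1 by (intro powr_mono2) auto
        moreover have "exp (- (real k * \<eta>)) \<le> exp (- (real k * (s * ln \<beta>)))"
          using \<eta>(1) by (simp add: mult_left_mono)
        ultimately have "exp (- (real k * \<eta>)) \<le> diam (beta_dist \<beta>) U powr s"
          unfolding beta_power_powr by linarith
        then show ?thesis using x(1) False by (auto simp: diam_power_def)
      qed
      have "U \<inter> A N \<subseteq> cyl k x" using U(1) same x(1) by (auto simp: cyl_def)
      moreover have "G.prob (cyl k x) \<le> C * diam_power (beta_dist \<beta>) s U"
      proof -
        have "C * exp (- (real k * \<eta>)) \<le> C * diam_power (beta_dist \<beta>) s U"
          using dp C(1) by (intro mult_left_mono) auto
        then show ?thesis using cyl_small[OF xE \<open>N \<le> k\<close>] by linarith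
      qed
      ultimately show ?thesis by (intro exI[of _ "cyl k x"]) (simp add: cyl_sets)
    qed
  qed
  let ?\<delta> = "1 / \<beta> ^ N"
  have "ennreal (G.prob (A N) / C) \<le> (\<Sum>i. ennreal (diam_power (beta_dist \<beta>) s (U i)))"
    if "U \<in> delta_covers X (beta_dist \<beta>) ?\<delta> (frequency_set \<beta> \<alpha>)" for U
  proof -
    have U: "U i \<subseteq> X" "\<forall>x\<in>U i. \<forall>y\<in>U i. beta_dist \<beta> x y \<le> 1 / \<beta> ^ N" for i
      using that by (auto simp: delta_covers_def)
    have cover: "frequency_set \<beta> \<alpha> \<subseteq> (\<Union>i. U i)" using that by (simp add: delta_covers_def)
    have "\<forall>i. \<exists>V. V \<in> sets (gibbs t) \<and> U i \<inter> A N \<subseteq> V \<and> G.prob V \<le> C * diam_power (beta_dist \<beta>) s (U i)"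
      using piece[OF U] by blast
    then obtain V where V: "\<And>i. V i \<in> sets (gibbs t)" "\<And>i. U i \<inter> A N \<subseteq> V i"
      "\<And>i. G.prob (V i) \<le> C * diam_power (beta_dist \<beta>) s (U i)"
      by metis
    have "A N \<subseteq> (\<Union>i. V i)" using A_freq[of N] cover V(2) by blast
    then have "emeasure (gibbs t) (A N) \<le> emeasure (gibbs t) (\<Union>i. V i)"
      using V(1) by (intro emeasure_mono sets.countable_UN) auto
    also have "\<dots> \<le> (\<Sum>i. emeasure (gibbs t) (V i))"
      using V(1) by (intro emeasure_subadditive_countably) auto
    also have "\<dots> \<le> (\<Sum>i. ennreal C * ennreal (diam_power (beta_dist \<beta>) s (U i)))"
    proof (intro suminf_le)
      fix i
      have "0 \<le> diam_power (beta_dist \<beta>) s (U i)" by (simp add: diam_power_def)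
      then show "emeasure (gibbs t) (V i) \<le> ennreal C * ennreal (diam_power (beta_dist \<beta>) s (U i))"
        using V(3)[of i] C(1) by (simp add: G.emeasure_eq_measure ennreal_mult[symmetric] ennreal_leI)
    qed auto
    also have "\<dots> = ennreal C * (\<Sum>i. ennreal (diam_power (beta_dist \<beta>) s (U i)))" by simp
    finally have le: "ennreal (G.prob (A N)) \<le> ennreal C * (\<Sum>i. ennreal (diam_power (beta_dist \<beta>) s (U i)))"
      by (simp add: G.emeasure_eq_measure)
    show ?thesis
    proof (cases "\<Sum>i. ennreal (diam_power (beta_dist \<beta>) s (U i))")
      case (real r)
      then have "G.prob (A N) \<le> C * r"
        using le C(1) by (simp add: ennreal_mult[symmetric])
      then show ?thesis using real C(1) by (simp add: ennreal_leI pos_divide_le_eq mult.commute)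
    qed simp
  qed
  then have "ennreal (G.prob (A N) / C)
      \<le> (INF U\<in>delta_covers X (beta_dist \<beta>) ?\<delta> (frequency_set \<beta> \<alpha>). \<Sum>i. ennreal (diam_power (beta_dist \<beta>) s (U i)))"
    by (rule INF_greatest)
  also have "\<dots> \<le> hausdorff_measure X (beta_dist \<beta>) s (frequency_set \<beta> \<alpha>)"
    unfolding hausdorff_measure_def using beta_gt_1 by (intro SUP_upper) auto
  finally show ?thesis using pA C(1) by (auto simp: ennreal_eq_0_iff divide_le_0_iff)
qed

text \<open>A point of the frequency set has prefixes in \<open>W n\<close> for all large n. Such
  words have weight at least \<open>exp (n * (t * \<alpha> - \<bar>t\<bar> * e))\<close>, so the
  partition sum bounds their number, and covers by words of length at least N cost no more than the
  tail of a geometric series.\<close>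

lemma frequency_set_hausdorff_zero:
  assumes nonneg: "0 \<le> ln (lam \<beta> t) - t * \<alpha>" and s: "ln (lam \<beta> t) - t * \<alpha> < s * ln \<beta>"
  shows "hausdorff_measure X (beta_dist \<beta>) s (frequency_set \<beta> \<alpha>) = 0"
proof -
  define d where "d = ln (lam \<beta> t) - t * \<alpha>"
  \<comment> \<open>Half of the surplus of s, scaled by \<open>\<bar>t\<bar> + 1\<close>: the
    frequency error then leaves the positive decay rate
    \<open>c = \<bar>t\<bar> * e + 2 * e\<close>.\<close>
  define e where "e = (s * ln \<beta> - d) / 2 / (\<bar>t\<bar> + 1)"
  define c where "c = s * ln \<beta> - d - \<bar>t\<bar> * e"
  have "0 < s * ln \<beta>" using nonneg s by linarith
  then have "0 < s" using beta_gt_1 by (simp add: zero_less_mult_iff)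
  have e: "0 < e" unfolding e_def using s by (intro divide_pos_pos) (auto simp: d_def)
  have "e * (\<bar>t\<bar> + 1) = (s * ln \<beta> - d) / 2"
    unfolding e_def by (rule nonzero_eq_divide_eq[THEN iffD1]) auto
  then have "c = \<bar>t\<bar> * e + 2 * e" by (simp add: c_def algebra_simps)
  then have c: "0 < c" using e by (simp add: add_nonneg_pos)
  define C where "C = (\<Sum>n. H n t q / lam \<beta> t ^ n)"
  have C: "pressure_sum n t \<le> C * lam \<beta> t ^ n" for n
    unfolding C_def by (rule pressure_sum_le_lam)
  have C_pos: "0 < C" using C[of 0] pressure_sum_pos[of 0 t] by simp
  define W where "W n = {v \<in> words n. \<bar>ones n v - real n * \<alpha>\<bar> \<le> e * real n}" for n
  have fin: "finite (W n)" for n by (simp add: W_def)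
  have card_W: "real (card (W n)) * exp (- (real n * (s * ln \<beta>))) \<le> C * exp (- c) ^ n" for n
  proof -
    have "real (card (W n)) * exp (real n * (t * \<alpha> - \<bar>t\<bar> * e)) = (\<Sum>v\<in>W n. exp (real n * (t * \<alpha> - \<bar>t\<bar> * e)))"
      by simp
    also have "\<dots> \<le> (\<Sum>v\<in>W n. H n t v)"
    proof (rule sum_mono)
      fix v assume "v \<in> W n"
      then have "\<bar>ones n v - real n * \<alpha>\<bar> \<le> e * real n" by (simp add: W_def)
      then have "\<bar>t * (ones n v - real n * \<alpha>)\<bar> \<le> \<bar>t\<bar> * (e * real n)"
        unfolding abs_mult by (intro mult_left_mono) auto
      then have "real n * (t * \<alpha> - \<bar>t\<bar> * e) \<le> t * ones n v" by (simp add: algebra_simps)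
      then show "exp (real n * (t * \<alpha> - \<bar>t\<bar> * e)) \<le> H n t v" by (simp add: H_def)
    qed
    also have "\<dots> \<le> pressure_sum n t"
      unfolding pressure_sum_def by (intro sum_mono2) (auto simp: W_def)
    also have "\<dots> \<le> C * lam \<beta> t ^ n" by (rule C)
    also have "lam \<beta> t ^ n = exp (real n * ln (lam \<beta> t))"
      by (simp only: exp_of_nat_mult exp_ln lam_pos)
    finally have "real (card (W n)) * exp (real n * (t * \<alpha> - \<bar>t\<bar> * e)) * exp (- (real n * (t * \<alpha> - \<bar>t\<bar> * e)) - real n * (s * ln \<beta>))
        \<le> C * exp (real n * ln (lam \<beta> t)) * exp (- (real n * (t * \<alpha> - \<bar>t\<bar> * e)) - real n * (s * ln \<beta>))"
      by (intro mult_right_mono) auto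
    then have "real (card (W n)) * exp (real n * (t * \<alpha> - \<bar>t\<bar> * e) + (- (real n * (t * \<alpha> - \<bar>t\<bar> * e)) - real n * (s * ln \<beta>)))
        \<le> C * exp (real n * ln (lam \<beta> t) + (- (real n * (t * \<alpha> - \<bar>t\<bar> * e)) - real n * (s * ln \<beta>)))"
      by (simp only: exp_add mult.assoc)
    moreover have "real n * (t * \<alpha> - \<bar>t\<bar> * e) + (- (real n * (t * \<alpha> - \<bar>t\<bar> * e)) - real n * (s * ln \<beta>)) = - (real n * (s * ln \<beta>))"
      by simp
    moreover have "real n * ln (lam \<beta> t) + (- (real n * (t * \<alpha> - \<bar>t\<bar> * e)) - real n * (s * ln \<beta>)) = real n * (- c)"
      by (simp add: c_def d_def algebra_simps)
    ultimately show ?thesis by (simp only: exp_of_nat_mult)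
  qed
  have summable: "summable (\<lambda>n. C * exp (- c) ^ n)"
    using c by (intro summable_mult summable_geometric) simp
  have "(INF U\<in>delta_covers X (beta_dist \<beta>) \<delta> (frequency_set \<beta> \<alpha>). \<Sum>i. ennreal (diam_power (beta_dist \<beta>) s (U i))) = 0"
    if "0 < \<delta>" for \<delta>
  proof (rule antisym)
    show "(INF U\<in>delta_covers X (beta_dist \<beta>) \<delta> (frequency_set \<beta> \<alpha>). \<Sum>i. ennreal (diam_power (beta_dist \<beta>) s (U i))) \<le> 0"
    proof (rule ennreal_le_epsilon)
      fix r :: real assume "0 < r"
      obtain N1 where N1: "\<And>n. n \<ge> N1 \<Longrightarrow> norm (\<Sum>i. C * exp (- c) ^ (i + n)) < r"
        using suminf_exist_split[OF \<open>0 < r\<close> summable] by blast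
      obtain N2 where N2: "1 / \<delta> < \<beta> ^ N2" using real_arch_pow beta_gt_1 by blast
      define N where "N = max N1 N2"
      have "\<beta> ^ N2 \<le> \<beta> ^ N"
        using beta_gt_1 by (intro power_increasing) (auto simp: N_def)
      then have "1 / \<delta> < \<beta> ^ N" using N2 by linarith
      then have N\<delta>: "1 / \<beta> ^ N \<le> \<delta>" using \<open>0 < \<delta>\<close> beta_gt_1 by (simp add: field_simps)
      have "\<exists>h. bij_betw h {0..<card (W n)} (W n)" for n using fin by (rule ex_bij_betw_nat_finite)
      then obtain h where h: "\<And>n. bij_betw (h n) {0..<card (W n)} (W n)" by metis
      \<comment> \<open>One row of cylinders for each length n + N, padded by empty sets, whose
        \<open>diam_power\<close> is 0; \<open>prod_decode\<close> arranges the rows in one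
        sequence.\<close>
      define P where "P = (\<lambda>(n, j). if j < card (W (n + N)) then cyl (n + N) (h (n + N) j) else {})"
      define U where "U i = P (prod_decode i)" for i
      have cover: "U \<in> delta_covers X (beta_dist \<beta>) \<delta> (frequency_set \<beta> \<alpha>)"
        unfolding delta_covers_def
      proof (intro CollectI conjI allI ballI)
        fix i
        obtain n j where nj: "prod_decode i = (n, j)" by fastforce
        have Ui: "U i \<subseteq> cyl (n + N) (h (n + N) j)" by (auto simp: U_def P_def nj)
        then show "U i \<subseteq> X" by (auto simp: cyl_def)
        fix x y assume "x \<in> U i" "y \<in> U i"
        then have "x \<in> cyl (n + N) (h (n + N) j)" "y \<in> cyl (n + N) (h (n + N) j)" using Ui by auto
        then have "beta_dist \<beta> x y \<le> 1 / \<beta> ^ (n + N)"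
          by (intro beta_dist_le) (simp add: cyl_def)
        also have "\<dots> \<le> 1 / \<beta> ^ N"
          using beta_gt_1 by (intro divide_left_mono power_increasing) auto
        finally show "beta_dist \<beta> x y \<le> \<delta>" using N\<delta> by linarith
      next
        show "frequency_set \<beta> \<alpha> \<subseteq> (\<Union>i. U i)"
        proof
          fix x assume "x \<in> frequency_set \<beta> \<alpha>"
          then have x: "x \<in> X" "(\<lambda>n. ones n x / real n) \<longlonglongrightarrow> \<alpha>"
            by (auto simp: frequency_set_def)
          have "\<forall>\<^sub>F n in sequentially. dist (ones n x / real n) \<alpha> < e"
            using x(2) e by (rule tendstoD)
          then have "\<forall>\<^sub>F n in sequentially. dist (ones n x / real n) \<alpha> < e \<and> max 1 N \<le> n"
            using eventually_ge_at_top by (rule eventually_conj)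
          then obtain n where n: "dist (ones n x / real n) \<alpha> < e" "1 \<le> n" "N \<le> n"
            using eventually_happens'[OF sequentially_bot] by fastforce
          have "\<bar>ones n x - real n * \<alpha>\<bar> = real n * \<bar>ones n x / real n - \<alpha>\<bar>"
          proof -
            have "ones n x - real n * \<alpha> = real n * (ones n x / real n - \<alpha>)"
              using n(2) by (simp add: field_simps)
            then show ?thesis by (simp add: abs_mult)
          qed
          also have "\<dots> \<le> real n * e" using n(1) by (intro mult_left_mono) (auto simp: dist_real_def)
          finally have "\<bar>ones n x - real n * \<alpha>\<bar> \<le> e * real n" by (simp add: mult.commute)
          moreover have "ones n (trunc n x) = ones n x" by (intro sum.cong) (auto simp: trunc_def)
          ultimately have "trunc n x \<in> W n" using trunc_in_words[OF x(1), of n] by (simp add: W_def)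
          then obtain j where j: "j < card (W n)" "h n j = trunc n x"
            using h[of n] unfolding bij_betw_def by (metis atLeastLessThan_iff imageE)
          have "x \<in> P (n - N, j)" using n(3) j x(1) by (simp add: P_def cyl_def trunc_def)
          then have "x \<in> U (prod_encode (n - N, j))" by (simp add: U_def)
          then show "x \<in> (\<Union>i. U i)" by blast
        qed
      qed
      have row: "(\<Sum>j. ennreal (diam_power (beta_dist \<beta>) s (P (n, j)))) \<le> ennreal (C * exp (- c) ^ (n + N))" for n
      proof -
        let ?k = "card (W (n + N))"
        have "(\<Sum>j. ennreal (diam_power (beta_dist \<beta>) s (P (n, j))))
            = (\<Sum>j<?k. ennreal (diam_power (beta_dist \<beta>) s (P (n, j))))"
          by (rule suminf_finite) (auto simp: P_def diam_power_def)
        also have "\<dots> \<le> (\<Sum>j<?k. ennreal (exp (- (real (n + N) * (s * ln \<beta>)))))"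
        proof (intro sum_mono ennreal_leI)
          fix j assume "j \<in> {..<?k}"
          then show "diam_power (beta_dist \<beta>) s (P (n, j)) \<le> exp (- (real (n + N) * (s * ln \<beta>)))"
            using diam_power_cyl_le[OF \<open>0 < s\<close>, of "n + N"] by (simp add: P_def del: of_nat_add)
        qed
        also have "\<dots> = ennreal (real ?k * exp (- (real (n + N) * (s * ln \<beta>))))"
          by (simp add: ennreal_mult ennreal_of_nat_eq_real_of_nat)
        also have "\<dots> \<le> ennreal (C * exp (- c) ^ (n + N))"
          using card_W by (intro ennreal_leI)
        finally show ?thesis .
      qed
      have "(\<Sum>i. ennreal (diam_power (beta_dist \<beta>) s (U i)))
          = (\<Sum>n. \<Sum>j. ennreal (diam_power (beta_dist \<beta>) s (P (n, j))))"
        unfolding U_def by (rule suminf_ennreal_2dimen) (rule refl)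
      also have "\<dots> \<le> (\<Sum>n. ennreal (C * exp (- c) ^ (n + N)))"
        by (intro suminf_le row) auto
      also have "\<dots> = ennreal (\<Sum>n. C * exp (- c) ^ (n + N))"
        using C_pos summable_ignore_initial_segment[OF summable, of N]
        by (intro suminf_ennreal2) auto
      also have "\<dots> \<le> ennreal r"
        using N1[of N] by (intro ennreal_leI) (auto simp: N_def)
      finally have "(\<Sum>i. ennreal (diam_power (beta_dist \<beta>) s (U i))) \<le> ennreal r" .
      then have "(INF U\<in>delta_covers X (beta_dist \<beta>) \<delta> (frequency_set \<beta> \<alpha>). \<Sum>i. ennreal (diam_power (beta_dist \<beta>) s (U i))) \<le> ennreal r"
        by (rule INF_lower2[OF cover])
      then show "(INF U\<in>delta_covers X (beta_dist \<beta>) \<delta> (frequency_set \<beta> \<alpha>). \<Sum>i. ennreal (diam_power (beta_dist \<beta>) s (U i))) \<le> 0 + ennreal r"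
        by simp
    qed
  qed simp
  then show ?thesis unfolding hausdorff_measure_def by (simp add: SUP_eq_const)
qed

lemma frequency_set_hausdorff_dim:
  assumes sub: "\<And>s. ln (lam \<beta> t) + (s - t) * \<alpha> \<le> ln (lam \<beta> s)"
    and nonneg: "0 \<le> ln (lam \<beta> t) - t * \<alpha>"
  shows "hausdorff_dim X (beta_dist \<beta>) (frequency_set \<beta> \<alpha>) = ereal ((ln (lam \<beta> t) - t * \<alpha>) / ln \<beta>)"
proof (rule hausdorff_dim_eqI)
  have ln_pos: "0 < ln \<beta>" using beta_gt_1 by simp
  then show "0 \<le> (ln (lam \<beta> t) - t * \<alpha>) / ln \<beta>" using nonneg by simp
  show "hausdorff_measure X (beta_dist \<beta>) s (frequency_set \<beta> \<alpha>) \<noteq> 0"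
    if "0 \<le> s" "s < (ln (lam \<beta> t) - t * \<alpha>) / ln \<beta>" for s
    using that ln_pos by (intro frequency_set_hausdorff_pos[OF sub]) (auto simp: pos_less_divide_eq)
  show "hausdorff_measure X (beta_dist \<beta>) s (frequency_set \<beta> \<alpha>) = 0"
    if "(ln (lam \<beta> t) - t * \<alpha>) / ln \<beta> < s" for s
    using that ln_pos by (intro frequency_set_hausdorff_zero[OF nonneg]) (auto simp: pos_divide_less_eq)
qed

end

theorem theorem4p5:
  fixes \<beta> t \<alpha> :: real and \<mu> :: "(nat \<Rightarrow> nat) measure"
  assumes "1 < \<beta>" and "\<beta> \<le> 2"
    and "equilibrium_state (beta_shift \<beta>) shift (\<lambda>x. t * indicator (one_cylinder \<beta>) x) \<mu>"
    and "\<alpha> = (\<integral>x. indicator (one_cylinder \<beta>) x \<partial>\<mu>)"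
  shows "\<alpha> = 1 / F \<beta> t *
           (\<Sum>n. (real (\<Sum>i = 1..Suc n. quasi_greedy_digit \<beta> i) - 1)
                 * (real (quasi_greedy_digit \<beta> (Suc n)) * H n t (quasi_greedy_seq \<beta>)
                    / lam \<beta> t ^ Suc n))
    \<and> hausdorff_dim (beta_shift \<beta>) (beta_dist \<beta>) (frequency_set \<beta> \<alpha>)
        = ereal ((ln (lam \<beta> t) - t * \<alpha>) / ln \<beta>)
    \<and> (\<forall>n0\<ge>2. \<beta> < 2 \<and> (beta_map \<beta> ^^ (n0 - 1)) 1 = 1 / \<beta> \<longrightarrow>
         \<alpha> = 1 / F_hat \<beta> t n0 *
           (\<Sum>l = 1..n0 - 1.
              real (greedy_digit \<beta> (l + 1) 1) * H l t (greedy_seq \<beta> 1) / lam \<beta> t ^ l *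
              (\<Sum>n = 1..n0 - l. real (greedy_digit \<beta> (n + l) 1)
                   * H (n - 1) t ((shift ^^ l) (greedy_seq \<beta> 1)) / lam \<beta> t ^ n)))"
proof -
  interpret beta_expansion \<beta> by unfold_locales (use assms(1,2) in auto)
  note sub = equilibrium_subgradient[OF assms(3,4)]
  show ?thesis
    using frequency_formula[OF sub(1)] frequency_set_hausdorff_dim[OF sub] simple_frequency_formula[OF sub(1)]
    by (intro conjI allI impI) auto
qed

end
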